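(* Let $\beta>0$ and consider catalytic binary branching Brownian motion with branching rate $\beta\delta_0(\cdot)$ started from one particle at $0$. Let $f,g:\mathbb{R}\to\mathbb{R}$ be non-negative measurable functions, and for a non-negative measurable function $h:\mathbb{R}\to\mathbb{R}$ define $S_h(t):=E\big(\sum_{u\in N_t}h(X^u_t)\big)$, $t\ge0$. Then for all $t\ge0$, $$E\Big[\Big(\sum_{u\in N_t}f(X^u_t)\Big)\Big(\sum_{u\in N_t}g(X^u_t)\Big)\Big]=S_{fg}(t)+2\int_0^tS_f(t-s)\,S_g(t-s)\,\frac{\partial}{\partial s}\Big(2\Phi(\beta\sqrt{s})\,\mathrm{e}^{\frac{\beta^2}{2}s}\Big)\mathrm{d}s,$$ where $\Phi(x)=\frac{1}{\sqrt{2\pi}}\int_{-\infty}^x\mathrm{e}^{-w^2/2}\,\mathrm{d}w$ is the standard normal cumulative distribution function.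
   Context: Model (catalytic binary branching Brownian motion with branching rate $\beta\delta_0$, where $\beta>0$ is a constant). The process starts with a single particle at $0$ whose path $(X_t)_{t\ge0}$ is a standard one-dimensional Brownian motion. Let $(L_t)_{t\ge0}$ be the local time at $0$ of $X$, formally $L_t=\int_0^t\delta_0(X_s)\,\mathrm{d}s$ (i.e. $L_t=\lim_{\epsilon\downarrow0}\frac{1}{2\epsilon}\int_0^t\mathbf{1}_{\{|X_s|<\epsilon\}}\mathrm{d}s$). At a random time $T$ satisfying $\mathbb{P}(T>t\mid (X_s)_{s\ge0})=\mathrm{e}^{-\beta L_t}$ for all $t \geq 0$, the particle dies and is replaced at its current position by two new particles, which independently of each other repeat the behaviour of their parent (moving as Brownian motions until their own split times, defined in the same way, and so on). $P$ denotes the law of this process and $E$ the corresponding expectation. $N_t$ is the set of particles alive at time $t$; for $u\in N_t$, $X^u_t$ is its position at time $t$. Expectations of non-negative quantities take values in $[0,\infty]$. *)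

theory Defs
  imports "HOL-Probability.Probability" "HOL-Library.Sublist"
begin

locale std_brownian_motion = prob_space M for M :: "'w measure" +
  fixes W :: "real \<Rightarrow> 'w \<Rightarrow> real"
  assumes W_measurable: "\<And>t. 0 \<le> t \<Longrightarrow> W t \<in> borel_measurable M"
    and W_zero: "\<And>\<omega>. \<omega> \<in> space M \<Longrightarrow> W 0 \<omega> = 0"
    and W_continuous: "\<And>\<omega>. \<omega> \<in> space M \<Longrightarrow> continuous_on {0..} (\<lambda>t. W t \<omega>)"
    and W_increment: "\<And>s t. 0 \<le> s \<Longrightarrow> s < t \<Longrightarrow>
      distributed M lborel (\<lambda>\<omega>. W t \<omega> - W s \<omega>) (normal_density 0 (sqrt (t - s)))"
    and W_indep: "\<And>(\<tau> :: nat \<Rightarrow> real) n. 0 \<le> \<tau> 0 \<Longrightarrow> mono \<tau> \<Longrightarrow>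
      indep_vars (\<lambda>_. borel) (\<lambda>i \<omega>. W (\<tau> (Suc i)) \<omega> - W (\<tau> i) \<omega>) {..<n}"

(* Pathwise limit of the normalised occupation times of (-\<epsilon>, \<epsilon>).  For a Brownian path the limit
   exists almost surely; where it does not exist, Lim is an unspecified value. *)
definition local_time :: "(real \<Rightarrow> real) \<Rightarrow> real \<Rightarrow> real" where
  "local_time x t =
     Lim (at_right 0) (\<lambda>\<epsilon>. 1 / (2 * \<epsilon>) * (LINT s:{0..t}|lborel. indicator {y. \<bar>y\<bar> < \<epsilon>} (x s)))"

(* Particles are Ulam-Harris labels with the youngest generation first: [] is the initial particle
   and False # u, True # u are the two children of u, so that the descendants of u (u included) are
   the w with suffix u w.  The process is driven by
     B u a \<omega>, the displacement of u from its place of birth at age a (defined for all a \<ge> 0, also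
       beyond the death of u), and
     T u \<omega>, the lifespan of u, i.e. its age when it splits. *)

primrec birth_time :: "(bool list \<Rightarrow> 'w \<Rightarrow> real) \<Rightarrow> bool list \<Rightarrow> 'w \<Rightarrow> real" where
  "birth_time T [] \<omega> = 0"
| "birth_time T (i # u) \<omega> = birth_time T u \<omega> + T u \<omega>"

primrec birth_place ::
  "(bool list \<Rightarrow> real \<Rightarrow> 'w \<Rightarrow> real) \<Rightarrow> (bool list \<Rightarrow> 'w \<Rightarrow> real) \<Rightarrow> bool list \<Rightarrow> 'w \<Rightarrow> real" where
  "birth_place B T [] \<omega> = 0"
| "birth_place B T (i # u) \<omega> = birth_place B T u \<omega> + B u (T u \<omega>) \<omega>"

definition path ::
  "(bool list \<Rightarrow> real \<Rightarrow> 'w \<Rightarrow> real) \<Rightarrow> (bool list \<Rightarrow> 'w \<Rightarrow> real) \<Rightarrow> bool list \<Rightarrow> 'w \<Rightarrow> real \<Rightarrow> real" where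
  "path B T u \<omega> a = birth_place B T u \<omega> + B u a \<omega>"

definition alive :: "(bool list \<Rightarrow> 'w \<Rightarrow> real) \<Rightarrow> real \<Rightarrow> 'w \<Rightarrow> bool list set" where
  "alive T t \<omega> = {u. birth_time T u \<omega> \<le> t \<and> t < birth_time T u \<omega> + T u \<omega>}"

definition position ::
  "(bool list \<Rightarrow> real \<Rightarrow> 'w \<Rightarrow> real) \<Rightarrow> (bool list \<Rightarrow> 'w \<Rightarrow> real) \<Rightarrow> bool list \<Rightarrow> real \<Rightarrow> 'w \<Rightarrow> real" where
  "position B T u t \<omega> = path B T u \<omega> (t - birth_time T u \<omega>)"

(* Everything that is not decided by the splitting of u or of its descendants: the driving motions
   of all particles and the lifespans of all particles that do not descend from u. *)
definition environment ::
  "'w measure \<Rightarrow> (bool list \<Rightarrow> real \<Rightarrow> 'w \<Rightarrow> real) \<Rightarrow> (bool list \<Rightarrow> 'w \<Rightarrow> real) \<Rightarrow> bool list \<Rightarrow> 'w measure" where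
  "environment M B T u = sigma (space M)
     ({B v a -` A \<inter> space M | v a A. 0 \<le> a \<and> A \<in> sets borel} \<union>
      {T w -` A \<inter> space M | w A. \<not> suffix u w \<and> A \<in> sets borel})"

(* Conditioning on the whole environment, rather than only on the path of u itself, expresses that
   given their paths the particles split independently of each other and of the past; together with
   T_split for shorter labels, B_indep and B_brownian it determines the joint law of B and T.
   The path of u in T_split starts from the place of birth of u, so the relevant local time is that
   of the actual position of u at the origin. *)
locale catalytic_bbm = prob_space M for M :: "'w measure" +
  fixes \<beta> :: real
    and B :: "bool list \<Rightarrow> real \<Rightarrow> 'w \<Rightarrow> real"
    and T :: "bool list \<Rightarrow> 'w \<Rightarrow> real"
  assumes B_brownian: "\<And>u. std_brownian_motion M (B u)"
    and B_indep: "indep_vars (\<lambda>_. PiM {0..} (\<lambda>_. borel)) (\<lambda>u \<omega>. \<lambda>a\<in>{0..}. B u a \<omega>) UNIV"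
    and T_measurable: "\<And>u. T u \<in> borel_measurable M"
    and T_nonneg: "\<And>u \<omega>. \<omega> \<in> space M \<Longrightarrow> 0 \<le> T u \<omega>"
    and T_split: "\<And>u t. 0 \<le> t \<Longrightarrow>
      AE \<omega> in M. real_cond_exp M (environment M B T u) (indicator {\<omega>' \<in> space M. T u \<omega>' > t}) \<omega>
        = exp (- \<beta> * local_time (path B T u \<omega>) t)"

(* The sum of h over the positions of the particles alive at time t, in [0,\<infinity>], so that no
   convention is needed for infinitely many particles. *)
definition particle_sum ::
  "(bool list \<Rightarrow> real \<Rightarrow> 'w \<Rightarrow> real) \<Rightarrow> (bool list \<Rightarrow> 'w \<Rightarrow> real) \<Rightarrow> (real \<Rightarrow> real) \<Rightarrow> real \<Rightarrow> 'w \<Rightarrow> ennreal" where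
  "particle_sum B T h t \<omega> = (\<Sum>\<^sub>\<infinity>u\<in>alive T t \<omega>. ennreal (h (position B T u t \<omega>)))"

definition mean_sum ::
  "'w measure \<Rightarrow> (bool list \<Rightarrow> real \<Rightarrow> 'w \<Rightarrow> real) \<Rightarrow> (bool list \<Rightarrow> 'w \<Rightarrow> real) \<Rightarrow>
    (real \<Rightarrow> real) \<Rightarrow> real \<Rightarrow> ennreal" where
  "mean_sum M B T h t = (\<integral>\<^sup>+\<omega>. particle_sum B T h t \<omega> \<partial>M)"

definition std_normal_cdf :: "real \<Rightarrow> real" where
  "std_normal_cdf x = 1 / sqrt (2 * pi) * (LINT w:{..x}|lborel. exp (- (w\<^sup>2) / 2))"

end

theory Submission
  imports Defs
begin

text \<open>The lifespan of a particle depends on its path only through its local time at 0, which increases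
  only at zeros of the path; hence particles split at 0, all birth places vanish almost surely, and the
  pairs (motion, lifespan) are independent and identically distributed over the labels. Two particles
  alive at time \<open>t\<close> are equal or descend from different children of a last common ancestor \<open>w\<close>, and given
  its split time \<open>s\<close> the two subtrees are independent copies of the process run for time \<open>t - s\<close>. This
  gives the formula with the measure \<open>\<nu>\<close> (the expected number of splits) in place of the derivative.

  It remains to show \<open>\<nu> [0, t] = m t - 1\<close> with \<open>m t = 2 \<Phi>(\<beta> \<surd>t) exp (\<beta>\<^sup>2 t / 2)\<close>. An \<open>L\<^sup>2\<close> estimate for
  occupation times shows that the local time exists and that the Feynman--Kac equation survives the limit: the law \<open>F\<close>
  of a lifespan satisfies \<open>F + q * F = q\<close> with \<open>q\<close> of density \<open>\<beta> / \<surd>(2 \<pi> s)\<close>. Since \<open>m = 1 + q * m\<close>,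
  the function \<open>m - 1\<close> solves the renewal equation of \<open>\<nu>\<close>, and iterating that equation identifies the two.\<close>

subsection \<open>Dyadic codes of paths\<close>

text \<open>Laws on the product over all times see neither continuity nor integrals over time. A
  continuous path is fixed by its values at dyadic times, and on that countable product a law is
  settled by cylinders. What obstructs a direct use of independence is that a lifespan is governed
  by the local time of the actual position, so the law of a pair (motion, lifespan) depends on the
  birth place. Only once the birth places are known to vanish are the pairs identically distributed.
  The analysis rests on one estimate: a difference of two probability densities on [-\<eta>, \<eta>]
  has an occupation time of size \<eta>^(1/4) in mean. It yields local time, makes the shape of the
  approximating bump irrelevant, and absorbs the spatial shift of the bump in the Feynman--Kac
  equation. The kernel q is singular at 0, but q * q is the constant \<beta>^2 / 2 on the positive
  half-line; this brings Gronwall's estimate into reach. Sums over particles and convolutions live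
  in [0,\<infinity>], so that Tonelli applies without integrability of f and g; the price is that
  equations must be stated and compared without subtraction.\<close>

definition dyadic :: "nat \<times> nat \<Rightarrow> real" where
  "dyadic j = real (snd j) / 2 ^ fst j"

abbreviation code_space :: "(nat \<times> nat \<Rightarrow> real) measure" where
  "code_space \<equiv> PiM UNIV (\<lambda>_. borel)"

definition path_code :: "(real \<Rightarrow> 'w \<Rightarrow> real) \<Rightarrow> 'w \<Rightarrow> nat \<times> nat \<Rightarrow> real" where
  "path_code X \<omega> j = X (dyadic j) \<omega>"

text \<open>The limit runs along the dyadics just above \<open>a\<close>. A \<open>lim\<close> of
  measurable functions is measurable whether or not it converges, so evaluation is measurable on all
  codes, including those that no continuous path produces.\<close>

definition code_eval :: "(nat \<times> nat \<Rightarrow> real) \<Rightarrow> real \<Rightarrow> real" where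
  "code_eval c a = lim (\<lambda>n. c (n, nat \<lceil>2 ^ n * a\<rceil>))"

lemma dyadic_nonneg [simp]: "0 \<le> dyadic j"
  by (simp add: dyadic_def)

lemma measurable_code_eval [measurable]:
  "(\<lambda>p. code_eval (fst p) (snd p)) \<in> borel_measurable (code_space \<Otimes>\<^sub>M borel)"
proof -
  have "(\<lambda>p. fst p (n, nat \<lceil>2 ^ n * snd p\<rceil>)) \<in> borel_measurable (code_space \<Otimes>\<^sub>M (borel::real measure))"
    for n
    \<comment> \<open>The coordinate that is read depends on the time, but only through a natural
      number; countably many fixed coordinates suffice.\<close>
    by (rule measurable_compose_countable[where f = "\<lambda>k p. fst p (n, k)"]) auto
  then show ?thesis
    unfolding code_eval_def by (rule borel_measurable_lim_metric)
qed

lemma measurable_code_eval' [measurable (raw)]: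
  assumes "f \<in> measurable N code_space" "g \<in> borel_measurable N"
  shows "(\<lambda>x. code_eval (f x) (g x)) \<in> borel_measurable N"
  using measurable_compose[OF measurable_Pair[OF assms] measurable_code_eval] by simp

lemma measurable_path_code:
  assumes "\<And>t. 0 \<le> t \<Longrightarrow> X t \<in> borel_measurable M"
  shows "path_code X \<in> measurable M code_space"
  by (rule measurable_PiM_single') (auto simp: path_code_def intro!: assms)

lemma dyadic_ceiling_tendsto:
  fixes a :: real
  assumes "0 \<le> a"
  shows "(\<lambda>n. dyadic (n, nat \<lceil>2 ^ n * a\<rceil>)) \<longlonglongrightarrow> a"
proof (rule tendsto_sandwich)
  show "\<forall>\<^sub>F n in sequentially. a \<le> dyadic (n, nat \<lceil>2 ^ n * a\<rceil>)"
    by (auto simp: dyadic_def field_simps of_nat_ceiling)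
  have "dyadic (n, nat \<lceil>2 ^ n * a\<rceil>) \<le> a + 1 / 2 ^ n" for n
  proof -
    have "real (nat \<lceil>2 ^ n * a\<rceil>) \<le> 2 ^ n * a + 1"
      using assms by simp
    then show ?thesis
      by (simp add: dyadic_def field_simps)
  qed
  then show "\<forall>\<^sub>F n in sequentially. dyadic (n, nat \<lceil>2 ^ n * a\<rceil>) \<le> a + 1 / 2 ^ n"
    by simp
  have "(\<lambda>n. a + (1 / 2) ^ n) \<longlonglongrightarrow> a + 0"
    by (intro tendsto_intros LIMSEQ_realpow_zero) auto
  then show "(\<lambda>n. a + 1 / 2 ^ n) \<longlonglongrightarrow> a"
    by (simp add: power_one_over)
qed simp

lemma code_eval_path_code:
  assumes "continuous_on {0..} (\<lambda>t. X t \<omega>)" "0 \<le> a"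
  shows "code_eval (path_code X \<omega>) a = X a \<omega>"
proof -
  have "(\<lambda>n. X (dyadic (n, nat \<lceil>2 ^ n * a\<rceil>)) \<omega>) \<longlonglongrightarrow> X a \<omega>"
    by (rule continuous_on_tendsto_compose[OF assms(1) dyadic_ceiling_tendsto[OF assms(2)]])
      (use assms in auto)
  then show ?thesis
    by (simp add: code_eval_def path_code_def limI)
qed

section \<open>Gaussian increments and the law of the path code\<close>

text \<open>Variance 0 is the point mass: increments over repeated grid times occur, and so does
  time 0 in the Markov property. A density would not do there, since
  \<open>normal_density 0 0\<close> is identically 0.\<close>

definition gauss :: "real \<Rightarrow> real measure" where
  "gauss v = (if v = 0 then return borel 0 else density lborel (\<lambda>x. ennreal (normal_density 0 (sqrt v) x)))"

lemma sets_gauss [simp, measurable_cong]: "sets (gauss v) = sets borel"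
  by (simp add: gauss_def)

lemma prob_space_gauss: "0 \<le> v \<Longrightarrow> prob_space (gauss v)"
  by (auto simp: gauss_def intro!: prob_space_return prob_space_normal_density)

context std_brownian_motion
begin

lemma W_increment_law:
  assumes "0 \<le> s" "s \<le> t"
  shows "distr M borel (\<lambda>\<omega>. W t \<omega> - W s \<omega>) = gauss (t - s)"
proof (cases "s = t")
  case True
  have "distr M borel (\<lambda>\<omega>. 0::real) = return borel 0"
    by (rule measure_eqI) (auto simp: emeasure_distr emeasure_space_1 indicator_def)
  then show ?thesis using True by (simp add: gauss_def)
next
  case False
  have "distr M lborel (\<lambda>\<omega>. W t \<omega> - W s \<omega>) = distr M borel (\<lambda>\<omega>. W t \<omega> - W s \<omega>)"
    by (rule distr_cong) auto
  with False assms W_increment[of s t] show ?thesis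
    by (simp add: distributed_def gauss_def)
qed

lemma W_law: "0 \<le> t \<Longrightarrow> distr M borel (W t) = gauss t"
  using W_increment_law[of 0 t] W_zero
  by (simp cong: distr_cong)

text \<open>Covers the empty list of increments; the characterisation of independence by product
  laws is applied to nonempty index sets only.\<close>

lemma return_empty_PiM:
  "return (PiM {} (\<lambda>_. borel)) (\<lambda>_. undefined) = PiM {} (N :: 'i \<Rightarrow> real measure)"
proof (rule measure_eqI)
  fix A :: "('i \<Rightarrow> real) set"
  assume "A \<in> sets (return (PiM {} (\<lambda>_. borel)) (\<lambda>_. undefined))"
  then have "A = {} \<or> A = {\<lambda>_. undefined}"
    by (auto simp: sets_PiM_empty)
  then show "emeasure (return (PiM {} (\<lambda>_. borel)) (\<lambda>_. undefined)) A = emeasure (PiM {} N) A"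
    by (auto simp: PiM_empty sets_PiM_empty)
qed (simp add: sets_PiM_empty)

lemma increments_law:
  fixes \<tau> :: "nat \<Rightarrow> real"
  assumes "0 \<le> \<tau> 0" "mono \<tau>"
  shows "distr M (PiM {..<n} (\<lambda>_. borel)) (\<lambda>\<omega>. \<lambda>i\<in>{..<n}. W (\<tau> (Suc i)) \<omega> - W (\<tau> i) \<omega>)
    = PiM {..<n} (\<lambda>i. gauss (\<tau> (Suc i) - \<tau> i))"
proof -
  have \<tau>: "0 \<le> \<tau> i" "\<tau> i \<le> \<tau> (Suc i)" for i
    using assms monoD[OF assms(2), of 0 i] monoD[OF assms(2), of i "Suc i"] by auto
  have "distr M (PiM {..<n} (\<lambda>_. borel)) (\<lambda>\<omega>. \<lambda>i\<in>{..<n}. W (\<tau> (Suc i)) \<omega> - W (\<tau> i) \<omega>)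
    = PiM {..<n} (\<lambda>i. distr M borel (\<lambda>\<omega>. W (\<tau> (Suc i)) \<omega> - W (\<tau> i) \<omega>))"
  proof (cases "n = 0")
    case True
    then show ?thesis by (simp add: restrict_def return_empty_PiM)

  next
    case False
    have "W (\<tau> (Suc i)) \<in> borel_measurable M" "W (\<tau> i) \<in> borel_measurable M" for i
      using \<tau>[of i] by (auto intro!: W_measurable)
    then show ?thesis
      by (intro iffD1[OF indep_vars_iff_distr_eq_PiM' W_indep[OF assms]]) (use False in auto)
  qed
  also have "\<dots> = PiM {..<n} (\<lambda>i. gauss (\<tau> (Suc i) - \<tau> i))"
    using \<tau> by (intro PiM_cong) (auto simp: W_increment_law)
  finally show ?thesis .
qed

lemma path_code_measurable [measurable]: "path_code W \<in> measurable M code_space"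
  by (rule measurable_path_code) (rule W_measurable)

lemma code_eval_W: "\<omega> \<in> space M \<Longrightarrow> 0 \<le> a \<Longrightarrow> code_eval (path_code W \<omega>) a = W a \<omega>"
  by (intro code_eval_path_code W_continuous)

end

text \<open>For n \<le> N the dyadic k / 2^n is point number k * 2^(N - n) of the grid with spacing
  1 / 2^N, so the path at that time is the sum of that many grid increments.\<close>

definition grid_sums :: "nat \<Rightarrow> (nat \<Rightarrow> real) \<Rightarrow> nat \<times> nat \<Rightarrow> real" where
  "grid_sums N d j = (\<Sum>i<snd j * 2 ^ (N - fst j). d i)"

lemma grid_sums_increments:
  assumes "fst j \<le> N" "snd j * 2 ^ (N - fst j) \<le> K"
  shows "grid_sums N (\<lambda>i\<in>{..<K}. X (s + real (Suc i) / 2 ^ N) - X (s + real i / 2 ^ N)) j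
    = X (s + dyadic j) - X s"
proof -
  have "grid_sums N (\<lambda>i\<in>{..<K}. X (s + real (Suc i) / 2 ^ N) - X (s + real i / 2 ^ N)) j
    = (\<Sum>i<snd j * 2 ^ (N - fst j). X (s + real (Suc i) / 2 ^ N) - X (s + real i / 2 ^ N))"
    unfolding grid_sums_def using assms by (intro sum.cong) auto
  also have "\<dots> = X (s + real (snd j * 2 ^ (N - fst j)) / 2 ^ N) - X (s + real 0 / 2 ^ N)"
    by (rule sum_lessThan_telescope)
  also have "real (snd j * 2 ^ (N - fst j)) / 2 ^ N = dyadic j"
    using assms(1) by (simp add: dyadic_def field_simps flip: power_add)
  also have "X (s + real 0 / 2 ^ N) = X s" by simp
  finally show ?thesis .
qed

lemma measurable_grid_sums:
  assumes "\<And>j. j \<in> J \<Longrightarrow> snd j * 2 ^ (N - fst j) \<le> K"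
  shows "(\<lambda>d. \<lambda>j\<in>J. grid_sums N d j) \<in> measurable (PiM {..<K} (\<lambda>_. borel)) (PiM J (\<lambda>_. borel))"
proof (rule measurable_restrict)
  fix j assume "j \<in> J"
  with assms have *: "snd j * 2 ^ (N - fst j) \<le> K" by auto
  show "(\<lambda>d. grid_sums N d j) \<in> borel_measurable (PiM {..<K} (\<lambda>_. borel))"
    unfolding grid_sums_def
    by (rule borel_measurable_sum, rule measurable_component_singleton) (use * in auto)
qed

lemma finite_grid:
  assumes "finite (J :: (nat \<times> nat) set)"
  obtains N K where "\<And>j. j \<in> J \<Longrightarrow> fst j \<le> N" "\<And>j. j \<in> J \<Longrightarrow> snd j * 2 ^ (N - fst j) \<le> K"
proof -
  define N where "N = Max (insert 0 (fst ` J))"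
  define K where "K = Max (insert 0 ((\<lambda>j. snd j * 2 ^ (N - fst j)) ` J))"
  show ?thesis
    by (rule that[of N K]) (use assms in \<open>auto simp: N_def K_def intro!: Max_ge\<close>)
qed

lemma (in std_brownian_motion) mono_grid: "mono (\<lambda>i. real i / 2 ^ N)"
  by (auto simp: mono_def divide_right_mono)

text \<open>Finitely many dyadic times are read off the independent increments of one common grid.
  The right-hand side is built from Gaussian measures and no longer mentions \<open>W\<close>,
  whence all Brownian motions have the same code law.\<close>

lemma (in std_brownian_motion) path_code_cylinder:
  assumes "finite J" "\<And>j. j \<in> J \<Longrightarrow> fst j \<le> N" "\<And>j. j \<in> J \<Longrightarrow> snd j * 2 ^ (N - fst j) \<le> K"
    and A: "\<And>j. j \<in> J \<Longrightarrow> A j \<in> sets borel"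
  shows "emeasure (distr M code_space (path_code W)) (prod_emb UNIV (\<lambda>_. borel) J (Pi\<^sub>E J A))
    = emeasure (PiM {..<K} (\<lambda>i. gauss (1 / 2 ^ N)))
        ((\<lambda>d. \<lambda>j\<in>J. grid_sums N d j) -` Pi\<^sub>E J A \<inter> space (PiM {..<K} (\<lambda>_. borel)))"
proof -
  let ?D = "\<lambda>\<omega>. \<lambda>i\<in>{..<K}. W (real (Suc i) / 2 ^ N) \<omega> - W (real i / 2 ^ N) \<omega>"
  have D [measurable]: "?D \<in> measurable M (PiM {..<K} (\<lambda>_. borel))"
    by (intro measurable_restrict borel_measurable_diff W_measurable) auto
  have law: "distr M (PiM {..<K} (\<lambda>_. borel)) ?D = PiM {..<K} (\<lambda>i. gauss (1 / 2 ^ N))"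
    using increments_law[OF _ mono_grid, of N K] by (simp add: diff_divide_distrib[symmetric])
  have "emeasure (distr M code_space (path_code W)) (prod_emb UNIV (\<lambda>_. borel) J (Pi\<^sub>E J A))
     = emeasure M (path_code W -` prod_emb UNIV (\<lambda>_. borel) J (Pi\<^sub>E J A) \<inter> space M)"
    using A assms(1) by (intro emeasure_distr sets_PiM_I) auto
  also have "path_code W -` prod_emb UNIV (\<lambda>_. borel) J (Pi\<^sub>E J A) \<inter> space M
    = ?D -` ((\<lambda>d. \<lambda>j\<in>J. grid_sums N d j) -` Pi\<^sub>E J A \<inter> space (PiM {..<K} (\<lambda>_. borel))) \<inter> space M"
  proof -
    have "grid_sums N (?D \<omega>) j = path_code W \<omega> j" if "j \<in> J" "\<omega> \<in> space M" for j \<omega>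
      using grid_sums_increments[of j N K "\<lambda>t. W t \<omega>" 0] assms(2,3)[OF that(1)] W_zero[OF that(2)]
      by (simp add: path_code_def)
    then have "(\<lambda>j\<in>J. grid_sums N (?D \<omega>) j) \<in> Pi\<^sub>E J A \<longleftrightarrow> path_code W \<omega> \<in> prod_emb UNIV (\<lambda>_. borel) J (Pi\<^sub>E J A)"
      if "\<omega> \<in> space M" for \<omega>
      using that by (auto simp: prod_emb_def PiE_iff)
    then show ?thesis
      using measurable_space[OF D] by auto
  qed
  also have "emeasure M \<dots> = emeasure (distr M (PiM {..<K} (\<lambda>_. borel)) ?D)
      ((\<lambda>d. \<lambda>j\<in>J. grid_sums N d j) -` Pi\<^sub>E J A \<inter> space (PiM {..<K} (\<lambda>_. borel)))"
    using A assms(1)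
    by (intro emeasure_distr[symmetric] D measurable_sets[OF measurable_grid_sums[OF assms(3)]])
       (auto intro!: sets_PiM_I_finite)
  finally show ?thesis
    unfolding law .
qed

lemma path_code_law_unique:
  assumes "std_brownian_motion M X" "std_brownian_motion M Y"
  shows "distr M code_space (path_code X) = distr M code_space (path_code Y)"
proof (rule measure_eqI_PiM_infinite)
  interpret X: std_brownian_motion M X by fact
  interpret Y: std_brownian_motion M Y by fact
  show "finite_measure (distr M code_space (path_code X))"
    by (rule X.finite_measure_distr) simp
  fix A and J :: "(nat \<times> nat) set"
  assume J: "finite J" and A: "\<And>j. j \<in> J \<Longrightarrow> A j \<in> sets (borel :: real measure)"
  obtain N K where "\<And>j. j \<in> J \<Longrightarrow> fst j \<le> N" "\<And>j. j \<in> J \<Longrightarrow> snd j * 2 ^ (N - fst j) \<le> K"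
    using finite_grid[OF J] by blast
  note * = this
  show "emeasure (distr M code_space (path_code X)) (prod_emb UNIV (\<lambda>_. borel) J (Pi\<^sub>E J A)) =
    emeasure (distr M code_space (path_code Y)) (prod_emb UNIV (\<lambda>_. borel) J (Pi\<^sub>E J A))"
    using X.path_code_cylinder[OF J * A] Y.path_code_cylinder[OF J * A] by simp
qed simp_all

section \<open>The simple Markov property\<close>

context std_brownian_motion
begin

lemma std_brownian_motion_shift:
  assumes "0 \<le> s"
  shows "std_brownian_motion M (\<lambda>r \<omega>. W (s + r) \<omega> - W s \<omega>)"
proof unfold_locales
  show "(\<lambda>\<omega>. W (s + t) \<omega> - W s \<omega>) \<in> borel_measurable M" if "0 \<le> t" for t
    using that assms by (intro borel_measurable_diff W_measurable) auto
  show "W (s + 0) \<omega> - W s \<omega> = 0" for \<omega>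
    by simp
  show "continuous_on {0..} (\<lambda>t. W (s + t) \<omega> - W s \<omega>)" if "\<omega> \<in> space M" for \<omega>
    by (intro continuous_intros continuous_on_compose2[OF W_continuous[OF that]]) (use assms in auto)
  show "distributed M lborel (\<lambda>\<omega>. (W (s + t) \<omega> - W s \<omega>) - (W (s + r) \<omega> - W s \<omega>))
     (normal_density 0 (sqrt (t - r)))" if "0 \<le> r" "r < t" for r t
    using W_increment[of "s + r" "s + t"] that assms by simp
  show "indep_vars (\<lambda>_. borel) (\<lambda>i \<omega>. (W (s + \<tau> (Suc i)) \<omega> - W s \<omega>) - (W (s + \<tau> i) \<omega> - W s \<omega>)) {..<n}"
    if "0 \<le> \<tau> 0" "mono \<tau>" for \<tau> :: "nat \<Rightarrow> real" and n
    using W_indep[of "\<lambda>i. s + \<tau> i" n] that assms by (simp add: mono_def)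
qed

lemma shift_indep_cylinder:
  assumes "0 \<le> s" and J: "finite J" and A: "A \<in> sets borel" "\<And>j. j \<in> J \<Longrightarrow> C j \<in> sets borel"
  shows "prob {\<omega> \<in> space M. W s \<omega> \<in> A \<and> (\<forall>j\<in>J. W (s + dyadic j) \<omega> - W s \<omega> \<in> C j)}
    = prob {\<omega> \<in> space M. W s \<omega> \<in> A} * prob {\<omega> \<in> space M. \<forall>j\<in>J. W (s + dyadic j) \<omega> - W s \<omega> \<in> C j}"
proof -
  obtain N K where NK: "\<And>j. j \<in> J \<Longrightarrow> fst j \<le> N" "\<And>j. j \<in> J \<Longrightarrow> snd j * 2 ^ (N - fst j) \<le> K"
    using finite_grid[OF J] by blast
  \<comment> \<open>The first increment of this grid is \<open>W s\<close> and all later ones lie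
    after \<open>s\<close>, so the two events of the claim depend on disjoint blocks of independent
    increments.\<close>
  define \<tau> :: "nat \<Rightarrow> real" where "\<tau> i = (case i of 0 \<Rightarrow> 0 | Suc k \<Rightarrow> s + real k / 2 ^ N)" for i
  have \<tau>: "0 \<le> \<tau> 0" "mono \<tau>"
    using assms(1) by (auto simp: \<tau>_def mono_def divide_right_mono split: nat.split intro!: add_nonneg_nonneg)
  let ?X = "\<lambda>i \<omega>. W (\<tau> (Suc i)) \<omega> - W (\<tau> i) \<omega>"
  let ?PA = "PiM {0} (\<lambda>_. borel) :: (nat \<Rightarrow> real) measure" and ?PB = "PiM (Suc ` {..<K}) (\<lambda>_. borel) :: (nat \<Rightarrow> real) measure"
  define F where "F d = (\<lambda>j\<in>J. grid_sums N (\<lambda>i\<in>{..<K}. d (Suc i)) j)" for d :: "nat \<Rightarrow> real"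
  have "(\<lambda>d. \<lambda>i\<in>{..<K}. d (Suc i)) \<in> measurable ?PB (PiM {..<K} (\<lambda>_. borel))"
    by (intro measurable_restrict measurable_component_singleton) auto
  from measurable_comp[OF this measurable_grid_sums[of J N K]] NK(2)
  have F: "F \<in> measurable ?PB (PiM J (\<lambda>_. borel))"
    by (simp add: F_def[abs_def] comp_def)
  have "indep_var ?PA (\<lambda>\<omega>. \<lambda>i\<in>{0}. ?X i \<omega>) ?PB (\<lambda>\<omega>. \<lambda>i\<in>Suc ` {..<K}. ?X i \<omega>)"
    by (rule indep_var_restrict[OF W_indep[OF \<tau>, of "Suc K"]]) auto
  \<comment> \<open>\<open>indep_var\<close> takes two variables of the same type;
    \<open>W s\<close> is therefore presented as a family over the one-point index set {(0,
    0)}.\<close>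
  then have "indep_var (PiM {(0, 0)} (\<lambda>_. borel)) ((\<lambda>d. \<lambda>_\<in>{(0, 0)}. d 0) \<circ> (\<lambda>\<omega>. \<lambda>i\<in>{0}. ?X i \<omega>))
      (PiM J (\<lambda>_. borel)) (F \<circ> (\<lambda>\<omega>. \<lambda>i\<in>Suc ` {..<K}. ?X i \<omega>))"
    by (rule indep_var_compose[OF _ _ F]) (auto intro!: measurable_restrict)
  then have ind: "indep_var (PiM {(0, 0)} (\<lambda>_. borel)) (\<lambda>\<omega>. \<lambda>_\<in>{(0, 0)}. ?X 0 \<omega>)
      (PiM J (\<lambda>_. borel)) (\<lambda>\<omega>. F (\<lambda>i\<in>Suc ` {..<K}. ?X i \<omega>))"
    by (simp add: comp_def)
  have X0: "?X 0 \<omega> = W s \<omega>" if "\<omega> \<in> space M" for \<omega>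
    using W_zero[OF that] by (simp add: \<tau>_def)
  have FX: "F (\<lambda>i\<in>Suc ` {..<K}. ?X i \<omega>) = (\<lambda>j\<in>J. W (s + dyadic j) \<omega> - W s \<omega>)" for \<omega>
  proof -
    have "(\<lambda>i\<in>{..<K}. (\<lambda>i\<in>Suc ` {..<K}. ?X i \<omega>) (Suc i))
      = (\<lambda>i\<in>{..<K}. W (s + real (Suc i) / 2 ^ N) \<omega> - W (s + real i / 2 ^ N) \<omega>)"
      by (auto simp: fun_eq_iff \<tau>_def)
    then show ?thesis
      unfolding F_def
      by (intro restrict_ext) (simp only: grid_sums_increments[OF NK, of _ "\<lambda>t. W t \<omega>" s])
  qed
  let ?R = "\<lambda>\<omega>. \<lambda>_\<in>{(0 :: nat, 0 :: nat)}. ?X 0 \<omega>"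
  have "prob ((\<lambda>\<omega>. (?R \<omega>, F (\<lambda>i\<in>Suc ` {..<K}. ?X i \<omega>))) -` (Pi\<^sub>E {(0, 0)} (\<lambda>_. A) \<times> Pi\<^sub>E J C) \<inter> space M)
    = prob (?R -` Pi\<^sub>E {(0, 0)} (\<lambda>_. A) \<inter> space M) * prob ((\<lambda>\<omega>. F (\<lambda>i\<in>Suc ` {..<K}. ?X i \<omega>)) -` Pi\<^sub>E J C \<inter> space M)"
    using A J by (intro indep_varD[OF ind]) (auto intro!: sets_PiM_I_finite)
  also have "?R -` Pi\<^sub>E {(0, 0)} (\<lambda>_. A) \<inter> space M = {\<omega> \<in> space M. W s \<omega> \<in> A}"
    using X0 by (auto simp: PiE_iff)
  also have "(\<lambda>\<omega>. F (\<lambda>i\<in>Suc ` {..<K}. ?X i \<omega>)) -` Pi\<^sub>E J C \<inter> space M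
    = {\<omega> \<in> space M. \<forall>j\<in>J. W (s + dyadic j) \<omega> - W s \<omega> \<in> C j}"
    unfolding FX by (auto simp: PiE_iff)
  also have "(\<lambda>\<omega>. (?R \<omega>, F (\<lambda>i\<in>Suc ` {..<K}. ?X i \<omega>))) -` (Pi\<^sub>E {(0, 0)} (\<lambda>_. A) \<times> Pi\<^sub>E J C) \<inter> space M
    = {\<omega> \<in> space M. W s \<omega> \<in> A \<and> (\<forall>j\<in>J. W (s + dyadic j) \<omega> - W s \<omega> \<in> C j)}"
    unfolding FX using X0 by (auto simp: PiE_iff)
  finally show ?thesis .
qed

text \<open>With the event about \<open>W s\<close> fixed, both sides become finite measures in the
  code alone, and it is enough to compare them on cylinders, where the independence of increments
  applies. The restarted path is again a Brownian motion and so has the same code law.\<close>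

lemma markov_law:
  assumes s: "0 \<le> s"
  shows "distr M (borel \<Otimes>\<^sub>M code_space) (\<lambda>\<omega>. (W s \<omega>, path_code (\<lambda>r \<omega>. W (s + r) \<omega> - W s \<omega>) \<omega>))
    = gauss s \<Otimes>\<^sub>M distr M code_space (path_code W)"
proof -
  let ?V = "\<lambda>r \<omega>. W (s + r) \<omega> - W s \<omega>"
  interpret V: std_brownian_motion M ?V by (rule std_brownian_motion_shift[OF s])
  have [measurable]: "W s \<in> borel_measurable M" by (rule W_measurable[OF s])
  have V: "distr M code_space (path_code W) = distr M code_space (path_code ?V)"
    by (rule path_code_law_unique) unfold_locales
  interpret Q1: prob_space "gauss s" by (rule prob_space_gauss[OF s])
  interpret Q2: prob_space "distr M code_space (path_code ?V)" by (rule prob_space_distr) simp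
  show ?thesis
    unfolding V
  proof (rule pair_measure_eqI[symmetric])
    fix A B assume "A \<in> sets (gauss s)" "B \<in> sets (distr M code_space (path_code ?V))"
    then have A [measurable]: "A \<in> sets borel" and B [measurable]: "B \<in> sets code_space" by auto
    define E where "E = {\<omega> \<in> space M. W s \<omega> \<in> A}"
    have [measurable]: "E \<in> sets M" unfolding E_def by simp
    have gE: "emeasure (gauss s) A = emeasure M E"
      unfolding W_law[OF s, symmetric] E_def by (auto simp: emeasure_distr intro!: arg_cong[where f = "emeasure M"])
    define P where "P = distr (density M (indicator E)) code_space (path_code ?V)"
    define Q where "Q = density (distr M code_space (path_code ?V)) (\<lambda>_. emeasure M E)"
    have P: "emeasure P C = emeasure M {\<omega> \<in> space M. W s \<omega> \<in> A \<and> path_code ?V \<omega> \<in> C}" if [measurable]: "C \<in> sets code_space" for C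
    proof -
      have "emeasure P C = emeasure (density M (indicator E)) (path_code ?V -` C \<inter> space M)"
        unfolding P_def by (subst emeasure_distr) auto
      also have "\<dots> = (\<integral>\<^sup>+\<omega>. indicator E \<omega> * indicator (path_code ?V -` C \<inter> space M) \<omega> \<partial>M)"
        by (rule emeasure_density) auto
      also have "\<dots> = (\<integral>\<^sup>+\<omega>. indicator {\<omega> \<in> space M. W s \<omega> \<in> A \<and> path_code ?V \<omega> \<in> C} \<omega> \<partial>M)"
        by (intro nn_integral_cong) (auto simp: E_def indicator_def)
      finally show ?thesis by simp
    qed
    have Q: "emeasure Q C = emeasure M E * emeasure (distr M code_space (path_code ?V)) C" if [measurable]: "C \<in> sets code_space" for C
      unfolding Q_def using that by (subst emeasure_density) (auto simp: nn_integral_cmult)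
    have "P = Q"
    proof (rule measure_eqI_PiM_infinite)
      show "finite_measure P"
      proof
        have "emeasure P (space code_space) < \<infinity>"
          unfolding P[OF sets.top] by (simp add: less_top[symmetric])
        then show "emeasure P (space P) \<noteq> \<infinity>"
          by (simp add: P_def)
      qed
      fix C and J :: "(nat \<times> nat) set"
      assume J: "finite J" and C: "\<And>j. j \<in> J \<Longrightarrow> C j \<in> sets (borel :: real measure)"
      have S: "prod_emb UNIV (\<lambda>_. borel) J (Pi\<^sub>E J C) \<in> sets code_space"
        using C J by (intro sets_PiM_I) auto
      have iff: "path_code ?V \<omega> \<in> prod_emb UNIV (\<lambda>_. borel) J (Pi\<^sub>E J C) \<longleftrightarrow> (\<forall>j\<in>J. ?V (dyadic j) \<omega> \<in> C j)" for \<omega>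
        by (auto simp: prod_emb_def PiE_iff path_code_def)
      have "emeasure P (prod_emb UNIV (\<lambda>_. borel) J (Pi\<^sub>E J C))
        = ennreal (prob {\<omega> \<in> space M. W s \<omega> \<in> A \<and> (\<forall>j\<in>J. ?V (dyadic j) \<omega> \<in> C j)})"
        by (simp add: P[OF S] emeasure_eq_measure iff)
      also have "\<dots> = ennreal (prob E) * ennreal (prob {\<omega> \<in> space M. \<forall>j\<in>J. ?V (dyadic j) \<omega> \<in> C j})"
        using shift_indep_cylinder[OF s J A, of C] C by (simp add: E_def ennreal_mult)
      also have "{\<omega> \<in> space M. \<forall>j\<in>J. ?V (dyadic j) \<omega> \<in> C j}
         = path_code ?V -` prod_emb UNIV (\<lambda>_. borel) J (Pi\<^sub>E J C) \<inter> space M"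
        using iff by auto
      also have "ennreal (prob \<dots>) = emeasure (distr M code_space (path_code ?V)) (prod_emb UNIV (\<lambda>_. borel) J (Pi\<^sub>E J C))"
        using S by (simp add: emeasure_distr emeasure_eq_measure)
      also have "ennreal (prob E) * \<dots> = emeasure Q (prod_emb UNIV (\<lambda>_. borel) J (Pi\<^sub>E J C))"
        by (simp add: Q[OF S] emeasure_eq_measure)
      finally show "emeasure P (prod_emb UNIV (\<lambda>_. borel) J (Pi\<^sub>E J C)) = emeasure Q (prod_emb UNIV (\<lambda>_. borel) J (Pi\<^sub>E J C))" .
    qed (simp_all add: P_def Q_def)
    then have "emeasure M E * emeasure (distr M code_space (path_code ?V)) B = emeasure P B"
      using Q[OF B] by simp
    also have "\<dots> = emeasure (distr M (borel \<Otimes>\<^sub>M code_space) (\<lambda>\<omega>. (W s \<omega>, path_code ?V \<omega>))) (A \<times> B)"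
      by (subst emeasure_distr) (auto simp: P[OF B] intro!: arg_cong[where f = "emeasure M"])
    finally show "emeasure (gauss s) A * emeasure (distr M code_space (path_code ?V)) B =
       emeasure (distr M (borel \<Otimes>\<^sub>M code_space) (\<lambda>\<omega>. (W s \<omega>, path_code ?V \<omega>))) (A \<times> B)"
      by (simp add: gE)
  qed (auto intro!: sets_pair_measure_cong Q1.sigma_finite_measure_axioms Q2.sigma_finite_measure_axioms)
qed

end

subsection \<open>Occupation times of Brownian motion\<close>

text \<open>The bound min(1, y) is weakened to a power. The exponent 1/4 is a compromise: applied to
  y of order \<eta>^2 / a it yields the positive power \<eta>^(1/2), while the Gaussian factor
  a^(-1/2) only worsens to a^(-3/4), which is still integrable at 0.\<close>

lemma one_minus_exp_le_powr:
  fixes y :: real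
  assumes "0 \<le> y"
  shows "1 - exp (- y) \<le> y powr (1 / 4)"
proof (cases "y \<le> 1")
  case True
  have "1 - exp (- y) \<le> y"
    using exp_ge_add_one_self[of "- y"] by simp
  also have "y \<le> y powr (1 / 4)"
  proof (cases "y = 0")
    case False
    then have "y powr 1 \<le> y powr (1 / 4)"
      using assms True by (intro powr_mono') auto
    then show ?thesis using False assms by simp
  qed simp
  finally show ?thesis .
next
  case False
  then have "1 \<le> y powr (1 / 4)"
    by (intro ge_one_powr_ge_zero) auto
  then show ?thesis
    by (smt (verit) exp_gt_zero)
qed

text \<open>Two points of [-\<eta>, \<eta>] differ by at most 2\<eta>, whence the range of
  \<open>z\<close>. The exponent z^2 / (2a) is at most 2\<eta>^2 / a, and the numerical factor
  2^(1/4) / sqrt (2 pi) that remains is below 1.\<close>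

lemma normal_density_diff_bound:
  fixes a \<eta> z :: real
  assumes "0 < a" "0 < \<eta>" "\<bar>z\<bar> \<le> 2 * \<eta>"
  shows "\<bar>normal_density 0 (sqrt a) z - normal_density 0 (sqrt a) 0\<bar> \<le> \<eta> powr (1/2) * a powr (-3/4)"
proof -
  have eq: "normal_density 0 (sqrt a) z - normal_density 0 (sqrt a) 0 = - (1 / sqrt (2 * pi * a)) * (1 - exp (- (z\<^sup>2 / (2 * a))))"
    using assms by (simp add: normal_density_def field_simps)
  have le1: "1 - exp (- (z\<^sup>2 / (2 * a))) \<le> 1 - exp (- (2 * \<eta>\<^sup>2 / a))"
  proof -
    have "z\<^sup>2 \<le> (2 * \<eta>)\<^sup>2"
      using assms by (intro abs_le_square_iff[THEN iffD1]) auto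
    then show ?thesis
      using assms by (simp add: field_simps)
  qed
  also have "\<dots> \<le> (2 * \<eta>\<^sup>2 / a) powr (1/4)"
    using assms by (intro one_minus_exp_le_powr) auto
  also have "\<dots> = 2 powr (1/4) * \<eta> powr (1/2) * a powr (-1/4)"
  proof -
    have "\<eta>\<^sup>2 powr (1/4) = (\<eta> powr 2) powr (1/4)"
      using assms by simp
    also have "\<dots> = \<eta> powr (1/2)"
      by (simp only: powr_powr) simp
    finally show ?thesis
      using assms by (simp add: powr_mult powr_divide powr_minus divide_simps)
  qed
  finally have le: "1 - exp (- (z\<^sup>2 / (2 * a))) \<le> 2 powr (1/4) * \<eta> powr (1/2) * a powr (-1/4)" .
  have nn: "0 \<le> 1 - exp (- (z\<^sup>2 / (2 * a)))"
    using assms by simp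
  have "\<bar>normal_density 0 (sqrt a) z - normal_density 0 (sqrt a) 0\<bar> = 1 / sqrt (2 * pi * a) * (1 - exp (- (z\<^sup>2 / (2 * a))))"
    unfolding eq using nn assms by (simp add: abs_mult)
  also have "\<dots> \<le> 1 / sqrt (2 * pi * a) * (2 powr (1/4) * \<eta> powr (1/2) * a powr (-1/4))"
    using le assms by (intro mult_left_mono) auto
  also have "\<dots> = (2 powr (1/4) / sqrt (2 * pi)) * (\<eta> powr (1/2) * (a powr (-1/2) * a powr (-1/4)))"
    using assms by (simp add: real_sqrt_mult powr_half_sqrt powr_minus divide_simps)
  also have "a powr (-1/2) * a powr (-1/4) = a powr (-3/4)"
    by (simp flip: powr_add)
  also have "(2 powr (1/4) / sqrt (2 * pi)) * (\<eta> powr (1/2) * a powr (-3/4)) \<le> 1 * (\<eta> powr (1/2) * a powr (-3/4))"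
  proof (intro mult_right_mono)
    have "2 powr (1/4) \<le> (2::real) powr 1"
      by (intro powr_mono) auto
    also have "\<dots> \<le> sqrt (2 * pi)"
      using pi_gt3 by (intro real_le_rsqrt) auto
    finally show "2 powr (1/4) / sqrt (2 * pi) \<le> 1"
      by simp
  qed auto
  finally show ?thesis by simp
qed

lemma normal_density_le:
  assumes "0 < s"
  shows "normal_density 0 (sqrt s) x \<le> 1 / sqrt (2 * pi * s)"
  using assms by (simp add: normal_density_def divide_simps)

lemma nn_integral_powr_Icc:
  fixes a c :: real
  assumes "-1 < a" "0 \<le> c"
  shows "(\<integral>\<^sup>+x. ennreal (x powr a) * indicator {0..c} x \<partial>lborel) = ennreal (c powr (a + 1) / (a + 1))"
  by (rule nn_integral_has_integral_lebesgue'[OF _ has_integral_powr_from_0[OF assms]]) auto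

context std_brownian_motion
begin

lemma integral_markov:
  fixes G :: "real \<times> (nat \<times> nat \<Rightarrow> real) \<Rightarrow> real"
  assumes s: "0 \<le> s" and G [measurable]: "G \<in> borel_measurable (borel \<Otimes>\<^sub>M code_space)"
    and K: "\<And>p. \<bar>G p\<bar> \<le> K"
  shows "(\<integral>\<omega>. G (W s \<omega>, path_code (\<lambda>r \<omega>. W (s + r) \<omega> - W s \<omega>) \<omega>) \<partial>M)
    = (\<integral>x. \<integral>\<omega>. G (x, path_code W \<omega>) \<partial>M \<partial>gauss s)"
proof -
  interpret V: std_brownian_motion M "\<lambda>r \<omega>. W (s + r) \<omega> - W s \<omega>" by (rule std_brownian_motion_shift[OF s])
  have [measurable]: "W s \<in> borel_measurable M" by (rule W_measurable[OF s])
  interpret Q1: prob_space "gauss s" by (rule prob_space_gauss[OF s])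
  interpret Q2: prob_space "distr M code_space (path_code W)" by (rule prob_space_distr) simp
  interpret Q: pair_prob_space "gauss s" "distr M code_space (path_code W)" ..
  have "(\<integral>\<omega>. G (W s \<omega>, path_code (\<lambda>r \<omega>. W (s + r) \<omega> - W s \<omega>) \<omega>) \<partial>M)
    = (\<integral>p. G p \<partial>distr M (borel \<Otimes>\<^sub>M code_space) (\<lambda>\<omega>. (W s \<omega>, path_code (\<lambda>r \<omega>. W (s + r) \<omega> - W s \<omega>) \<omega>)))"
    by (subst integral_distr) auto
  also have "\<dots> = (\<integral>x. \<integral>c. G (x, c) \<partial>distr M code_space (path_code W) \<partial>gauss s)"
    unfolding markov_law[OF s]
    by (subst Q.integral_fst'[symmetric]) (auto intro!: Q.P.integrable_const_bound[where B = K] simp: K cong: measurable_cong_sets)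
  also have "\<dots> = (\<integral>x. \<integral>\<omega>. G (x, path_code W \<omega>) \<partial>M \<partial>gauss s)"
    by (intro Bochner_Integration.integral_cong integral_distr) auto
  finally show ?thesis .
qed

lemma integral_W:
  fixes f :: "real \<Rightarrow> real"
  assumes "0 < s" and f [measurable]: "f \<in> borel_measurable borel"
  shows "(\<integral>\<omega>. f (W s \<omega>) \<partial>M) = (\<integral>z. normal_density 0 (sqrt s) z * f z \<partial>lborel)"
proof -
  have "(\<integral>\<omega>. f (W s \<omega>) \<partial>M) = (\<integral>x. f x \<partial>distr M borel (W s))"
    using assms by (subst integral_distr) (auto intro: W_measurable)
  also have "\<dots> = (\<integral>z. normal_density 0 (sqrt s) z * f z \<partial>lborel)"
    using assms by (simp add: W_law gauss_def integral_density)
  finally show ?thesis .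
qed

end

lemma (in finite_measure) integrable_bounded_real:
  fixes g :: "'a \<Rightarrow> real"
  assumes "g \<in> borel_measurable M" "\<And>x. \<bar>g x\<bar> \<le> B"
  shows "integrable M g"
  using assms by (intro integrable_const_bound[of _ B]) auto

lemma measurable_covariance:
  fixes f :: "'a \<Rightarrow> 'b \<Rightarrow> real"
  assumes "finite_measure M"
    and f: "(\<lambda>p. f (fst p) (snd p)) \<in> borel_measurable (S \<Otimes>\<^sub>M M)"
  shows "(\<lambda>p. \<integral>\<omega>. f (fst p) \<omega> * f (snd p) \<omega> \<partial>M) \<in> borel_measurable (S \<Otimes>\<^sub>M S)"
proof -
  interpret M: finite_measure M by fact
  have "(\<lambda>q. f (fst (fst q)) (snd q) * f (snd (fst q)) (snd q)) \<in> borel_measurable ((S \<Otimes>\<^sub>M S) \<Otimes>\<^sub>M M)"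
    by (intro borel_measurable_times measurable_compose[OF _ f, of "\<lambda>q. (fst (fst q), snd q)", simplified]
       measurable_compose[OF _ f, of "\<lambda>q. (snd (fst q), snd q)", simplified]) measurable
  then show ?thesis
    by (intro M.borel_measurable_lebesgue_integral) (simp add: case_prod_unfold)
qed

lemma integral_square_Fubini:
  fixes f :: "'a \<Rightarrow> 'b \<Rightarrow> real"
  assumes "finite_measure M" "finite_measure S"
    and f [measurable]: "(\<lambda>p. f (fst p) (snd p)) \<in> borel_measurable (S \<Otimes>\<^sub>M M)"
    and fb: "\<And>s \<omega>. \<bar>f s \<omega>\<bar> \<le> K"
  shows "(\<integral>\<omega>. (\<integral>s. f s \<omega> \<partial>S)\<^sup>2 \<partial>M) = (\<integral>p. \<integral>\<omega>. f (fst p) \<omega> * f (snd p) \<omega> \<partial>M \<partial>(S \<Otimes>\<^sub>M S))"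
proof -
  interpret M: finite_measure M by fact
  interpret S: finite_measure S by fact
  interpret SS: finite_measure "S \<Otimes>\<^sub>M S"
    by (rule finite_measure_pair_measure) unfold_locales
  interpret MSS: finite_measure "M \<Otimes>\<^sub>M (S \<Otimes>\<^sub>M S)"
    by (rule finite_measure_pair_measure) unfold_locales
  interpret pS: pair_sigma_finite S S ..
  interpret pM: pair_sigma_finite M "S \<Otimes>\<^sub>M S" ..
  have K: "0 \<le> K"
    using fb[of undefined undefined] by linarith
  have ffb: "\<bar>f s \<omega> * f r \<omega>\<bar> \<le> K * K" for s r \<omega>
    unfolding abs_mult by (intro mult_mono fb K) simp
  have "(\<integral>s. f s \<omega> \<partial>S)\<^sup>2 = (\<integral>p. f (fst p) \<omega> * f (snd p) \<omega> \<partial>(S \<Otimes>\<^sub>M S))"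
    if [measurable]: "\<omega> \<in> space M" for \<omega>
  proof -
    have [measurable]: "(\<lambda>s. f s \<omega>) \<in> borel_measurable S"
      using measurable_compose[OF _ f, of "\<lambda>s. (s, \<omega>)" S] by simp
    have "(\<integral>p. f (fst p) \<omega> * f (snd p) \<omega> \<partial>(S \<Otimes>\<^sub>M S)) = (\<integral>s. \<integral>r. f s \<omega> * f r \<omega> \<partial>S \<partial>S)"
      using ffb by (subst pS.integral_fst'[symmetric]) (auto intro!: SS.integrable_bounded_real[of _ "K * K"])
    then show ?thesis
      by (simp add: power2_eq_square)
  qed
  then have "(\<integral>\<omega>. (\<integral>s. f s \<omega> \<partial>S)\<^sup>2 \<partial>M) = (\<integral>\<omega>. \<integral>p. f (fst p) \<omega> * f (snd p) \<omega> \<partial>(S \<Otimes>\<^sub>M S) \<partial>M)"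
    by (intro Bochner_Integration.integral_cong refl)
  also have "\<dots> = (\<integral>p. \<integral>\<omega>. f (fst p) \<omega> * f (snd p) \<omega> \<partial>M \<partial>(S \<Otimes>\<^sub>M S))"
  proof (rule pM.Fubini_integral[symmetric], rule MSS.integrable_bounded_real)
    have "(\<lambda>q. f (fst (snd q)) (fst q) * f (snd (snd q)) (fst q)) \<in> borel_measurable (M \<Otimes>\<^sub>M (S \<Otimes>\<^sub>M S))"
      by (intro borel_measurable_times measurable_compose[OF _ f, of "\<lambda>q. (fst (snd q), fst q)", simplified]
         measurable_compose[OF _ f, of "\<lambda>q. (snd (snd q), fst q)", simplified]) measurable
    then show "(\<lambda>(\<omega>, p). f (fst p) \<omega> * f (snd p) \<omega>) \<in> borel_measurable (M \<Otimes>\<^sub>M (S \<Otimes>\<^sub>M S))"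
      by (simp add: case_prod_unfold)
    show "\<bar>case x of (\<omega>, p) \<Rightarrow> f (fst p) \<omega> * f (snd p) \<omega>\<bar> \<le> K * K" for x
      using ffb by (cases x) simp
  qed
  finally show ?thesis .
qed

text \<open>After a shift the inner integral is at most 4 t^(1/4), and the outer one is 2 t^(1/2);
  with the factor 4 in front this gives 32 = 4 * 4 * 2.\<close>

lemma nn_integral_kernel:
  fixes t c :: real
  assumes t: "0 \<le> t" and c: "0 \<le> c"
  shows "(\<integral>\<^sup>+s. \<integral>\<^sup>+r. (if 0 < s \<and> s < r then ennreal (4 * c) * (ennreal (s powr (-1/2)) * ennreal ((r - s) powr (-3/4))) else 0)
      * indicator {0..t} r \<partial>lborel \<partial>lborel) \<le> ennreal (32 * c * t powr (3/4))"
proof -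
  define b where "b s r = (if 0 < s \<and> s < r then ennreal (4 * c) * (ennreal (s powr (-1/2)) * ennreal ((r - s) powr (-3/4))) else 0)" for s r :: real
  have "(\<integral>\<^sup>+r. b s r * indicator {0..t} r \<partial>lborel) \<le> ennreal (4 * c) * (ennreal (s powr (-1/2)) * ennreal (4 * t powr (1/4))) * indicator {0..t} s" for s
  proof (cases "0 < s \<and> s \<le> t")
    case False
    then have "b s r * indicator {0..t} r = 0" for r
      by (auto simp: b_def indicator_def)
    then show ?thesis by (simp only: nn_integral_const mult_zero_left zero_le)
  next
    case True
    have "b s r * indicator {0..t} r \<le> ennreal (4 * c) * (ennreal (s powr (-1/2)) * (ennreal ((r - s) powr (-3/4)) * indicator {0..t} (r - s)))" for r
      using True by (auto simp: b_def indicator_def)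
    then have "(\<integral>\<^sup>+r. b s r * indicator {0..t} r \<partial>lborel)
      \<le> (\<integral>\<^sup>+r. ennreal (4 * c) * (ennreal (s powr (-1/2)) * (ennreal ((r - s) powr (-3/4)) * indicator {0..t} (r - s))) \<partial>lborel)"
      by (intro nn_integral_mono)
    also have "\<dots> = ennreal (4 * c) * (ennreal (s powr (-1/2)) * (\<integral>\<^sup>+r. ennreal ((r - s) powr (-3/4)) * indicator {0..t} (r - s) \<partial>lborel))"
      by (simp add: nn_integral_cmult)
    also have "(\<integral>\<^sup>+r. ennreal ((r - s) powr (-3/4)) * indicator {0..t} (r - s) \<partial>lborel)
      = (\<integral>\<^sup>+r. ennreal (r powr (-3/4)) * indicator {0..t} r \<partial>lborel)"
      by (subst nn_integral_real_affine[where c = 1 and t = s]) auto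
    also have "\<dots> = ennreal (4 * t powr (1/4))"
      using t by (subst nn_integral_powr_Icc) auto
    finally show ?thesis
      using True by simp
  qed
  then have "(\<integral>\<^sup>+s. \<integral>\<^sup>+r. b s r * indicator {0..t} r \<partial>lborel \<partial>lborel)
    \<le> (\<integral>\<^sup>+s. ennreal (4 * c) * (ennreal (s powr (-1/2)) * ennreal (4 * t powr (1/4))) * indicator {0..t} s \<partial>lborel)"
    by (intro nn_integral_mono)
  also have "\<dots> = (\<integral>\<^sup>+s. (ennreal (4 * c) * ennreal (4 * t powr (1/4))) * (ennreal (s powr (-1/2)) * indicator {0..t} s) \<partial>lborel)"
    by (intro nn_integral_cong) (simp only: ac_simps)
  also have "\<dots> = (ennreal (4 * c) * ennreal (4 * t powr (1/4))) * (\<integral>\<^sup>+s. ennreal (s powr (-1/2)) * indicator {0..t} s \<partial>lborel)"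
    by (rule nn_integral_cmult) measurable
  also have "\<dots> = (ennreal (4 * c) * ennreal (4 * t powr (1/4))) * ennreal (2 * t powr (1/2))"
    using t by (subst nn_integral_powr_Icc) (auto simp: mult.commute)
  also have "\<dots> = ennreal ((4 * c) * (4 * t powr (1/4)) * (2 * t powr (1/2)))"
    using c by (simp only: ennreal_mult[symmetric] mult_nonneg_nonneg powr_ge_zero zero_le_numeral)
  also have "(4 * c) * (4 * t powr (1/4)) * (2 * t powr (1/2)) = 32 * c * (t powr (1/4) * t powr (1/2))"
    by simp
  also have "t powr (1/4) * t powr (1/2) = t powr (3/4)"
    by (simp flip: powr_add)
  finally show ?thesis
    unfolding b_def .
qed

section \<open>Covariances of functions with integral zero\<close>

text \<open>Models the difference of two probability densities concentrated within \<eta> of 0,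
  which accounts for the bound 2 on the total mass. The vanishing integral is the source of the
  smallness as \<eta> tends to 0.\<close>

locale signed_bump =
  fixes \<theta> :: "real \<Rightarrow> real" and K \<eta> :: real
  assumes \<theta>_measurable [measurable]: "\<theta> \<in> borel_measurable borel"
    and \<theta>_bound: "\<And>y. \<bar>\<theta> y\<bar> \<le> K"
    and \<theta>_support: "\<And>y. \<eta> < \<bar>y\<bar> \<Longrightarrow> \<theta> y = 0"
    and \<theta>_integrable: "integrable lborel \<theta>"
    and \<theta>_integral: "(\<integral>y. \<theta> y \<partial>lborel) = 0"
    and \<theta>_mass: "(\<integral>y. \<bar>\<theta> y\<bar> \<partial>lborel) \<le> 2"
    and \<eta>_pos: "0 < \<eta>"
begin

lemma K_nonneg: "0 \<le> K"
  using \<theta>_bound[of 0] by linarith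

text \<open>Since \<open>\<theta>\<close> has integral 0, the value of the Gaussian density at 0 may
  be subtracted for free; what is left is the oscillation of the density over distances at most
  2\<eta>.\<close>

lemma gauss_bound:
  assumes a: "0 < a" and x: "\<bar>x\<bar> \<le> \<eta>"
  shows "\<bar>\<integral>z. normal_density 0 (sqrt a) z * \<theta> (x + z) \<partial>lborel\<bar> \<le> 2 * (\<eta> powr (1/2) * a powr (-3/4))"
proof -
  let ?p = "normal_density 0 (sqrt a)"
  let ?c = "\<eta> powr (1/2) * a powr (-3/4)"
  have p_bd: "\<bar>?p y\<bar> \<le> 1 / sqrt (2 * pi * a)" for y
    using normal_density_le[OF a] by simp
  have I1: "integrable lborel (\<lambda>y. ?p (y - x) * \<theta> y)"
  proof (rule Bochner_Integration.integrable_bound)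
    show "integrable lborel (\<lambda>y. 1 / sqrt (2 * pi * a) * \<bar>\<theta> y\<bar>)"
      using \<theta>_integrable by simp
    have "\<bar>?p (y - x) * \<theta> y\<bar> \<le> 1 / sqrt (2 * pi * a) * \<bar>\<theta> y\<bar>" for y
      unfolding abs_mult by (intro mult_right_mono p_bd) simp
    then show "AE y in lborel. norm (?p (y - x) * \<theta> y) \<le> norm (1 / sqrt (2 * pi * a) * \<bar>\<theta> y\<bar>)"
      unfolding real_norm_def by (intro AE_I2 order_trans[OF _ abs_ge_self])
  qed measurable
  have "(\<integral>z. ?p z * \<theta> (x + z) \<partial>lborel) = (\<integral>y. ?p (y - x) * \<theta> y \<partial>lborel)"
    using lborel_integral_real_affine[of 1 "\<lambda>y. ?p (y - x) * \<theta> y" x] by simp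
  also have "\<dots> = (\<integral>y. ?p (y - x) * \<theta> y \<partial>lborel) - ?p 0 * (\<integral>y. \<theta> y \<partial>lborel)"
    by (simp add: \<theta>_integral)
  also have "\<dots> = (\<integral>y. (?p (y - x) - ?p 0) * \<theta> y \<partial>lborel)"
    using I1 \<theta>_integrable by (simp add: left_diff_distrib)
  also have "\<bar>\<dots>\<bar> \<le> (\<integral>y. ?c * \<bar>\<theta> y\<bar> \<partial>lborel)"
  proof (rule integral_abs_bound_integral)
    show "integrable lborel (\<lambda>y. (?p (y - x) - ?p 0) * \<theta> y)"
      using I1 \<theta>_integrable by (simp add: left_diff_distrib)
    show "integrable lborel (\<lambda>y. ?c * \<bar>\<theta> y\<bar>)"
      using \<theta>_integrable by simp
    show "\<bar>(?p (y - x) - ?p 0) * \<theta> y\<bar> \<le> ?c * \<bar>\<theta> y\<bar>" for y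
    proof (cases "\<bar>y\<bar> \<le> \<eta>")
      case True
      then have "\<bar>?p (y - x) - ?p 0\<bar> \<le> ?c"
        using x by (intro normal_density_diff_bound a \<eta>_pos) auto
      then show ?thesis
        unfolding abs_mult by (intro mult_right_mono) auto
    next
      case False
      then show ?thesis using \<theta>_support by simp
    qed
  qed
  also have "\<dots> = ?c * (\<integral>y. \<bar>\<theta> y\<bar> \<partial>lborel)"
    by simp
  also have "\<dots> \<le> ?c * 2"
    by (intro mult_left_mono \<theta>_mass) simp
  finally show ?thesis by (simp add: mult.commute)
qed



text \<open>Conditionally on W s = x the later factor averages to \<open>E x\<close>. The factor
  \<open>\<theta> x\<close> restricts x to [-\<eta>, \<eta>], where \<open>E x\<close> is small by
  cancellation, with constant 2. The density of \<open>W s\<close> costs s^(-1/2) and the mass of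
  \<open>\<theta>\<close> another factor 2, whence the 4.\<close>

lemma covariance_bound:
  assumes "std_brownian_motion M W" and s: "0 < s" "s < r"
  shows "\<bar>\<integral>\<omega>. \<theta> (W s \<omega>) * \<theta> (W r \<omega>) \<partial>M\<bar> \<le> 4 * \<eta> powr (1/2) * s powr (-1/2) * (r - s) powr (-3/4)"
proof -
  interpret std_brownian_motion M W by fact
  interpret V: std_brownian_motion M "\<lambda>r \<omega>. W (s + r) \<omega> - W s \<omega>" by (rule std_brownian_motion_shift) (use s in auto)
  let ?p = "normal_density 0 (sqrt s)"
  let ?c = "2 * (\<eta> powr (1/2) * (r - s) powr (-3/4))"
  define G where "G p = \<theta> (fst p) * \<theta> (fst p + code_eval (snd p) (r - s))" for p :: "real \<times> (nat \<times> nat \<Rightarrow> real)"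
  have [measurable]: "G \<in> borel_measurable (borel \<Otimes>\<^sub>M code_space)"
    unfolding G_def[abs_def] by measurable
  define E where "E x = (\<integral>z. normal_density 0 (sqrt (r - s)) z * \<theta> (x + z) \<partial>lborel)" for x
  have [measurable]: "E \<in> borel_measurable borel"
    unfolding E_def[abs_def] by measurable
  have "(\<integral>\<omega>. \<theta> (W s \<omega>) * \<theta> (W r \<omega>) \<partial>M)
      = (\<integral>\<omega>. G (W s \<omega>, path_code (\<lambda>r \<omega>. W (s + r) \<omega> - W s \<omega>) \<omega>) \<partial>M)"
    by (intro Bochner_Integration.integral_cong refl)
      (simp add: G_def V.code_eval_W less_imp_le[OF s(2)])
  also have "\<dots> = (\<integral>x. \<integral>\<omega>. G (x, path_code W \<omega>) \<partial>M \<partial>gauss s)"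
    using s mult_mono[OF \<theta>_bound \<theta>_bound K_nonneg]
    by (intro integral_markov[where K = "K * K"]) (auto simp: G_def abs_mult)
  also have "\<dots> = (\<integral>x. \<theta> x * E x \<partial>gauss s)"
  proof (intro Bochner_Integration.integral_cong refl)
    fix x
    have "(\<integral>\<omega>. G (x, path_code W \<omega>) \<partial>M) = \<theta> x * (\<integral>\<omega>. \<theta> (x + W (r - s) \<omega>) \<partial>M)"
      using s by (simp add: G_def code_eval_W cong: Bochner_Integration.integral_cong)
    also have "(\<integral>\<omega>. \<theta> (x + W (r - s) \<omega>) \<partial>M) = E x"
      unfolding E_def using s by (intro integral_W) auto
    finally show "(\<integral>\<omega>. G (x, path_code W \<omega>) \<partial>M) = \<theta> x * E x" .
  qed
  also have "\<dots> = (\<integral>x. ?p x * (\<theta> x * E x) \<partial>lborel)"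
    using s by (simp add: gauss_def integral_density)
  finally have eq: "(\<integral>\<omega>. \<theta> (W s \<omega>) * \<theta> (W r \<omega>) \<partial>M) = (\<integral>x. ?p x * (\<theta> x * E x) \<partial>lborel)" .
  have "\<bar>\<integral>x. ?p x * (\<theta> x * E x) \<partial>lborel\<bar> \<le> (\<integral>x. (1 / sqrt (2 * pi * s) * ?c) * \<bar>\<theta> x\<bar> \<partial>lborel)"
  proof -
    have *: "\<bar>?p x * (\<theta> x * E x)\<bar> \<le> (1 / sqrt (2 * pi * s) * ?c) * \<bar>\<theta> x\<bar>" for x
    proof (cases "\<bar>x\<bar> \<le> \<eta>")
      case True
      then have "\<bar>E x\<bar> \<le> ?c"
        unfolding E_def using s by (intro gauss_bound) auto
      then have "?p x * \<bar>E x\<bar> \<le> 1 / sqrt (2 * pi * s) * ?c"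
        using s normal_density_le[OF s(1)] by (intro mult_mono) auto
      then have "?p x * \<bar>E x\<bar> * \<bar>\<theta> x\<bar> \<le> 1 / sqrt (2 * pi * s) * ?c * \<bar>\<theta> x\<bar>"
        by (intro mult_right_mono) auto
      moreover have "\<bar>?p x * (\<theta> x * E x)\<bar> = ?p x * \<bar>E x\<bar> * \<bar>\<theta> x\<bar>"
        by (simp add: abs_mult)
      ultimately show ?thesis by linarith
    next
      case False
      then show ?thesis using \<theta>_support by simp
    qed
    show ?thesis
    proof (rule integral_abs_bound_integral)
      show I: "integrable lborel (\<lambda>x. (1 / sqrt (2 * pi * s) * ?c) * \<bar>\<theta> x\<bar>)"
        using \<theta>_integrable by simp
      show "integrable lborel (\<lambda>x. ?p x * (\<theta> x * E x))"
      proof (rule Bochner_Integration.integrable_bound[OF I])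
        show "(\<lambda>x. ?p x * (\<theta> x * E x)) \<in> borel_measurable lborel"
          by measurable
        have "norm (?p x * (\<theta> x * E x)) \<le> norm ((1 / sqrt (2 * pi * s) * ?c) * \<bar>\<theta> x\<bar>)" for x
          using order_trans[OF *[of x] abs_ge_self] by (simp only: real_norm_def)
        then show "AE x in lborel. norm (?p x * (\<theta> x * E x)) \<le> norm ((1 / sqrt (2 * pi * s) * ?c) * \<bar>\<theta> x\<bar>)"
          by (rule AE_I2)
      qed
    qed (rule *)
  qed
  also have "\<dots> = (1 / sqrt (2 * pi * s) * ?c) * (\<integral>x. \<bar>\<theta> x\<bar> \<partial>lborel)"
    by simp
  also have "\<dots> \<le> (1 / sqrt (2 * pi * s) * ?c) * 2"
    using s by (intro mult_left_mono \<theta>_mass) auto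
  also have "\<dots> \<le> (s powr (-1/2) * ?c) * 2"
  proof -
    have "1 / sqrt (2 * pi * s) \<le> 1 / sqrt (1 * s)"
      using s pi_gt3 by (intro divide_left_mono real_sqrt_le_mono mult_right_mono) auto
    also have "\<dots> = s powr (-1/2)"
      using s by (simp add: powr_minus powr_half_sqrt divide_simps)
    finally show ?thesis
      by (intro mult_right_mono) auto
  qed
  finally show ?thesis
    unfolding eq by (simp add: mult_ac)
qed

text \<open>The square is a double time integral of covariances; the orders s < r and r < s
  contribute 32 each. The diagonal and the axes, where the covariance bound says nothing, are null
  sets.\<close>

lemma second_moment:
  assumes "std_brownian_motion M W" and t: "0 \<le> t"
  shows "(\<integral>\<omega>. (LINT s:{0..t}|lborel. \<theta> (W s \<omega>))\<^sup>2 \<partial>M) \<le> 64 * \<eta> powr (1/2) * t powr (3/4)"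
proof -
  interpret std_brownian_motion M W by fact
  define S where "S = restrict_space lborel {0..t}"
  have sS: "sets S = sets (restrict_space borel {0..t})"
    by (simp add: S_def sets_restrict_space)
  have spS: "space S = {0..t}"
    by (simp add: S_def space_restrict_space)
  interpret S: finite_measure S
  proof (rule finite_measureI)
    have "emeasure S (space S) = emeasure lborel {0..t}"
      unfolding spS unfolding S_def by (subst emeasure_restrict_space) auto
    then show "emeasure S (space S) \<noteq> \<infinity>"
      using t by simp
  qed
  interpret MS: pair_sigma_finite M S ..
  interpret SM: pair_sigma_finite S M ..
  interpret SS: pair_sigma_finite S S ..
  define f where "f s \<omega> = \<theta> (code_eval (path_code W \<omega>) s)" for s \<omega>
  have f_meas: "(\<lambda>p. f (fst p) (snd p)) \<in> borel_measurable (S \<Otimes>\<^sub>M M)"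
  proof -
    have [measurable]: "(\<lambda>s. s) \<in> borel_measurable S"
      unfolding S_def by (rule measurable_restrict_space1) simp
    show ?thesis
      unfolding f_def by measurable
  qed
  have fb: "\<bar>f s \<omega>\<bar> \<le> K" for s \<omega>
    by (simp add: f_def \<theta>_bound)
  have feq: "f s \<omega> = \<theta> (W s \<omega>)" if "\<omega> \<in> space M" "s \<in> space S" for s \<omega>
    using that by (simp add: f_def code_eval_W spS)
  have Y: "(LINT s:{0..t}|lborel. \<theta> (W s \<omega>)) = (\<integral>s. f s \<omega> \<partial>S)" if "\<omega> \<in> space M" for \<omega>
  proof -
    have "(\<integral>s. f s \<omega> \<partial>S) = (\<integral>s. \<theta> (W s \<omega>) \<partial>S)"
      using feq[OF that] by (intro Bochner_Integration.integral_cong) auto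
    then show ?thesis
      by (simp add: S_def integral_restrict_space set_lebesgue_integral_def)
  qed
  have "(\<integral>\<omega>. (LINT s:{0..t}|lborel. \<theta> (W s \<omega>))\<^sup>2 \<partial>M) = (\<integral>\<omega>. (\<integral>s. f s \<omega> \<partial>S)\<^sup>2 \<partial>M)"
    by (intro Bochner_Integration.integral_cong refl) (simp only: Y)
  also have "\<dots> = (\<integral>p. \<integral>\<omega>. f (fst p) \<omega> * f (snd p) \<omega> \<partial>M \<partial>(S \<Otimes>\<^sub>M S))"
    using S.finite_measure_axioms finite_measure_axioms f_meas fb by (intro integral_square_Fubini[where K = K])
  also have "\<dots> \<le> 64 * \<eta> powr (1/2) * t powr (3/4)"
  proof -
    define c where "c s r = (\<integral>\<omega>. f s \<omega> * f r \<omega> \<partial>M)" for s r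
    have c_meas [measurable]: "(\<lambda>p. c (fst p) (snd p)) \<in> borel_measurable (S \<Otimes>\<^sub>M S)"
      unfolding c_def using finite_measure_axioms f_meas by (rule measurable_covariance)
    define b where "b s r = (if 0 < s \<and> s < r then ennreal (4 * \<eta> powr (1/2)) * (ennreal (s powr (-1/2)) * ennreal ((r - s) powr (-3/4))) else 0)" for s r :: real
    have b_meas [measurable]: "(\<lambda>p. b (fst p) (snd p)) \<in> borel_measurable (lborel \<Otimes>\<^sub>M lborel)"
      unfolding b_def by measurable
    have [measurable (raw)]: "(\<lambda>x. b (f x) (g x)) \<in> borel_measurable lborel"
      if "f \<in> borel_measurable borel" "g \<in> borel_measurable borel" for f g
      unfolding b_def using that by measurable
    have c_le: "ennreal \<bar>c s r\<bar> \<le> b s r + b r s" if "s \<in> {0..t}" "r \<in> {0..t}" "s \<noteq> r" "s \<noteq> 0" "r \<noteq> 0" for s r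
    proof -
      have le: "ennreal \<bar>c s r\<bar> \<le> b s r" if "0 < s" "s < r" "r \<le> t" for s r
      proof -
        have "c s r = (\<integral>\<omega>. \<theta> (W s \<omega>) * \<theta> (W r \<omega>) \<partial>M)"
          unfolding c_def using that feq by (intro Bochner_Integration.integral_cong) (auto simp: spS)
        then have "\<bar>c s r\<bar> \<le> 4 * \<eta> powr (1/2) * s powr (-1/2) * (r - s) powr (-3/4)"
          using covariance_bound[OF assms(1) that(1,2)] by simp
        then show ?thesis
          using that by (simp add: b_def ennreal_mult[symmetric] mult.assoc ennreal_leI)
      qed
      have sym: "c s r = c r s"
        unfolding c_def by (rule Bochner_Integration.integral_cong[OF refl mult.commute])
      show ?thesis
      proof (cases "s < r")
        case True
        with that le[of s r] show ?thesis by (intro add_increasing2) auto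
      next
        case False
        with that le[of r s] show ?thesis unfolding sym by (intro add_increasing) auto
      qed
    qed
    have int_b: "(\<integral>\<^sup>+s. \<integral>\<^sup>+r. b s r * indicator {0..t} r \<partial>lborel \<partial>lborel) \<le> ennreal (32 * \<eta> powr (1/2) * t powr (3/4))"
      unfolding b_def by (rule nn_integral_kernel[OF t]) simp
    have nz: "AE s in lborel. s \<noteq> (a::real)" for a
      by (rule AE_lborel_singleton)
    \<comment> \<open>A nonintegrable \<open>c\<close> would have Bochner integral 0 by convention,
      so the bound holds in either case.\<close>
    have "ennreal \<bar>\<integral>p. c (fst p) (snd p) \<partial>(S \<Otimes>\<^sub>M S)\<bar> \<le> (\<integral>\<^sup>+p. ennreal \<bar>c (fst p) (snd p)\<bar> \<partial>(S \<Otimes>\<^sub>M S))"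
      by (cases "integrable (S \<Otimes>\<^sub>M S) (\<lambda>p. c (fst p) (snd p))")
        (use integral_norm_bound_ennreal[of "S \<Otimes>\<^sub>M S" "\<lambda>p. c (fst p) (snd p)"] in \<open>auto simp: not_integrable_integral_eq\<close>)
    also have "\<dots> = (\<integral>\<^sup>+s. \<integral>\<^sup>+r. ennreal \<bar>c s r\<bar> \<partial>S \<partial>S)"
      by (subst S.nn_integral_fst[symmetric]) auto
    also have "\<dots> = (\<integral>\<^sup>+s. (\<integral>\<^sup>+r. ennreal \<bar>c s r\<bar> * indicator {0..t} r \<partial>lborel) * indicator {0..t} s \<partial>lborel)"
      by (simp add: S_def nn_integral_restrict_space)
    also have "\<dots> \<le> (\<integral>\<^sup>+s. (\<integral>\<^sup>+r. b s r * indicator {0..t} r + b r s * indicator {0..t} s \<partial>lborel) \<partial>lborel)"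
    proof (intro nn_integral_mono_AE)
      show "AE s in lborel. (\<integral>\<^sup>+r. ennreal \<bar>c s r\<bar> * indicator {0..t} r \<partial>lborel) * indicator {0..t} s
        \<le> (\<integral>\<^sup>+r. b s r * indicator {0..t} r + b r s * indicator {0..t} s \<partial>lborel)"
        using nz[of 0]
      proof eventually_elim
        case (elim s)
        show ?case
        proof (cases "s \<in> {0..t}")
          case True
          have "AE r in lborel. ennreal \<bar>c s r\<bar> * indicator {0..t} r \<le> b s r * indicator {0..t} r + b r s * indicator {0..t} s"
            using nz[of 0] nz[of s]
          proof eventually_elim
            case (elim r)
            with c_le[of s r] True \<open>s \<noteq> 0\<close> show ?case by (auto simp: indicator_def)
          qed
          then show ?thesis
            using True by (simp add: nn_integral_mono_AE)
        qed simp
      qed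
    qed
    also have "\<dots> = (\<integral>\<^sup>+s. (\<integral>\<^sup>+r. b s r * indicator {0..t} r \<partial>lborel) + (\<integral>\<^sup>+r. b r s * indicator {0..t} s \<partial>lborel) \<partial>lborel)"
      by (intro nn_integral_cong nn_integral_add) measurable
    also have "\<dots> = (\<integral>\<^sup>+s. \<integral>\<^sup>+r. b s r * indicator {0..t} r \<partial>lborel \<partial>lborel) + (\<integral>\<^sup>+s. \<integral>\<^sup>+r. b r s * indicator {0..t} s \<partial>lborel \<partial>lborel)"
      unfolding b_def by (intro nn_integral_add) measurable
    also have "(\<integral>\<^sup>+s. \<integral>\<^sup>+r. b r s * indicator {0..t} s \<partial>lborel \<partial>lborel) = (\<integral>\<^sup>+r. \<integral>\<^sup>+s. b r s * indicator {0..t} s \<partial>lborel \<partial>lborel)"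
      by (rule lborel_pair.Fubini') measurable
    also have "(\<integral>\<^sup>+s. \<integral>\<^sup>+r. b s r * indicator {0..t} r \<partial>lborel \<partial>lborel) + \<dots> \<le> ennreal (32 * \<eta> powr (1/2) * t powr (3/4)) + ennreal (32 * \<eta> powr (1/2) * t powr (3/4))"
      by (intro add_mono int_b)
    also have "\<dots> = ennreal (64 * \<eta> powr (1/2) * t powr (3/4))"
      by (subst ennreal_plus[symmetric]) auto
    finally have "\<bar>\<integral>p. c (fst p) (snd p) \<partial>(S \<Otimes>\<^sub>M S)\<bar> \<le> 64 * \<eta> powr (1/2) * t powr (3/4)"
      by (simp add: ennreal_le_iff)
    then show ?thesis
      unfolding c_def by linarith
  qed
  finally show ?thesis .
qed

end

subsection \<open>Brownian local time\<close>

text \<open>An approximate delta function. The radius \<open>\<eta>\<close> only has to bound the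
  support, so that bumps of different widths can be compared at a common scale.\<close>

definition bump :: "real \<Rightarrow> (real \<Rightarrow> real) \<Rightarrow> bool" where
  "bump \<eta> \<phi> \<longleftrightarrow> \<phi> \<in> borel_measurable borel \<and> (\<forall>y. 0 \<le> \<phi> y) \<and> (\<exists>K. \<forall>y. \<phi> y \<le> K) \<and>
     (\<forall>y. \<eta> < \<bar>y\<bar> \<longrightarrow> \<phi> y = 0) \<and> integrable lborel \<phi> \<and> (\<integral>y. \<phi> y \<partial>lborel) = 1"

definition occupation :: "(real \<Rightarrow> real) \<Rightarrow> real \<Rightarrow> (nat \<times> nat \<Rightarrow> real) \<Rightarrow> real" where
  "occupation \<phi> t c = (LINT s:{0..t}|lborel. \<phi> (code_eval c s))"

lemma bumpD:
  assumes "bump \<eta> \<phi>"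
  shows "\<phi> \<in> borel_measurable borel" "\<And>y. 0 \<le> \<phi> y" "\<And>y. \<eta> < \<bar>y\<bar> \<Longrightarrow> \<phi> y = 0"
    "integrable lborel \<phi>" "(\<integral>y. \<phi> y \<partial>lborel) = 1"
  using assms by (auto simp: bump_def)

lemma bump_mono: "bump \<eta> \<phi> \<Longrightarrow> \<eta> \<le> \<eta>' \<Longrightarrow> bump \<eta>' \<phi>"
  by (auto simp: bump_def)

lemma bump_shift:
  assumes "bump \<eta> \<phi>" "\<bar>x\<bar> \<le> \<eta>"
  shows "bump (2 * \<eta>) (\<lambda>y. \<phi> (x + y))"
  unfolding bump_def
proof (intro conjI allI impI)
  note [measurable] = bumpD(1)[OF assms(1)]
  show "(\<lambda>y. \<phi> (x + y)) \<in> borel_measurable borel" by measurable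
  show "\<exists>K. \<forall>y. \<phi> (x + y) \<le> K" using assms by (auto simp: bump_def)
  show "integrable lborel (\<lambda>y. \<phi> (x + y))"
    using lborel_integrable_real_affine[OF bumpD(4)[OF assms(1)], of 1 x] by simp
  show "(\<integral>y. \<phi> (x + y) \<partial>lborel) = 1"
    using lborel_integral_real_affine[of 1 \<phi> x] bumpD(5)[OF assms(1)] by simp
  show "\<phi> (x + y) = 0" if "2 * \<eta> < \<bar>y\<bar>" for y
    using that assms(2) by (intro bumpD(3)[OF assms(1)]) auto
qed (use bumpD(2)[OF assms(1)] in auto)

lemma signed_bump_diff:
  assumes "bump \<eta> \<phi>" "bump \<eta> \<psi>" "0 < \<eta>"
  obtains K where "signed_bump (\<lambda>y. \<phi> y - \<psi> y) K \<eta>"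
proof -
  note P = bumpD[OF assms(1)] and Q = bumpD[OF assms(2)]
  from assms obtain K1 K2 where K: "\<And>y. \<phi> y \<le> K1" "\<And>y. \<psi> y \<le> K2"
    by (auto simp: bump_def)
  have "signed_bump (\<lambda>y. \<phi> y - \<psi> y) (K1 + K2) \<eta>"
  proof
    show "(\<lambda>y. \<phi> y - \<psi> y) \<in> borel_measurable borel" using P Q by measurable
    show "\<bar>\<phi> y - \<psi> y\<bar> \<le> K1 + K2" for y
      using K(1)[of y] K(2)[of y] P(2)[of y] Q(2)[of y] by linarith
    show "integrable lborel (\<lambda>y. \<phi> y - \<psi> y)" using P Q by simp
    show "(\<integral>y. \<phi> y - \<psi> y \<partial>lborel) = 0" using P Q by simp
    have "(\<integral>y. \<bar>\<phi> y - \<psi> y\<bar> \<partial>lborel) \<le> (\<integral>y. \<phi> y + \<psi> y \<partial>lborel)"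
      using P Q by (intro integral_mono) (auto intro!: abs_leI simp: add_increasing add_increasing2)
    then show "(\<integral>y. \<bar>\<phi> y - \<psi> y\<bar> \<partial>lborel) \<le> 2" using P Q by simp
  qed (use P Q assms in auto)
  then show ?thesis by (rule that)
qed

lemma measurable_occupation [measurable]:
  assumes [measurable]: "\<phi> \<in> borel_measurable borel"
  shows "occupation \<phi> t \<in> borel_measurable code_space"
  unfolding occupation_def[abs_def] set_lebesgue_integral_def by measurable

lemma set_integrable_bounded_code:
  fixes \<phi> :: "real \<Rightarrow> real"
  assumes [measurable]: "\<phi> \<in> borel_measurable borel" and "\<And>y. \<bar>\<phi> y\<bar> \<le> K"
  shows "set_integrable lborel {a..b} (\<lambda>s. \<phi> (code_eval c s))"
  unfolding set_integrable_def
proof (rule integrableI_bounded_set_indicator[where B = K])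
  have "(\<lambda>s. code_eval c s) \<in> borel_measurable borel"
    by (rule measurable_code_eval') (auto simp: space_PiM)
  then show "(\<lambda>s. \<phi> (code_eval c s)) \<in> borel_measurable lborel"
    by measurable
qed (use assms in \<open>auto simp: emeasure_lborel_Icc_eq\<close>)

lemma occupation_nonneg: "(\<And>y. 0 \<le> \<phi> y) \<Longrightarrow> 0 \<le> occupation \<phi> t c"
  unfolding occupation_def set_lebesgue_integral_def by (intro integral_nonneg_AE) auto

lemma occupation_bound:
  assumes "\<phi> \<in> borel_measurable borel" "\<And>y. \<bar>\<phi> y\<bar> \<le> K" and t: "0 \<le> t"
  shows "\<bar>occupation \<phi> t c\<bar> \<le> K * t"
proof -
  have "\<bar>occupation \<phi> t c\<bar> \<le> (\<integral>s. indicator {0..t} s *\<^sub>R K \<partial>lborel)"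
    unfolding occupation_def set_lebesgue_integral_def
  proof (rule integral_abs_bound_integral)
    show "integrable lborel (\<lambda>s. indicator {0..t} s *\<^sub>R \<phi> (code_eval c s))"
      using set_integrable_bounded_code[OF assms(1,2), of 0 t c] by (simp add: set_integrable_def)
    show "integrable lborel (\<lambda>s. indicator {0..t} s *\<^sub>R K)"
      by (rule integrable_scaleR_left) (simp add: integrable_indicator_iff emeasure_lborel_Icc_eq)
    show "\<bar>indicator {0..t} s *\<^sub>R \<phi> (code_eval c s)\<bar> \<le> indicator {0..t} s *\<^sub>R K" for s
      using assms(2) by (simp add: indicator_def)
  qed
  also have "\<dots> = K * t" using t by simp
  finally show ?thesis .
qed

text \<open>Nonnegativity of the variance turns the second moment bound into one for the first
  absolute moment; 8 is the square root of 64.\<close>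

lemma (in signed_bump) occupation_L1:
  assumes "std_brownian_motion M W" and t: "0 \<le> t"
  shows "(\<integral>\<omega>. \<bar>occupation \<theta> t (path_code W \<omega>)\<bar> \<partial>M) \<le> 8 * \<eta> powr (1/4) * t powr (3/8)"
proof -
  interpret std_brownian_motion M W by fact
  define Y where "Y \<omega> = \<bar>occupation \<theta> t (path_code W \<omega>)\<bar>" for \<omega>
  have [measurable]: "Y \<in> borel_measurable M" unfolding Y_def by measurable
  have bd: "\<bar>Y \<omega>\<bar> \<le> K * t" for \<omega>
    using occupation_bound[OF \<theta>_measurable \<theta>_bound t] by (simp add: Y_def)
  have sq: "\<bar>(Y \<omega>)\<^sup>2\<bar> \<le> (K * t)\<^sup>2" for \<omega>
    using power_mono[OF bd[of \<omega>], of 2] by simp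
  have iY: "integrable M Y"
    by (rule integrable_bounded_real[OF _ bd]) measurable
  have iY2: "integrable M (\<lambda>\<omega>. (Y \<omega>)\<^sup>2)"
    by (rule integrable_bounded_real[OF _ sq]) measurable
  have "(expectation Y)\<^sup>2 \<le> expectation (\<lambda>\<omega>. (Y \<omega>)\<^sup>2)"
    using variance_positive[of Y] unfolding variance_eq[OF iY iY2] by linarith
  also have "\<dots> = (\<integral>\<omega>. (LINT s:{0..t}|lborel. \<theta> (W s \<omega>))\<^sup>2 \<partial>M)"
  proof (rule Bochner_Integration.integral_cong[OF refl])
    fix \<omega> assume "\<omega> \<in> space M"
    then have "occupation \<theta> t (path_code W \<omega>) = (LINT s:{0..t}|lborel. \<theta> (W s \<omega>))"
      unfolding occupation_def by (intro set_lebesgue_integral_cong) (auto simp: code_eval_W)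
    then show "(Y \<omega>)\<^sup>2 = (LINT s:{0..t}|lborel. \<theta> (W s \<omega>))\<^sup>2" by (simp add: Y_def)
  qed
  also have "\<dots> \<le> 64 * \<eta> powr (1/2) * t powr (3/4)"
    by (rule second_moment) fact+
  also have "\<dots> = (8 * \<eta> powr (1/4) * t powr (3/8))\<^sup>2"
  proof -
    have "(z powr (1/4))\<^sup>2 = z powr (1/2)" "(z powr (3/8))\<^sup>2 = z powr (3/4)" for z :: real
      by (simp_all add: power2_eq_square flip: powr_add)
    then show ?thesis by (simp add: power_mult_distrib)
  qed
  finally have "expectation Y \<le> 8 * \<eta> powr (1/4) * t powr (3/8)"
    by (rule power2_le_imp_le) simp
  then show ?thesis unfolding Y_def[abs_def] .
qed

text \<open>Put to use three times: for windows of different widths it gives the existence of local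
  time, for a tent and a window the independence of the limit from the shape, and for a tent and its
  translate the limit of the Feynman--Kac equation.\<close>

lemma (in std_brownian_motion) occupation_diff_L1:
  assumes "bump \<eta> \<phi>" "bump \<eta> \<psi>" "0 < \<eta>" "0 \<le> t"
  shows "(\<integral>\<omega>. \<bar>occupation \<phi> t (path_code W \<omega>) - occupation \<psi> t (path_code W \<omega>)\<bar> \<partial>M)
    \<le> 8 * \<eta> powr (1/4) * t powr (3/8)"
proof -
  obtain K where "signed_bump (\<lambda>y. \<phi> y - \<psi> y) K \<eta>"
    using signed_bump_diff[OF assms(1-3)] .
  then interpret signed_bump "\<lambda>y. \<phi> y - \<psi> y" K \<eta> .
  from assms obtain K1 K2 where K: "\<And>y. \<phi> y \<le> K1" "\<And>y. \<psi> y \<le> K2"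
    by (auto simp: bump_def)
  have "set_integrable lborel {0..t} (\<lambda>s. \<phi> (code_eval c s))" for c
    using bumpD(1,2)[OF assms(1)] K(1) by (intro set_integrable_bounded_code[where K = K1]) auto
  moreover have "set_integrable lborel {0..t} (\<lambda>s. \<psi> (code_eval c s))" for c
    using bumpD(1,2)[OF assms(2)] K(2) by (intro set_integrable_bounded_code[where K = K2]) auto
  ultimately have "occupation (\<lambda>y. \<phi> y - \<psi> y) t c = occupation \<phi> t c - occupation \<psi> t c" for c
    unfolding occupation_def by (rule set_integral_diff(2))
  then show ?thesis
    using occupation_L1[OF std_brownian_motion_axioms assms(4)] by simp
qed

section \<open>Existence of the local time at a fixed time\<close>

definition window :: "real \<Rightarrow> real \<Rightarrow> real" where
  "window \<epsilon> y = (if \<bar>y\<bar> < \<epsilon> then 1 / (2 * \<epsilon>) else 0)"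

lemma bump_window:
  assumes "0 < \<epsilon>"
  shows "bump \<epsilon> (window \<epsilon>)"
  unfolding bump_def
proof (intro conjI allI impI)
  have eq: "window \<epsilon> = (\<lambda>y. indicator {- \<epsilon><..<\<epsilon>} y *\<^sub>R (1 / (2 * \<epsilon>)))"
    by (auto simp: window_def fun_eq_iff indicator_def)
  show "window \<epsilon> \<in> borel_measurable borel" "integrable lborel (window \<epsilon>)"
    unfolding eq using assms by (auto intro!: integrable_scaleR_left simp: integrable_indicator_iff simp del: real_scaleR_def)
  show "(\<integral>y. window \<epsilon> y \<partial>lborel) = 1"
    unfolding eq using assms by simp
  show "\<exists>K. \<forall>y. window \<epsilon> y \<le> K"
    using assms by (intro exI[of _ "1 / (2 * \<epsilon>)"]) (auto simp: window_def)
qed (use assms in \<open>auto simp: window_def\<close>)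

text \<open>The power 8 makes the rate mesh^(1/4) equal to 1 / (n+1)^2, hence summable, while the
  ratio of neighbouring points still tends to 1. A geometric mesh would have the first property but
  not the second.\<close>

definition mesh :: "nat \<Rightarrow> real" where
  "mesh n = 1 / real (Suc n) ^ 8"

lemma mesh_pos: "0 < mesh n"
  by (simp add: mesh_def)

lemma mesh_powr: "mesh n powr (1/4) = 1 / real (Suc n) ^ 2"
proof -
  have "mesh n = (1 / real (Suc n) ^ 2) ^ 4"
    by (simp add: mesh_def power_divide flip: power_mult)
  also have "\<dots> = (1 / real (Suc n) ^ 2) powr 4"
    by simp
  finally have "mesh n powr (1/4) = ((1 / real (Suc n) ^ 2) powr 4) powr (1/4)"
    by (rule arg_cong)
  also have "\<dots> = 1 / real (Suc n) ^ 2"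
    by (simp only: powr_powr) simp
  finally show ?thesis .
qed

lemma mesh_tendsto: "mesh \<longlonglongrightarrow> 0"
proof -
  have "(\<lambda>n. inverse (real (Suc n)) ^ 8) \<longlonglongrightarrow> 0 ^ 8"
    by (intro tendsto_power LIMSEQ_inverse_real_of_nat)
  then show ?thesis by (simp add: mesh_def[abs_def] inverse_eq_divide power_divide)
qed

text \<open>Local time as a measurable function of the code, which is possible because the limit
  runs along a sequence; where it fails to converge the value is arbitrary.\<close>

definition code_local_time :: "(nat \<times> nat \<Rightarrow> real) \<Rightarrow> real \<Rightarrow> real" where
  "code_local_time c t = lim (\<lambda>n. occupation (window (mesh n)) t c)"

lemma measurable_code_local_time [measurable]:
  "(\<lambda>c. code_local_time c t) \<in> borel_measurable code_space"
  unfolding code_local_time_def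
  by (intro borel_measurable_lim_metric measurable_occupation bumpD(1)[OF bump_window] mesh_pos)

text \<open>The expected sum of the absolute increments along the mesh is finite, so almost surely
  the increments are absolutely summable.\<close>

lemma (in std_brownian_motion) AE_occupation_convergent:
  assumes t: "0 \<le> t"
  shows "AE \<omega> in M. convergent (\<lambda>n. occupation (window (mesh n)) t (path_code W \<omega>))"
proof -
  define a where "a n \<omega> = occupation (window (mesh n)) t (path_code W \<omega>)" for n \<omega>
  have [measurable]: "a n \<in> borel_measurable M" for n
    unfolding a_def by (intro measurable_compose[OF path_code_measurable] measurable_occupation bumpD(1)[OF bump_window] mesh_pos)
  have a_bd: "\<bar>a n \<omega>\<bar> \<le> t / (2 * mesh n)" for n \<omega>
  proof -
    have "\<bar>window (mesh n) y\<bar> \<le> 1 / (2 * mesh n)" for y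
      using mesh_pos[of n] by (auto simp: window_def)
    then show ?thesis
      unfolding a_def using occupation_bound[OF bumpD(1)[OF bump_window[OF mesh_pos]] _ t, of n "1 / (2 * mesh n)"] by simp
  qed
  have le: "(\<integral>\<^sup>+\<omega>. ennreal \<bar>a (Suc n) \<omega> - a n \<omega>\<bar> \<partial>M) \<le> ennreal (8 * t powr (3/8) * (1 / real (Suc n) ^ 2))" for n
  proof -
    have "mesh (Suc n) \<le> mesh n"
      by (auto simp: mesh_def intro!: divide_left_mono power_mono)
    then have "(\<integral>\<omega>. \<bar>a (Suc n) \<omega> - a n \<omega>\<bar> \<partial>M) \<le> 8 * mesh n powr (1/4) * t powr (3/8)"
      unfolding a_def using t mesh_pos
      by (intro occupation_diff_L1 bump_mono[OF bump_window[OF mesh_pos[of "Suc n"]]] bump_window) auto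
    moreover have "integrable M (\<lambda>\<omega>. \<bar>a (Suc n) \<omega> - a n \<omega>\<bar>)"
      by (intro integrable_bounded_real[where B = "t / (2 * mesh (Suc n)) + t / (2 * mesh n)"])
        (auto intro!: order_trans[OF abs_triangle_ineq4] add_mono a_bd)
    ultimately show ?thesis
      by (subst nn_integral_eq_integral) (auto simp: mesh_powr mult_ac intro!: ennreal_leI)
  qed
  have sm: "summable (\<lambda>n. 8 * t powr (3/8) * (1 / real (Suc n) ^ 2))"
    using inverse_power_summable[of 2, where 'a = real] summable_Suc_iff[of "\<lambda>n. inverse (real n ^ 2)"]
    by (intro summable_mult) (simp add: inverse_eq_divide)
  have "(\<integral>\<^sup>+\<omega>. (\<Sum>n. ennreal \<bar>a (Suc n) \<omega> - a n \<omega>\<bar>) \<partial>M) = (\<Sum>n. \<integral>\<^sup>+\<omega>. ennreal \<bar>a (Suc n) \<omega> - a n \<omega>\<bar> \<partial>M)"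
    by (rule nn_integral_suminf) measurable
  also have "\<dots> \<le> (\<Sum>n. ennreal (8 * t powr (3/8) * (1 / real (Suc n) ^ 2)))"
    by (intro suminf_le le) auto
  also have "\<dots> < \<infinity>"
    using sm by (subst suminf_ennreal2) auto
  finally have "AE \<omega> in M. (\<Sum>n. ennreal \<bar>a (Suc n) \<omega> - a n \<omega>\<bar>) \<noteq> \<infinity>"
    by (intro nn_integral_PInf_AE) auto
  then show ?thesis
  proof eventually_elim
    case (elim \<omega>)
    then have "summable (\<lambda>n. \<bar>a (Suc n) \<omega> - a n \<omega>\<bar>)"
      by (intro summable_suminf_not_top) auto
    then have "summable (\<lambda>n. a (Suc n) \<omega> - a n \<omega>)"
      by (rule summable_rabs_cancel)
    then have "convergent (\<lambda>n. \<Sum>i<n. a (Suc i) \<omega> - a i \<omega>)"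
      by (simp add: summable_iff_convergent)
    then have "convergent (\<lambda>n. a n \<omega> - a 0 \<omega>)"
      by (simp only: sum_lessThan_telescope[of "\<lambda>i. a i \<omega>"])
    then have "convergent (\<lambda>n. a n \<omega>)"
      using convergent_add[OF _ convergent_const[of "a 0 \<omega>"]] by fastforce
    then show ?case by (simp add: a_def)
  qed
qed

lemma powr_eighth:
  fixes x :: real
  shows "0 \<le> x \<Longrightarrow> (x ^ 8) powr (1/8) = x" "0 < x \<Longrightarrow> (x powr (-1/8)) ^ 8 = 1 / x"
proof -
  have 8: "y ^ 8 = y powr 8" if "0 \<le> y" for y :: real
    using that by simp
  show "0 \<le> x \<Longrightarrow> (x ^ 8) powr (1/8) = x"
    by (simp only: 8 powr_powr) simp
  show "0 < x \<Longrightarrow> (x powr (-1/8)) ^ 8 = 1 / x"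
    by (simp only: 8 powr_ge_zero powr_powr) (simp add: powr_minus_divide)
qed

text \<open>Monotonicity of the occupation time in \<open>\<epsilon>\<close> upgrades convergence along \<open>mesh\<close> to convergence in \<open>\<epsilon>\<close>,
  because consecutive mesh points have ratios tending to 1.\<close>

lemma tendsto_occupation_at_right:
  assumes conv: "(\<lambda>n. occupation (window (mesh n)) t c) \<longlonglongrightarrow> L"
  shows "((\<lambda>\<epsilon>. 1 / (2 * \<epsilon>) * (LINT s:{0..t}|lborel. indicator {y. \<bar>y\<bar> < \<epsilon>} (code_eval c s))) \<longlongrightarrow> L) (at_right 0)"
proof -
  define O' where "O' \<epsilon> = (LINT s:{0..t}|lborel. indicator {y. \<bar>y\<bar> < \<epsilon>} (code_eval c s) :: real)" for \<epsilon>
  define l where "l n = occupation (window (mesh n)) t c" for n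
  have int: "set_integrable lborel {0..t} (\<lambda>s. indicator {y. \<bar>y\<bar> < \<epsilon>} (code_eval c s) :: real)" for \<epsilon>
    by (rule set_integrable_bounded_code[where K = 1]) auto
  have mono: "O' a \<le> O' b" if "a \<le> b" for a b
    unfolding O'_def using that by (intro set_integral_mono int) (auto simp: indicator_def)
  have O_nonneg: "0 \<le> O' a" for a
    unfolding O'_def set_lebesgue_integral_def by (intro integral_nonneg_AE) auto
  have l_eq: "l n = real (Suc n) ^ 8 / 2 * O' (1 / real (Suc n) ^ 8)" for n
  proof -
    have "l n = (LINT s:{0..t}|lborel. 1 / (2 * mesh n) * indicator {y. \<bar>y\<bar> < mesh n} (code_eval c s))"
      unfolding l_def occupation_def
      by (intro set_lebesgue_integral_cong) (auto simp: window_def indicator_def)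
    also have "\<dots> = 1 / (2 * mesh n) * O' (mesh n)"
      unfolding O'_def by (rule set_integral_mult_right)
    finally show ?thesis by (simp add: mesh_def)
  qed
  \<comment> \<open>For 0 < \<epsilon> < 1 this choice gives (N+1)^(-8) \<le> \<epsilon> \<le>
    N^(-8). As \<open>mesh n\<close> is (n+1)^(-8), the two ends are \<open>mesh N\<close> and
    \<open>mesh (N - 1)\<close>; hence the index shift in the upper bound.\<close>
  define N where "N \<epsilon> = nat \<lfloor>\<epsilon> powr (-1/8)\<rfloor>" for \<epsilon> :: real
  have N_lim: "filterlim N sequentially (at_right 0)"
    unfolding filterlim_at_top
  proof
    fix Z :: nat
    define d where "d = 1 / real (Suc Z) ^ 8"
    have "N \<epsilon> \<ge> Z" if "0 < \<epsilon>" "\<epsilon> < d" for \<epsilon>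
    proof -
      have "real (Suc Z) = (real (Suc Z) ^ 8) powr (1/8)"
        by (simp only: powr_eighth of_nat_0_le_iff)
      also have "\<dots> \<le> (1 / \<epsilon>) powr (1/8)"
        using that by (intro powr_mono2) (auto simp: d_def field_simps)
      also have "\<dots> = \<epsilon> powr (-1/8)"
        using that by (simp add: powr_divide powr_minus divide_simps)
      finally show ?thesis unfolding N_def by (simp add: le_nat_iff le_floor_iff)
    qed
    moreover have "0 < d" by (simp add: d_def)
    ultimately show "\<forall>\<^sub>F \<epsilon> in at_right 0. Z \<le> N \<epsilon>"
      unfolding eventually_at_right_field by (intro exI[of _ d]) auto
  qed
  have N_bounds: "real (N \<epsilon>) ^ 8 \<le> 1 / \<epsilon>" "1 / \<epsilon> \<le> real (Suc (N \<epsilon>)) ^ 8" "1 \<le> N \<epsilon>" if "0 < \<epsilon>" "\<epsilon> < 1" for \<epsilon>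
  proof -
    let ?r = "\<epsilon> powr (-1/8)"
    have r: "?r ^ 8 = 1 / \<epsilon>"
      using that by (rule_tac powr_eighth)
    have "1 \<le> ?r"
      using that powr_mono2'[of "-1/8" \<epsilon> 1] by simp
    then have *: "real (N \<epsilon>) \<le> ?r" "?r \<le> real (Suc (N \<epsilon>))" "1 \<le> N \<epsilon>"
      unfolding N_def by (auto simp: le_nat_iff le_floor_iff) linarith+
    show "1 \<le> N \<epsilon>" by fact
    show "real (N \<epsilon>) ^ 8 \<le> 1 / \<epsilon>" "1 / \<epsilon> \<le> real (Suc (N \<epsilon>)) ^ 8"
      unfolding r[symmetric] using * \<open>1 \<le> ?r\<close> by (auto intro!: power_mono)
  qed
  have ratio: "(\<lambda>n. (real n / real (Suc n)) ^ 8) \<longlonglongrightarrow> 1"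
    using tendsto_power[OF LIMSEQ_n_over_Suc_n[where 'a = real], of 8] by simp
  have low: "((\<lambda>\<epsilon>. l (N \<epsilon>) * (real (N \<epsilon>) / real (Suc (N \<epsilon>))) ^ 8) \<longlongrightarrow> L) (at_right 0)"
  proof -
    have "(\<lambda>n. l n * (real n / real (Suc n)) ^ 8) \<longlonglongrightarrow> L * 1"
      using conv by (intro tendsto_mult ratio) (simp add: l_def)
    from filterlim_compose[OF this N_lim] show ?thesis by simp
  qed
  have up: "((\<lambda>\<epsilon>. l (N \<epsilon> - 1) / (real (N \<epsilon>) / real (Suc (N \<epsilon>))) ^ 8) \<longlongrightarrow> L) (at_right 0)"
  proof -
    have "(\<lambda>n. l (n - 1)) \<longlonglongrightarrow> L"
      by (rule LIMSEQ_offset[where k = 1]) (use conv in \<open>simp add: l_def\<close>)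
    then have "(\<lambda>n. l (n - 1) / (real n / real (Suc n)) ^ 8) \<longlonglongrightarrow> L / 1"
      by (intro tendsto_divide ratio) auto
    from filterlim_compose[OF this N_lim] show ?thesis by simp
  qed
  have ev: "\<forall>\<^sub>F \<epsilon> in at_right 0. 0 < \<epsilon> \<and> \<epsilon> < (1::real)"
    unfolding eventually_at_right_field by (intro exI[of _ 1]) auto
  have "((\<lambda>\<epsilon>. 1 / (2 * \<epsilon>) * O' \<epsilon>) \<longlongrightarrow> L) (at_right 0)"
  proof (rule tendsto_sandwich[OF _ _ low up])
    show "\<forall>\<^sub>F \<epsilon> in at_right 0. l (N \<epsilon>) * (real (N \<epsilon>) / real (Suc (N \<epsilon>))) ^ 8 \<le> 1 / (2 * \<epsilon>) * O' \<epsilon>"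
      using ev
    proof eventually_elim
      case (elim \<epsilon>)
      then have e: "0 < \<epsilon>" "\<epsilon> < 1" by auto
      note N = N_bounds[OF e]
      have "l (N \<epsilon>) * (real (N \<epsilon>) / real (Suc (N \<epsilon>))) ^ 8 = real (N \<epsilon>) ^ 8 / 2 * O' (1 / real (Suc (N \<epsilon>)) ^ 8)"
        unfolding l_eq by (simp add: power_divide)
      also have "\<dots> \<le> (1 / \<epsilon>) / 2 * O' \<epsilon>"
      proof (intro mult_mono mono O_nonneg)
        show "1 / real (Suc (N \<epsilon>)) ^ 8 \<le> \<epsilon>"
          using N(2) e by (simp add: field_simps)
      qed (use N e in auto)
      finally show ?case by simp
    qed
    show "\<forall>\<^sub>F \<epsilon> in at_right 0. 1 / (2 * \<epsilon>) * O' \<epsilon> \<le> l (N \<epsilon> - 1) / (real (N \<epsilon>) / real (Suc (N \<epsilon>))) ^ 8"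
      using ev
    proof eventually_elim
      case (elim \<epsilon>)
      then have e: "0 < \<epsilon>" "\<epsilon> < 1" by auto
      note N = N_bounds[OF e]
      have "1 / (2 * \<epsilon>) * O' \<epsilon> = (1 / \<epsilon>) / 2 * O' \<epsilon>" by simp
      also have "\<dots> \<le> real (Suc (N \<epsilon>)) ^ 8 / 2 * O' (1 / real (N \<epsilon>) ^ 8)"
      proof (intro mult_mono mono O_nonneg)
        show "\<epsilon> \<le> 1 / real (N \<epsilon>) ^ 8"
          using N(1,3) e by (simp add: field_simps)
      qed (use N e in auto)
      also have "\<dots> = l (N \<epsilon> - 1) / (real (N \<epsilon>) / real (Suc (N \<epsilon>))) ^ 8"
        unfolding l_eq using N(3) by (simp add: power_divide)
      finally show ?case .
    qed
  qed
  then show ?thesis by (simp add: O'_def)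
qed

text \<open>Wherever the mesh sequence converges, the limit over \<epsilon> exists and is the same,
  so for each fixed \<open>t\<close> the \<open>Lim\<close> in \<open>local_time\<close> almost
  surely has its genuine value.\<close>

lemma (in std_brownian_motion) AE_local_time:
  assumes t: "0 \<le> t"
  shows "AE \<omega> in M. (\<lambda>n. occupation (window (mesh n)) t (path_code W \<omega>)) \<longlonglongrightarrow> code_local_time (path_code W \<omega>) t \<and>
    local_time (\<lambda>s. W s \<omega>) t = code_local_time (path_code W \<omega>) t"
  using AE_occupation_convergent[OF t] AE_space
proof eventually_elim
  case (elim \<omega>)
  then have L: "(\<lambda>n. occupation (window (mesh n)) t (path_code W \<omega>)) \<longlonglongrightarrow> code_local_time (path_code W \<omega>) t"
    by (simp add: code_local_time_def convergent_LIMSEQ_iff)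
  have "(LINT s:{0..t}|lborel. indicator {y. \<bar>y\<bar> < \<epsilon>} (code_eval (path_code W \<omega>) s)) = (LINT s:{0..t}|lborel. indicator {y. \<bar>y\<bar> < \<epsilon>} (W s \<omega>) :: real)" for \<epsilon>
    using elim by (intro set_lebesgue_integral_cong) (auto simp: code_eval_W)
  then have "((\<lambda>\<epsilon>. 1 / (2 * \<epsilon>) * (LINT s:{0..t}|lborel. indicator {y. \<bar>y\<bar> < \<epsilon>} (W s \<omega>))) \<longlongrightarrow> code_local_time (path_code W \<omega>) t) (at_right 0)"
    using tendsto_occupation_at_right[OF L] by simp
  then have "local_time (\<lambda>s. W s \<omega>) t = code_local_time (path_code W \<omega>) t"
    unfolding local_time_def by (intro tendsto_Lim) auto
  with L show ?case by simp
qed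

subsection \<open>The Feynman--Kac equation\<close>

text \<open>A continuous bump: the Feynman--Kac equation is derived pathwise from the fundamental
  theorem of calculus, for which the discontinuous window is unsuitable.\<close>

definition tent :: "real \<Rightarrow> real \<Rightarrow> real" where
  "tent \<eta> y = max 0 (\<eta> - \<bar>y\<bar>) / \<eta>\<^sup>2"

text \<open>Up to a factor 2 this is an antiderivative of the absolute value, from which the mass of
  the tent is computed.\<close>

lemma has_real_derivative_mult_abs: "((\<lambda>y. y * \<bar>y\<bar>) has_real_derivative 2 * \<bar>x\<bar>) (at x)" for x :: real
proof (cases "x = 0")
  case True
  have "((\<lambda>h. (h * \<bar>h\<bar> - 0 * \<bar>0\<bar>) / (h - 0)) \<longlongrightarrow> 0) (at (0::real))"
  proof (rule Lim_transform_eventually)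
    show "((\<lambda>h::real. \<bar>h\<bar>) \<longlongrightarrow> 0) (at 0)"
      by (rule tendsto_rabs_zero) (rule tendsto_ident_at)
    show "\<forall>\<^sub>F h in at (0::real). \<bar>h\<bar> = (h * \<bar>h\<bar> - 0 * \<bar>0\<bar>) / (h - 0)"
      by (auto simp: eventually_at_filter)
  qed
  then show ?thesis using True by (simp add: has_field_derivative_iff)
next
  case False
  then consider "0 < x" | "x < 0" by linarith
  then show ?thesis
  proof cases
    case 1
    have "((\<lambda>y. y * y) has_real_derivative 2 * \<bar>x\<bar>) (at x)"
      using 1 by (auto intro!: derivative_eq_intros)
    then show ?thesis
      by (rule has_field_derivative_transform_within_open[where S = "{0<..}"]) (use 1 in auto)
  next
    case 2
    have "((\<lambda>y. - (y * y)) has_real_derivative 2 * \<bar>x\<bar>) (at x)"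
      using 2 by (auto intro!: derivative_eq_intros)
    then show ?thesis
      by (rule has_field_derivative_transform_within_open[where S = "{..<0}"]) (use 2 in auto)
  qed
qed

lemma bump_tent:
  assumes "0 < \<eta>"
  shows "bump \<eta> (tent \<eta>)"
proof -
  have [measurable]: "tent \<eta> \<in> borel_measurable borel"
    unfolding tent_def[abs_def] by measurable
  have nn: "0 \<le> tent \<eta> y" for y
    by (simp add: tent_def)
  have supp: "tent \<eta> y = 0" if "\<eta> < \<bar>y\<bar>" for y
    using that by (simp add: tent_def)
  let ?F = "\<lambda>y. (\<eta> * y - y * \<bar>y\<bar> / 2) / \<eta>\<^sup>2"
  have "(\<integral>\<^sup>+y. ennreal (tent \<eta> y) * indicator {- \<eta>..\<eta>} y \<partial>lborel) = ennreal (?F \<eta> - ?F (- \<eta>))"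
  proof (rule nn_integral_FTC_Icc)
    fix y assume y: "y \<in> {- \<eta>..\<eta>}"
    have "(?F has_real_derivative (\<eta> - 2 * \<bar>y\<bar> / 2) / \<eta>\<^sup>2) (at y)"
      by (intro DERIV_cdivide DERIV_diff has_real_derivative_mult_abs DERIV_cmult_Id)
    also have "(\<eta> - 2 * \<bar>y\<bar> / 2) / \<eta>\<^sup>2 = tent \<eta> y"
      using y by (auto simp: tent_def)
    finally show "(?F has_real_derivative tent \<eta> y) (at y)" .
  qed (use assms nn in auto)
  also have "?F \<eta> - ?F (- \<eta>) = 1"
    using assms by (simp add: power2_eq_square divide_simps)
  also have "(\<integral>\<^sup>+y. ennreal (tent \<eta> y) * indicator {- \<eta>..\<eta>} y \<partial>lborel) = (\<integral>\<^sup>+y. ennreal (tent \<eta> y) \<partial>lborel)"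
    using supp by (intro nn_integral_cong) (auto simp: indicator_def not_le)
  finally have I: "(\<integral>\<^sup>+y. ennreal (tent \<eta> y) \<partial>lborel) = ennreal 1" .
  have "has_bochner_integral lborel (tent \<eta>) 1"
    by (rule has_bochner_integral_nn_integral) (use nn I in auto)
  then have "integrable lborel (tent \<eta>)" "(\<integral>y. tent \<eta> y \<partial>lborel) = 1"
    by (auto simp: has_bochner_integral_iff)
  moreover have "tent \<eta> y \<le> \<eta> / \<eta>\<^sup>2" for y
    unfolding tent_def using assms by (intro divide_right_mono) auto
  ultimately show ?thesis
    unfolding bump_def using nn supp by auto
qed

lemma continuous_on_tent: "continuous_on A (tent \<eta>)"
  unfolding tent_def[abs_def] by (cases "\<eta> = 0") (auto intro!: continuous_intros)

text \<open>With \<open>H\<close> the integral of \<open>h\<close>, the function exp (- (H t - H s))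
  of \<open>s\<close> has derivative \<open>h s\<close> times itself. Putting into the exponent what
  accrues after \<open>s\<close>, not before, is what lets the Markov property at \<open>s\<close>
  turn it into the expectation for a fresh path.\<close>

lemma feynman_kac_path:
  fixes h :: "real \<Rightarrow> real"
  assumes h: "continuous_on {0..t} h" and t: "0 \<le> t"
  shows "1 - exp (- (LINT s:{0..t}|lborel. h s))
    = (LINT s:{0..t}|lborel. h s * exp (- ((LINT r:{0..t}|lborel. h r) - (LINT r:{0..s}|lborel. h r))))"
proof -
  define H where "H s = integral {0..s} h" for s
  have H: "(LINT r:{0..s}|lborel. h r) = H s" if "s \<in> {0..t}" for s
    unfolding H_def using that
    by (intro set_borel_integral_eq_integral(2) borel_integrable_atLeastAtMost' continuous_on_subset[OF h]) auto
  have dH: "(H has_vector_derivative h s) (at s within {0..t})" if "s \<in> {0..t}" for s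
    unfolding H_def by (rule integral_has_vector_derivative[OF h that])
  have cH: "continuous_on {0..t} H"
    unfolding H_def by (rule indefinite_integral_continuous_1[OF integrable_continuous_interval[OF h]])
  let ?f = "\<lambda>s. h s * exp (- (H t - H s))"
  have "(?f has_integral exp (- (H t - H t)) - exp (- (H t - H 0))) {0..t}"
  proof (rule fundamental_theorem_of_calculus[OF t])
    fix s assume s: "s \<in> {0..t}"
    have "(H has_real_derivative h s) (at s within {0..t})"
      using dH[OF s] by (simp add: has_real_derivative_iff_has_vector_derivative)
    then have "((\<lambda>s. exp (- (H t - H s))) has_real_derivative ?f s) (at s within {0..t})"
      by (auto intro!: derivative_eq_intros)
    then show "((\<lambda>s. exp (- (H t - H s))) has_vector_derivative ?f s) (at s within {0..t})"
      by (simp add: has_real_derivative_iff_has_vector_derivative)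
  qed
  moreover have "H 0 = 0" by (simp add: H_def)
  ultimately have "integral {0..t} ?f = 1 - exp (- H t)"
    by (simp add: integral_unique)
  moreover have "(LINT s:{0..t}|lborel. ?f s) = integral {0..t} ?f"
    by (intro set_borel_integral_eq_integral(2) borel_integrable_atLeastAtMost' continuous_intros h cH)
  moreover have "(LINT s:{0..t}|lborel. h s * exp (- ((LINT r:{0..t}|lborel. h r) - (LINT r:{0..s}|lborel. h r)))) = (LINT s:{0..t}|lborel. ?f s)"
    using t by (intro set_lebesgue_integral_cong) (auto simp: H)
  ultimately show ?thesis
    using t by (simp add: H)
qed

lemma set_integral_split_shift:
  fixes h :: "real \<Rightarrow> real"
  assumes h: "continuous_on {0..t} h" and s: "0 \<le> s" "s \<le> t"
  shows "(LINT r:{0..t}|lborel. h r) - (LINT r:{0..s}|lborel. h r) = (LINT v:{0..t - s}|lborel. h (s + v))"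
proof -
  have c: "continuous_on {0..s} h" "continuous_on {s..t} h"
    using s by (auto intro: continuous_on_subset[OF h])
  have c': "continuous_on {0..t - s} (\<lambda>v. h (s + v))"
    by (rule continuous_on_compose2[OF h]) (use s in \<open>auto intro!: continuous_intros\<close>)
  have "(LINT v:{0..t - s}|lborel. h (s + v)) = integral {0..t - s} (\<lambda>v. h (s + v))"
    by (intro set_borel_integral_eq_integral(2) borel_integrable_atLeastAtMost' c')
  also have "\<dots> = integral {s..t} h"
    using integral_shift[where a = 0 and b = "t - s" and c = s and f = h] c(2) by (simp add: comp_def add.commute)
  also have "\<dots> = integral {0..t} h - integral {0..s} h"
    using Henstock_Kurzweil_Integration.integral_combine[of 0 s t h] s integrable_continuous_interval[OF h] by simp
  also have "\<dots> = (LINT r:{0..t}|lborel. h r) - (LINT r:{0..s}|lborel. h r)"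
    using borel_integrable_atLeastAtMost'[OF h] borel_integrable_atLeastAtMost'[OF c(1)]
    by (simp add: set_borel_integral_eq_integral(2))
  finally show ?thesis by simp
qed

lemma exp_neg_diff_le:
  fixes a b :: real
  assumes "0 \<le> a" "0 \<le> b"
  shows "\<bar>exp (- a) - exp (- b)\<bar> \<le> \<bar>a - b\<bar>"
proof -
  have *: "exp (- a) - exp (- b) \<le> b - a" if "0 \<le> a" "a \<le> b" for a b :: real
  proof -
    have "exp (- a) - exp (- b) = exp (- a) * (1 - exp (- (b - a)))"
      by (simp add: right_diff_distrib flip: exp_add)
    also have "\<dots> \<le> 1 * (b - a)"
    proof (intro mult_mono)
      show "1 - exp (- (b - a)) \<le> b - a"
        using exp_ge_add_one_self[of "- (b - a)"] by linarith
    qed (use that in auto)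
    finally show ?thesis by simp
  qed
  show ?thesis
    using *[of a b] *[of b a] assms by (cases "a \<le> b") auto
qed

lemma measurable_occupation_joint [measurable]:
  assumes [measurable]: "\<phi> \<in> borel_measurable borel"
  shows "(\<lambda>p. occupation (\<lambda>y. \<phi> (fst p + y)) t (snd p)) \<in> borel_measurable (borel \<Otimes>\<^sub>M code_space)"
  unfolding occupation_def set_lebesgue_integral_def by measurable

lemma measurable_occupation_time:
  assumes [measurable]: "\<phi> \<in> borel_measurable borel"
  shows "(\<lambda>p. occupation \<phi> (snd p) (fst p)) \<in> borel_measurable (code_space \<Otimes>\<^sub>M borel)"
proof -
  have "(\<lambda>p. \<integral>s. (if 0 \<le> s \<and> s \<le> snd p then \<phi> (code_eval (fst p) s) else 0) \<partial>lborel) \<in> borel_measurable (code_space \<Otimes>\<^sub>M borel)"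
    by measurable
  also have "(\<lambda>p. \<integral>s. (if 0 \<le> s \<and> s \<le> snd p then \<phi> (code_eval (fst p) s) else 0) \<partial>lborel) = (\<lambda>p. occupation \<phi> (snd p) (fst p))"
    unfolding occupation_def set_lebesgue_integral_def
    by (intro ext Bochner_Integration.integral_cong) (auto simp: indicator_def)
  finally show ?thesis .
qed

lemma integral_gauss:
  fixes f :: "real \<Rightarrow> real"
  assumes "0 < s" and [measurable]: "f \<in> borel_measurable borel"
  shows "(\<integral>x. f x \<partial>gauss s) = (\<integral>x. normal_density 0 (sqrt s) x * f x \<partial>lborel)"
  using assms by (simp add: gauss_def integral_density)

lemma integrable_normal_times:
  assumes s: "0 < s" and f: "integrable lborel f"
  shows "integrable lborel (\<lambda>x. normal_density 0 (sqrt s) x * f x)"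
proof (rule Bochner_Integration.integrable_bound)
  show "integrable lborel (\<lambda>x. 1 / sqrt (2 * pi * s) * f x)"
    using f by simp
  have "\<bar>normal_density 0 (sqrt s) x * f x\<bar> \<le> 1 / sqrt (2 * pi * s) * \<bar>f x\<bar>" for x
    unfolding abs_mult using normal_density_le[OF s, of x] by (intro mult_right_mono) auto
  then show "AE x in lborel. norm (normal_density 0 (sqrt s) x * f x) \<le> norm (1 / sqrt (2 * pi * s) * f x)"
    using s by (simp add: abs_mult)
qed (use f in measurable)

lemma gauss_bump_le:
  assumes s: "0 < s" and b: "bump \<eta> \<phi>"
  shows "(\<integral>x. \<phi> x \<partial>gauss s) \<le> 1 / sqrt (2 * pi * s)" "0 \<le> (\<integral>x. \<phi> x \<partial>gauss s)"
proof -
  note B = bumpD[OF b]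
  have "(\<integral>x. \<phi> x \<partial>gauss s) = (\<integral>x. normal_density 0 (sqrt s) x * \<phi> x \<partial>lborel)"
    using s B(1) by (rule integral_gauss)
  also have "\<dots> \<le> (\<integral>x. 1 / sqrt (2 * pi * s) * \<phi> x \<partial>lborel)"
    using B normal_density_le[OF s] by (intro integral_mono integrable_normal_times s mult_right_mono) auto
  also have "\<dots> = 1 / sqrt (2 * pi * s)" using B by simp
  finally show "(\<integral>x. \<phi> x \<partial>gauss s) \<le> 1 / sqrt (2 * pi * s)" .
  show "0 \<le> (\<integral>x. \<phi> x \<partial>gauss s)"
    using B by (intro integral_nonneg_AE) auto
qed

text \<open>A bump has mass 1, so its Gaussian mean differs from the density at 0 only through the
  oscillation of the density over the support.\<close>

lemma gauss_bump_approx: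
  assumes s: "0 < s" and \<eta>: "0 < \<eta>" and b: "bump \<eta> \<phi>"
  shows "\<bar>(\<integral>x. \<phi> x \<partial>gauss s) - 1 / sqrt (2 * pi * s)\<bar> \<le> \<eta> powr (1/2) * s powr (-3/4)"
proof -
  note B = bumpD[OF b]
  let ?p = "normal_density 0 (sqrt s)"
  have p0: "?p 0 = 1 / sqrt (2 * pi * s)"
    using s by (simp add: normal_density_def)
  have I: "integrable lborel (\<lambda>x. ?p x * \<phi> x)"
    using s B by (intro integrable_normal_times)
  have "(\<integral>x. \<phi> x \<partial>gauss s) - 1 / sqrt (2 * pi * s) = (\<integral>x. ?p x * \<phi> x \<partial>lborel) - (\<integral>x. ?p 0 * \<phi> x \<partial>lborel)"
    using s B by (simp add: integral_gauss p0)
  also have "\<dots> = (\<integral>x. (?p x - ?p 0) * \<phi> x \<partial>lborel)"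
    using I B by (simp add: left_diff_distrib)
  finally have eq: "(\<integral>x. \<phi> x \<partial>gauss s) - 1 / sqrt (2 * pi * s) = (\<integral>x. (?p x - ?p 0) * \<phi> x \<partial>lborel)" .
  have "\<bar>\<integral>x. (?p x - ?p 0) * \<phi> x \<partial>lborel\<bar> \<le> (\<integral>x. \<eta> powr (1/2) * s powr (-3/4) * \<phi> x \<partial>lborel)"
  proof (rule integral_abs_bound_integral)
    show "integrable lborel (\<lambda>x. (?p x - ?p 0) * \<phi> x)"
      using I B by (simp add: left_diff_distrib)
    show "\<bar>(?p x - ?p 0) * \<phi> x\<bar> \<le> \<eta> powr (1/2) * s powr (-3/4) * \<phi> x" for x
    proof (cases "\<bar>x\<bar> \<le> \<eta>")
      case True
      then show ?thesis
        unfolding abs_mult using B(2)[of x] \<eta>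
        by (intro mult_mono normal_density_diff_bound s) auto
    next
      case False
      then show ?thesis using B(3)[of x] by simp
    qed
  qed (use B in simp)
  also have "\<dots> = \<eta> powr (1/2) * s powr (-3/4)"
    using B by simp
  finally show ?thesis unfolding eq .
qed

lemma set_integrable_inverse_sqrt:
  assumes "0 \<le> t"
  shows "set_integrable lborel {0..t} (\<lambda>s. 1 / sqrt (2 * pi * s))"
  unfolding set_integrable_def
proof (rule integrableI_bounded)
  have "(\<integral>\<^sup>+s. ennreal (norm (indicator {0..t} s *\<^sub>R (1 / sqrt (2 * pi * s)))) \<partial>lborel)
    \<le> (\<integral>\<^sup>+s. ennreal (s powr (-1/2)) * indicator {0..t} s \<partial>lborel)"
  proof (intro nn_integral_mono)
    fix s :: real
    show "ennreal (norm (indicator {0..t} s *\<^sub>R (1 / sqrt (2 * pi * s)))) \<le> ennreal (s powr (-1/2)) * indicator {0..t} s"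
    proof (cases "0 < s \<and> s \<le> t")
      case True
      have "1 / sqrt (2 * pi * s) \<le> 1 / sqrt (1 * s)"
        using True pi_gt3 by (intro divide_left_mono real_sqrt_le_mono mult_right_mono) auto
      also have "\<dots> = s powr (-1/2)"
        using True by (simp add: powr_minus powr_half_sqrt divide_simps)
      finally show ?thesis using True by (simp add: ennreal_leI)
    qed (auto simp: indicator_def)
  qed
  also have "\<dots> < \<infinity>"
    using assms by (subst nn_integral_powr_Icc) auto
  finally show "(\<integral>\<^sup>+s. ennreal (norm (indicator {0..t} s *\<^sub>R (1 / sqrt (2 * pi * s)))) \<partial>lborel) < \<infinity>" .
qed measurable

context std_brownian_motion
begin

text \<open>The probability of no split up to time \<open>t\<close> if splitting happened at the
  bounded rate \<beta> \<phi>(W) instead of along the local time.\<close>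

definition survival :: "(real \<Rightarrow> real) \<Rightarrow> real \<Rightarrow> real \<Rightarrow> real" where
  "survival \<phi> \<beta> t = (\<integral>\<omega>. exp (- (\<beta> * occupation \<phi> t (path_code W \<omega>))) \<partial>M)"

lemma exp_occupation_le_1: "0 \<le> \<beta> \<Longrightarrow> (\<And>y. 0 \<le> \<phi> y) \<Longrightarrow> exp (- (\<beta> * occupation \<phi> t c)) \<le> 1"
  by (simp add: occupation_nonneg)

lemma integrable_exp_occupation:
  assumes "bump \<eta> \<phi>" "0 \<le> \<beta>"
  shows "integrable M (\<lambda>\<omega>. exp (- (\<beta> * occupation \<phi> t (path_code W \<omega>))))"
  using bumpD(1,2)[OF assms(1)] assms(2)
  by (intro integrable_bounded_real[where B = 1]) (auto intro!: mult_nonneg_nonneg occupation_nonneg)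

lemma survival_bounds:
  assumes "bump \<eta> \<phi>" "0 \<le> \<beta>"
  shows "0 \<le> survival \<phi> \<beta> t" "survival \<phi> \<beta> t \<le> 1"
proof -
  show "0 \<le> survival \<phi> \<beta> t" unfolding survival_def by simp
  have "survival \<phi> \<beta> t \<le> (\<integral>\<omega>. 1 \<partial>M)"
    unfolding survival_def
    by (intro integral_mono integrable_exp_occupation[OF assms]) (use bumpD(2)[OF assms(1)] assms(2) in \<open>auto intro!: mult_nonneg_nonneg occupation_nonneg\<close>)
  then show "survival \<phi> \<beta> t \<le> 1" by (simp add: prob_space)
qed

text \<open>The map y to exp (- y) is 1-Lipschitz on the nonnegative half-line, so the mean
  difference of the occupation times controls that of the survival functions.\<close>

lemma survival_diff:
  assumes "bump \<eta> \<phi>" "bump \<eta> \<psi>" "0 < \<eta>" "0 \<le> t" "0 \<le> \<beta>"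
  shows "\<bar>survival \<phi> \<beta> t - survival \<psi> \<beta> t\<bar> \<le> \<beta> * (8 * \<eta> powr (1/4) * t powr (3/8))"
proof -
  let ?a = "\<lambda>\<omega>. occupation \<phi> t (path_code W \<omega>)" and ?b = "\<lambda>\<omega>. occupation \<psi> t (path_code W \<omega>)"
  have [measurable]: "\<phi> \<in> borel_measurable borel" "\<psi> \<in> borel_measurable borel"
    using bumpD(1) assms(1,2) by auto
  obtain K1 K2 where K: "\<And>y. \<phi> y \<le> K1" "\<And>y. \<psi> y \<le> K2"
    using assms(1,2) by (auto simp: bump_def)
  have b1: "\<bar>?a \<omega>\<bar> \<le> K1 * t" for \<omega>
    using K(1) bumpD(2)[OF assms(1)] assms(4) by (intro occupation_bound) auto
  have b2: "\<bar>?b \<omega>\<bar> \<le> K2 * t" for \<omega>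
    using K(2) bumpD(2)[OF assms(2)] assms(4) by (intro occupation_bound) auto
  have I: "integrable M (\<lambda>\<omega>. \<beta> * \<bar>?a \<omega> - ?b \<omega>\<bar>)"
    by (intro integrable_mult_right integrable_abs Bochner_Integration.integrable_diff
        integrable_bounded_real[OF _ b1] integrable_bounded_real[OF _ b2]) measurable
  have eq: "survival \<phi> \<beta> t - survival \<psi> \<beta> t = (\<integral>\<omega>. exp (- (\<beta> * ?a \<omega>)) - exp (- (\<beta> * ?b \<omega>)) \<partial>M)"
    unfolding survival_def by (intro Bochner_Integration.integral_diff[symmetric] integrable_exp_occupation[OF assms(1,5)] integrable_exp_occupation[OF assms(2,5)])
  have "\<bar>\<integral>\<omega>. exp (- (\<beta> * ?a \<omega>)) - exp (- (\<beta> * ?b \<omega>)) \<partial>M\<bar> \<le> (\<integral>\<omega>. \<beta> * \<bar>?a \<omega> - ?b \<omega>\<bar> \<partial>M)"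
  proof (rule order_trans[OF integral_abs_bound integral_mono[OF _ I]])
    show "integrable M (\<lambda>\<omega>. \<bar>exp (- (\<beta> * ?a \<omega>)) - exp (- (\<beta> * ?b \<omega>))\<bar>)"
      by (intro integrable_abs Bochner_Integration.integrable_diff integrable_exp_occupation[OF assms(1,5)] integrable_exp_occupation[OF assms(2,5)])
    show "\<bar>exp (- (\<beta> * ?a \<omega>)) - exp (- (\<beta> * ?b \<omega>))\<bar> \<le> \<beta> * \<bar>?a \<omega> - ?b \<omega>\<bar>" for \<omega>
    proof -
      have "\<bar>exp (- (\<beta> * ?a \<omega>)) - exp (- (\<beta> * ?b \<omega>))\<bar> \<le> \<bar>\<beta> * ?a \<omega> - \<beta> * ?b \<omega>\<bar>"
        using bumpD(2)[OF assms(1)] bumpD(2)[OF assms(2)] assms(5)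
        by (intro exp_neg_diff_le mult_nonneg_nonneg occupation_nonneg) auto
      also have "\<dots> = \<beta> * \<bar>?a \<omega> - ?b \<omega>\<bar>"
        using assms(5) by (simp add: abs_mult flip: right_diff_distrib)
      finally show ?thesis .
    qed
  qed
  also have "\<dots> = \<beta> * (\<integral>\<omega>. \<bar>?a \<omega> - ?b \<omega>\<bar> \<partial>M)" by simp
  also have "\<dots> \<le> \<beta> * (8 * \<eta> powr (1/4) * t powr (3/8))"
    using assms by (intro mult_left_mono occupation_diff_L1) auto
  finally show ?thesis unfolding eq .
qed

text \<open>Conditioning at time \<open>s\<close>, the path stands at \<open>x\<close>, and its
  occupation time after \<open>s\<close> is that of a fresh path run for time t - s, measured with
  the translate of \<open>\<phi>\<close> by \<open>x\<close>.\<close>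

lemma feynman_kac:
  assumes b: "bump \<eta> \<phi>" and c: "continuous_on UNIV \<phi>" and \<beta>: "0 \<le> \<beta>" and t: "0 \<le> t"
  shows "1 - survival \<phi> \<beta> t = (LINT s:{0..t}|lborel. \<beta> * (\<integral>x. \<phi> x * survival (\<lambda>y. \<phi> (x + y)) \<beta> (t - s) \<partial>gauss s))"
    and "set_integrable lborel {0..t} (\<lambda>s. \<beta> * (\<integral>x. \<phi> x * survival (\<lambda>y. \<phi> (x + y)) \<beta> (t - s) \<partial>gauss s))"
proof -
  have \<phi>m [measurable]: "\<phi> \<in> borel_measurable borel" by (rule bumpD(1)[OF b])
  have nn: "0 \<le> \<phi> y" for y by (rule bumpD(2)[OF b])
  obtain K where K: "\<And>y. \<phi> y \<le> K" using b by (auto simp: bump_def)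
  have absK: "\<bar>\<phi> y\<bar> \<le> K" for y using nn K by simp
  have K0: "0 \<le> K" using nn[of 0] K[of 0] by linarith
  note [measurable] = measurable_occupation_time[OF \<phi>m]
  let ?A = "\<lambda>s \<omega>. occupation \<phi> s (path_code W \<omega>)"
  \<comment> \<open>The path enters through its code, which makes \<open>F\<close> jointly
    measurable in (\<omega>, s); together with the bound \<beta> K on [0, t] this is what Fubini
    asks for.\<close>
  define F where "F s \<omega> = indicator {0..t} s * (\<beta> * \<phi> (code_eval (path_code W \<omega>) s) * exp (- (\<beta> * (?A t \<omega> - ?A s \<omega>))))" for s \<omega>
  have A_eq: "?A s \<omega> = (LINT r:{0..s}|lborel. \<phi> (W r \<omega>))" if "\<omega> \<in> space M" for s \<omega>
    unfolding occupation_def using that by (intro set_lebesgue_integral_cong) (auto simp: code_eval_W)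
  have cW: "continuous_on {0..t} (\<lambda>s. \<phi> (W s \<omega>))" if "\<omega> \<in> space M" for \<omega>
    by (rule continuous_on_compose2[OF c continuous_on_subset[OF W_continuous[OF that]]]) auto
  have A_diff: "?A t \<omega> - ?A s \<omega> = (LINT v:{0..t - s}|lborel. \<phi> (W (s + v) \<omega>))" if "\<omega> \<in> space M" "0 \<le> s" "s \<le> t" for s \<omega>
    unfolding A_eq[OF that(1)] by (rule set_integral_split_shift[OF cW[OF that(1)] that(2,3)])
  have A_mono: "0 \<le> ?A t \<omega> - ?A s \<omega>" if "\<omega> \<in> space M" "0 \<le> s" "s \<le> t" for s \<omega>
    unfolding A_diff[OF that] set_lebesgue_integral_def using nn by (intro integral_nonneg_AE) auto
  have path: "1 - exp (- (\<beta> * ?A t \<omega>)) = (\<integral>s. F s \<omega> \<partial>lborel)" if \<omega>: "\<omega> \<in> space M" for \<omega>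
  proof -
    have \<beta>A: "(LINT r:{0..s}|lborel. \<beta> * \<phi> (W r \<omega>)) = \<beta> * ?A s \<omega>" for s
      unfolding A_eq[OF \<omega>] by simp
    have "1 - exp (- (LINT s:{0..t}|lborel. \<beta> * \<phi> (W s \<omega>))) = (LINT s:{0..t}|lborel. \<beta> * \<phi> (W s \<omega>) *
        exp (- ((LINT r:{0..t}|lborel. \<beta> * \<phi> (W r \<omega>)) - (LINT r:{0..s}|lborel. \<beta> * \<phi> (W r \<omega>)))))"
      by (intro feynman_kac_path t continuous_intros cW \<omega>)
    then have "1 - exp (- (\<beta> * ?A t \<omega>)) = (LINT s:{0..t}|lborel. \<beta> * \<phi> (W s \<omega>) * exp (- (\<beta> * ?A t \<omega> - \<beta> * ?A s \<omega>)))"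
      unfolding \<beta>A .
    also have "(LINT s:{0..t}|lborel. \<beta> * \<phi> (W s \<omega>) * exp (- (\<beta> * ?A t \<omega> - \<beta> * ?A s \<omega>))) = (\<integral>s. F s \<omega> \<partial>lborel)"
      unfolding set_lebesgue_integral_def F_def
      by (intro Bochner_Integration.integral_cong) (auto simp: code_eval_W \<omega> right_diff_distrib indicator_def)
    finally show ?thesis .
  qed
  have F_bd: "\<bar>F s \<omega>\<bar> \<le> indicator {0..t} s * (\<beta> * K)" if "\<omega> \<in> space M" for s \<omega>
  proof (cases "s \<in> {0..t}")
    case True
    have "\<beta> * \<phi> (code_eval (path_code W \<omega>) s) * exp (- (\<beta> * (?A t \<omega> - ?A s \<omega>))) \<le> (\<beta> * K) * 1"
      using A_mono[OF that, of s] True \<beta> K nn K0 by (intro mult_mono) auto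
    then show ?thesis using True \<beta> nn by (simp add: F_def abs_mult)
  qed (simp add: F_def)
  have F_meas [measurable]: "(\<lambda>p. F (snd p) (fst p)) \<in> borel_measurable (M \<Otimes>\<^sub>M lborel)"
  proof -
    have [measurable]: "(\<lambda>p. occupation \<phi> (snd p) (path_code W (fst p))) \<in> borel_measurable (M \<Otimes>\<^sub>M lborel)"
      using measurable_compose[OF _ measurable_occupation_time[OF \<phi>m], of "\<lambda>p. (path_code W (fst p), snd p)" "M \<Otimes>\<^sub>M lborel"] by simp
    show ?thesis unfolding F_def by measurable
  qed
  interpret PL: pair_sigma_finite M lborel ..
  have F_int: "integrable (M \<Otimes>\<^sub>M lborel) (\<lambda>p. F (snd p) (fst p))"
  proof (rule integrableI_bounded)
    have "(\<integral>\<^sup>+p. ennreal (norm (F (snd p) (fst p))) \<partial>(M \<Otimes>\<^sub>M lborel)) = (\<integral>\<^sup>+\<omega>. \<integral>\<^sup>+s. ennreal (norm (F s \<omega>)) \<partial>lborel \<partial>M)"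
      by (subst lborel.nn_integral_fst[symmetric]) auto
    also have "\<dots> \<le> (\<integral>\<^sup>+\<omega>. \<integral>\<^sup>+s. indicator {0..t} s * ennreal (\<beta> * K) \<partial>lborel \<partial>M)"
    proof (intro nn_integral_mono)
      fix \<omega> s assume "\<omega> \<in> space M"
      from F_bd[OF this, of s] show "ennreal (norm (F s \<omega>)) \<le> indicator {0..t} s * ennreal (\<beta> * K)"
        by (cases "s \<in> {0..t}") (auto intro!: ennreal_leI)
    qed
    also have "\<dots> < \<infinity>"
      using t by (simp add: nn_integral_multc emeasure_space_1 ennreal_mult_less_top)
    finally show "(\<integral>\<^sup>+p. ennreal (norm (F (snd p) (fst p))) \<partial>(M \<Otimes>\<^sub>M lborel)) < \<infinity>" .
  qed measurable
  have F_mean: "(\<integral>\<omega>. F s \<omega> \<partial>M) = indicator {0..t} s *\<^sub>R (\<beta> * (\<integral>x. \<phi> x * survival (\<lambda>y. \<phi> (x + y)) \<beta> (t - s) \<partial>gauss s))" for s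
  proof (cases "s \<in> {0..t}")
    case True
    then have s: "0 \<le> s" "s \<le> t" by auto
    interpret V: std_brownian_motion M "\<lambda>r \<omega>. W (s + r) \<omega> - W s \<omega>" by (rule std_brownian_motion_shift[OF s(1)])
    define G where "G p = \<beta> * (\<phi> (fst p) * exp (- (\<beta> * occupation (\<lambda>y. \<phi> (fst p + y)) (t - s) (snd p))))" for p
    have [measurable]: "G \<in> borel_measurable (borel \<Otimes>\<^sub>M code_space)"
      unfolding G_def[abs_def] by measurable
    have "(\<integral>\<omega>. F s \<omega> \<partial>M) = (\<integral>\<omega>. G (W s \<omega>, path_code (\<lambda>r \<omega>. W (s + r) \<omega> - W s \<omega>) \<omega>) \<partial>M)"
    proof (intro Bochner_Integration.integral_cong refl)
      fix \<omega> assume \<omega>: "\<omega> \<in> space M"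
      have "occupation (\<lambda>y. \<phi> (W s \<omega> + y)) (t - s) (path_code (\<lambda>r \<omega>. W (s + r) \<omega> - W s \<omega>) \<omega>) = (LINT v:{0..t - s}|lborel. \<phi> (W (s + v) \<omega>))"
        unfolding occupation_def by (intro set_lebesgue_integral_cong) (auto simp: V.code_eval_W \<omega>)
      then show "F s \<omega> = G (W s \<omega>, path_code (\<lambda>r \<omega>. W (s + r) \<omega> - W s \<omega>) \<omega>)"
        using True by (simp add: F_def G_def A_diff[OF \<omega> s] code_eval_W \<omega>)
    qed
    also have "\<dots> = (\<integral>x. \<integral>\<omega>. G (x, path_code W \<omega>) \<partial>M \<partial>gauss s)"
    proof (rule integral_markov[OF s(1), where K = "\<beta> * K"])
      fix p :: "real \<times> (nat \<times> nat \<Rightarrow> real)"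
      have "\<phi> (fst p) * exp (- (\<beta> * occupation (\<lambda>y. \<phi> (fst p + y)) (t - s) (snd p))) \<le> K * 1"
        using K nn K0 \<beta> by (intro mult_mono exp_occupation_le_1) auto
      then show "\<bar>G p\<bar> \<le> \<beta> * K"
        unfolding G_def using \<beta> nn by (auto simp: abs_mult intro!: mult_left_mono)
    qed measurable
    also have "\<dots> = (\<integral>x. \<beta> * (\<phi> x * survival (\<lambda>y. \<phi> (x + y)) \<beta> (t - s)) \<partial>gauss s)"
      by (simp add: G_def survival_def)
    finally show ?thesis using True by simp
  qed (simp add: F_def)
  have "1 - survival \<phi> \<beta> t = (\<integral>\<omega>. 1 - exp (- (\<beta> * ?A t \<omega>)) \<partial>M)"
    unfolding survival_def using integrable_exp_occupation[OF b \<beta>] by (simp add: prob_space)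
  also have "\<dots> = (\<integral>\<omega>. \<integral>s. F s \<omega> \<partial>lborel \<partial>M)"
    by (intro Bochner_Integration.integral_cong refl path)
  also have "\<dots> = (\<integral>s. \<integral>\<omega>. F s \<omega> \<partial>M \<partial>lborel)"
    using PL.Fubini_integral[of "\<lambda>\<omega> s. F s \<omega>"] F_int by (simp add: case_prod_unfold)
  also have "\<dots> = (LINT s:{0..t}|lborel. \<beta> * (\<integral>x. \<phi> x * survival (\<lambda>y. \<phi> (x + y)) \<beta> (t - s) \<partial>gauss s))"
    unfolding set_lebesgue_integral_def F_mean ..
  finally show "1 - survival \<phi> \<beta> t = (LINT s:{0..t}|lborel. \<beta> * (\<integral>x. \<phi> x * survival (\<lambda>y. \<phi> (x + y)) \<beta> (t - s) \<partial>gauss s))" .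
  show "set_integrable lborel {0..t} (\<lambda>s. \<beta> * (\<integral>x. \<phi> x * survival (\<lambda>y. \<phi> (x + y)) \<beta> (t - s) \<partial>gauss s))"
    unfolding set_integrable_def F_mean[symmetric]
    using PL.integrable_snd[of "\<lambda>\<omega> s. F s \<omega>"] F_int by (simp add: case_prod_unfold)
qed


section \<open>Passage to the limit: the Volterra equation for the survival function\<close>

definition local_survival :: "real \<Rightarrow> real \<Rightarrow> real" where
  "local_survival \<beta> t = (\<integral>\<omega>. exp (- (\<beta> * code_local_time (path_code W \<omega>) t)) \<partial>M)"

lemma AE_code_local_time_nonneg:
  assumes "0 \<le> t"
  shows "AE \<omega> in M. 0 \<le> code_local_time (path_code W \<omega>) t"
  using AE_local_time[OF assms]
proof eventually_elim
  case (elim \<omega>)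
  then show ?case
    by (intro LIMSEQ_le_const[of "\<lambda>n. occupation (window (mesh n)) t (path_code W \<omega>)"])
      (use bumpD(2)[OF bump_window[OF mesh_pos]] in \<open>auto intro!: occupation_nonneg\<close>)
qed

lemma survival_window_tendsto:
  assumes "0 \<le> \<beta>" "0 \<le> t"
  shows "(\<lambda>n. survival (window (mesh n)) \<beta> t) \<longlonglongrightarrow> local_survival \<beta> t"
  unfolding survival_def local_survival_def
proof (rule integral_dominated_convergence[where w = "\<lambda>_. 1"])
  note [measurable] = bumpD(1)[OF bump_window[OF mesh_pos]]
  show "(\<lambda>\<omega>. exp (- (\<beta> * code_local_time (path_code W \<omega>) t))) \<in> borel_measurable M"
    by measurable
  show "(\<lambda>\<omega>. exp (- (\<beta> * occupation (window (mesh n)) t (path_code W \<omega>)))) \<in> borel_measurable M" for n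
    by measurable
  show "AE \<omega> in M. (\<lambda>n. exp (- (\<beta> * occupation (window (mesh n)) t (path_code W \<omega>)))) \<longlonglongrightarrow> exp (- (\<beta> * code_local_time (path_code W \<omega>) t))"
    using AE_local_time[OF assms(2)] by eventually_elim (intro tendsto_intros, simp)
  show "AE \<omega> in M. norm (exp (- (\<beta> * occupation (window (mesh n)) t (path_code W \<omega>)))) \<le> 1" for n
    using assms(1) bumpD(2)[OF bump_window[OF mesh_pos]] by (auto intro!: mult_nonneg_nonneg occupation_nonneg)
qed simp

text \<open>Windows are tied to the definition of local time, tents to the Feynman--Kac equation; at
  equal radius their survival functions differ by a quantity that vanishes with the mesh.\<close>

lemma survival_tent_tendsto:
  assumes "0 \<le> \<beta>" "0 \<le> t"
  shows "(\<lambda>n. survival (tent (mesh n)) \<beta> t) \<longlonglongrightarrow> local_survival \<beta> t"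
proof -
  have "(\<lambda>n. survival (tent (mesh n)) \<beta> t - survival (window (mesh n)) \<beta> t) \<longlonglongrightarrow> 0"
  proof (rule Lim_null_comparison)
    show "\<forall>\<^sub>F n in sequentially. norm (survival (tent (mesh n)) \<beta> t - survival (window (mesh n)) \<beta> t)
        \<le> \<beta> * (8 * mesh n powr (1/4) * t powr (3/8))"
      unfolding real_norm_def
      by (intro always_eventually allI survival_diff bump_tent bump_window mesh_pos assms)
    have "(\<lambda>n. \<beta> * (8 * mesh n powr (1/4) * t powr (3/8))) \<longlonglongrightarrow> \<beta> * (8 * 0 powr (1/4) * t powr (3/8))"
      by (intro tendsto_intros tendsto_powr' mesh_tendsto) (auto simp: mesh_pos less_imp_le)
    then show "(\<lambda>n. \<beta> * (8 * mesh n powr (1/4) * t powr (3/8))) \<longlonglongrightarrow> 0" by simp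
  qed
  from tendsto_add[OF this survival_window_tendsto[OF assms]] show ?thesis by simp
qed

lemma local_survival_bounds:
  assumes "0 \<le> \<beta>" "0 \<le> t"
  shows "0 \<le> local_survival \<beta> t" "local_survival \<beta> t \<le> 1"
proof -
  show "0 \<le> local_survival \<beta> t"
    by (rule LIMSEQ_le_const[OF survival_tent_tendsto[OF assms]])
      (use survival_bounds[OF bump_tent[OF mesh_pos] assms(1)] in auto)
  show "local_survival \<beta> t \<le> 1"
    by (rule LIMSEQ_le_const2[OF survival_tent_tendsto[OF assms]])
      (use survival_bounds[OF bump_tent[OF mesh_pos] assms(1)] in auto)
qed

lemma measurable_survival_shift:
  assumes [measurable]: "\<phi> \<in> borel_measurable borel"
  shows "(\<lambda>x. survival (\<lambda>y. \<phi> (x + y)) \<beta> t) \<in> borel_measurable borel"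
proof -
  note * = measurable_compose[OF _ measurable_occupation_joint[OF assms], of "\<lambda>p. (fst p, path_code W (snd p))" "borel \<Otimes>\<^sub>M M", simplified]
  have [measurable]: "(\<lambda>p. occupation (\<lambda>y. \<phi> (fst p + y)) t (path_code W (snd p))) \<in> borel_measurable (borel \<Otimes>\<^sub>M M)"
    by (rule *) measurable
  show ?thesis
    unfolding survival_def by measurable
qed

text \<open>The limit of the Feynman--Kac equations of the tents. On the support of a tent the
  starting point is within the mesh size of 0, so the survival for the translated tent may be
  replaced by the untranslated one, and the remaining Gaussian mean of the tent tends to 1 / sqrt (2
  pi s). The dominating function is \<beta> / sqrt (2 pi s). Integrability is recorded for the later
  passage to nonnegative integrals.\<close>

lemma local_survival_Volterra:
  assumes \<beta>: "0 \<le> \<beta>" and t: "0 \<le> t"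
  shows "1 - local_survival \<beta> t = (LINT s:{0..t}|lborel. \<beta> * (1 / sqrt (2 * pi * s) * local_survival \<beta> (t - s)))"
    and "set_integrable lborel {0..t} (\<lambda>s. \<beta> * (1 / sqrt (2 * pi * s) * local_survival \<beta> (t - s)))"
proof -
  let ?\<phi> = "\<lambda>n. tent (mesh n)"
  let ?q = "\<lambda>s. 1 / sqrt (2 * pi * s)"
  note bt = bump_tent[OF mesh_pos]
  note [measurable] = bumpD(1)[OF bt]
  define I where "I n s = \<beta> * (\<integral>x. ?\<phi> n x * survival (\<lambda>y. ?\<phi> n (x + y)) \<beta> (t - s) \<partial>gauss s)" for n s
  define L where "L s = \<beta> * (?q s * local_survival \<beta> (t - s))" for s
  have fk: "1 - survival (?\<phi> n) \<beta> t = (LINT s:{0..t}|lborel. I n s)" and I_int: "set_integrable lborel {0..t} (I n)" for n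
    unfolding I_def by (rule feynman_kac[OF bt continuous_on_tent \<beta> t])+
  have gauss_int: "integrable (gauss s) (\<lambda>x. ?\<phi> n x * f x)"
    if s: "0 < s" and [measurable]: "f \<in> borel_measurable borel" and f: "\<And>x. \<bar>f x\<bar> \<le> 1" for s n f
  proof -
    interpret g: prob_space "gauss s" by (rule prob_space_gauss) (use s in simp)
    obtain K where K: "\<And>y. ?\<phi> n y \<le> K" using bt[of n] by (auto simp: bump_def)
    have "\<bar>?\<phi> n x * f x\<bar> \<le> K * 1" for x
      unfolding abs_mult using f[of x] K[of x] bumpD(2)[OF bt, of n x] order_trans[OF bumpD(2)[OF bt, of n x] K[of x]]
      by (intro mult_mono) auto
    then show ?thesis
      by (intro g.integrable_bounded_real) (auto cong: measurable_cong_sets)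
  qed
  \<comment> \<open>Translating by at most the mesh size leaves a bump of twice that radius, hence
    \<open>2 * mesh n\<close>.\<close>
  have approx: "\<bar>I n s - \<beta> * ((\<integral>x. ?\<phi> n x \<partial>gauss s) * survival (?\<phi> n) \<beta> (t - s))\<bar>
      \<le> \<beta> * (?q s * (\<beta> * (8 * (2 * mesh n) powr (1/4) * (t - s) powr (3/8))))" if s: "0 < s" "s \<le> t" for n s
  proof -
    let ?C = "\<beta> * (8 * (2 * mesh n) powr (1/4) * (t - s) powr (3/8))"
    let ?S = "\<lambda>x. survival (\<lambda>y. ?\<phi> n (x + y)) \<beta> (t - s)" and ?u = "survival (?\<phi> n) \<beta> (t - s)"
    have C0: "0 \<le> ?C" using \<beta> by simp
    note [measurable] = measurable_survival_shift[OF bumpD(1)[OF bt]]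
    have shb: "\<exists>\<eta>. bump \<eta> (\<lambda>y. ?\<phi> n (x + y))" for x
    proof -
      have "bump (2 * (mesh n + \<bar>x\<bar>)) (\<lambda>y. ?\<phi> n (x + y))"
        using mesh_pos[of n] by (intro bump_shift bump_mono[OF bt]) auto
      then show ?thesis by blast
    qed
    have S1: "\<bar>?S x\<bar> \<le> 1" for x
      using shb[of x] survival_bounds[OF _ \<beta>] by fastforce
    have u1: "\<bar>?u\<bar> \<le> 1"
      using survival_bounds[OF bt \<beta>] by simp
    have i1: "integrable (gauss s) (\<lambda>x. ?\<phi> n x * ?S x)"
      by (rule gauss_int[OF s(1) _ S1]) measurable
    have i2: "integrable (gauss s) (\<lambda>x. ?\<phi> n x * ?u)"
      by (rule gauss_int[OF s(1) _ u1]) measurable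
    have i3: "integrable (gauss s) (?\<phi> n)"
      using gauss_int[OF s(1), of "\<lambda>_. 1" n] by simp
    have pt: "\<bar>?\<phi> n x * ?S x - ?\<phi> n x * ?u\<bar> \<le> ?\<phi> n x * ?C" for x
    proof (cases "\<bar>x\<bar> \<le> mesh n")
      case True
      have "\<bar>?S x - ?u\<bar> \<le> ?C"
        using True s \<beta> mesh_pos[of n]
        by (intro survival_diff bump_shift bt bump_mono[OF bt, of n "2 * mesh n"]) auto
      then show ?thesis
        using bumpD(2)[OF bt, of n x] by (simp add: abs_mult mult_left_mono flip: right_diff_distrib)
    next
      case False
      then show ?thesis using bumpD(3)[OF bt, of n x] by simp
    qed
    have "\<bar>(\<integral>x. ?\<phi> n x * ?S x \<partial>gauss s) - (\<integral>x. ?\<phi> n x * ?u \<partial>gauss s)\<bar> = \<bar>\<integral>x. ?\<phi> n x * ?S x - ?\<phi> n x * ?u \<partial>gauss s\<bar>"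
      using i1 i2 by simp
    also have "\<dots> \<le> (\<integral>x. ?\<phi> n x * ?C \<partial>gauss s)"
      by (rule order_trans[OF integral_abs_bound integral_mono[OF _ _ pt]]) (use i1 i2 i3 in auto)
    also have "\<dots> = (\<integral>x. ?\<phi> n x \<partial>gauss s) * ?C" by simp
    also have "\<dots> \<le> ?q s * ?C"
      using gauss_bump_le[OF s(1) bt] C0 by (intro mult_right_mono) auto
    finally have "\<beta> * \<bar>(\<integral>x. ?\<phi> n x * ?S x \<partial>gauss s) - (\<integral>x. ?\<phi> n x * ?u \<partial>gauss s)\<bar> \<le> \<beta> * (?q s * ?C)"
      using \<beta> by (intro mult_left_mono)
    moreover have "\<bar>I n s - \<beta> * ((\<integral>x. ?\<phi> n x \<partial>gauss s) * ?u)\<bar> = \<beta> * \<bar>(\<integral>x. ?\<phi> n x * ?S x \<partial>gauss s) - (\<integral>x. ?\<phi> n x * ?u \<partial>gauss s)\<bar>"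
      unfolding I_def using \<beta> by (simp add: abs_mult flip: right_diff_distrib)
    ultimately show ?thesis by linarith
  qed
  have I_tendsto: "(\<lambda>n. I n s) \<longlonglongrightarrow> L s" if s: "0 < s" "s \<le> t" for s
  proof -
    have p0: "(\<lambda>n. (c * mesh n) powr e) \<longlonglongrightarrow> 0" if "0 < e" "0 \<le> c" for c e
    proof -
      have "(\<lambda>n. (c * mesh n) powr e) \<longlonglongrightarrow> (c * 0) powr e"
        using that by (intro tendsto_powr' tendsto_intros mesh_tendsto) (auto simp: mesh_pos less_imp_le)
      then show ?thesis by simp
    qed
    have g: "(\<lambda>n. \<integral>x. ?\<phi> n x \<partial>gauss s) \<longlonglongrightarrow> ?q s"
    proof (rule LIM_zero_cancel, rule Lim_null_comparison)
      show "\<forall>\<^sub>F n in sequentially. norm ((\<integral>x. ?\<phi> n x \<partial>gauss s) - ?q s) \<le> mesh n powr (1/2) * s powr (-3/4)"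
        unfolding real_norm_def by (intro always_eventually allI gauss_bump_approx s mesh_pos bt)
      show "(\<lambda>n. mesh n powr (1/2) * s powr (-3/4)) \<longlonglongrightarrow> 0"
        using tendsto_mult[OF p0[of "1/2" 1] tendsto_const[of "s powr (-3/4)"]] by simp
    qed
    have "(\<lambda>n. I n s - \<beta> * ((\<integral>x. ?\<phi> n x \<partial>gauss s) * survival (?\<phi> n) \<beta> (t - s))) \<longlonglongrightarrow> 0"
    proof (rule Lim_null_comparison)
      show "\<forall>\<^sub>F n in sequentially. norm (I n s - \<beta> * ((\<integral>x. ?\<phi> n x \<partial>gauss s) * survival (?\<phi> n) \<beta> (t - s)))
        \<le> \<beta> * (?q s * (\<beta> * (8 * (2 * mesh n) powr (1/4) * (t - s) powr (3/8))))"
        unfolding real_norm_def by (intro always_eventually allI approx s)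
      have "(\<lambda>n. \<beta> * (?q s * (\<beta> * (8 * (2 * mesh n) powr (1/4) * (t - s) powr (3/8))))) \<longlonglongrightarrow> \<beta> * (?q s * (\<beta> * (8 * 0 * (t - s) powr (3/8))))"
        by (intro tendsto_mult tendsto_const p0) auto
      then show "(\<lambda>n. \<beta> * (?q s * (\<beta> * (8 * (2 * mesh n) powr (1/4) * (t - s) powr (3/8))))) \<longlonglongrightarrow> 0" by simp
    qed
    moreover have "(\<lambda>n. \<beta> * ((\<integral>x. ?\<phi> n x \<partial>gauss s) * survival (?\<phi> n) \<beta> (t - s))) \<longlonglongrightarrow> L s"
      unfolding L_def using s \<beta> by (intro tendsto_mult tendsto_const g survival_tent_tendsto) auto
    ultimately show ?thesis
      using tendsto_add by fastforce
  qed
  have I_bd: "\<bar>I n s\<bar> \<le> \<beta> * ?q s" if s: "0 < s" "s \<le> t" for n s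
  proof -
    have S: "0 \<le> survival (\<lambda>y. ?\<phi> n (x + y)) \<beta> (t - s)" "survival (\<lambda>y. ?\<phi> n (x + y)) \<beta> (t - s) \<le> 1" for x
    proof -
      have "bump (2 * (mesh n + \<bar>x\<bar>)) (\<lambda>y. ?\<phi> n (x + y))"
        using mesh_pos[of n] by (intro bump_shift bump_mono[OF bt]) auto
      then show "0 \<le> survival (\<lambda>y. ?\<phi> n (x + y)) \<beta> (t - s)" "survival (\<lambda>y. ?\<phi> n (x + y)) \<beta> (t - s) \<le> 1"
        using \<beta> by (auto intro: survival_bounds)
    qed
    have "(\<integral>x. ?\<phi> n x * survival (\<lambda>y. ?\<phi> n (x + y)) \<beta> (t - s) \<partial>gauss s) \<le> (\<integral>x. ?\<phi> n x * 1 \<partial>gauss s)"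
      using S bumpD(2)[OF bt] measurable_survival_shift[OF bumpD(1)[OF bt]]
      by (intro integral_mono gauss_int s mult_left_mono) auto
    also have "\<dots> \<le> ?q s"
      using gauss_bump_le(1)[OF s(1) bt] by simp
    finally have le: "(\<integral>x. ?\<phi> n x * survival (\<lambda>y. ?\<phi> n (x + y)) \<beta> (t - s) \<partial>gauss s) \<le> ?q s" .
    have "0 \<le> (\<integral>x. ?\<phi> n x * survival (\<lambda>y. ?\<phi> n (x + y)) \<beta> (t - s) \<partial>gauss s)"
      using S bumpD(2)[OF bt] by (intro integral_nonneg_AE) auto
    then show ?thesis
      unfolding I_def abs_mult using \<beta> le by (intro mult_mono) auto
  qed
  have AE0: "AE s in lborel. s \<noteq> (0::real)" by (rule AE_lborel_singleton)
  have L_meas: "(\<lambda>s. indicator {0..t} s *\<^sub>R L s) \<in> borel_measurable lborel"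
  proof -
    \<comment> \<open>Measurability is inherited from the approximants. At s = 0 the law
      \<open>gauss 0\<close> is a point mass and the tent has height 1 / \<open>mesh n\<close>
      there, so convergence can fail and this point is set apart.\<close>
    have "(\<lambda>s. if s = 0 then indicator {0..t} (0::real) *\<^sub>R L 0 else lim (\<lambda>n. indicator {0..t} s *\<^sub>R I n s)) \<in> borel_measurable lborel"
    proof (rule measurable_If)
      show "(\<lambda>s. lim (\<lambda>n. indicator {0..t} s *\<^sub>R I n s)) \<in> borel_measurable lborel"
        using I_int unfolding set_integrable_def by (intro borel_measurable_lim_metric) auto
    qed auto
    also have "(\<lambda>s. if s = 0 then indicator {0..t} (0::real) *\<^sub>R L 0 else lim (\<lambda>n. indicator {0..t} s *\<^sub>R I n s)) = (\<lambda>s. indicator {0..t} s *\<^sub>R L s)"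
    proof
      fix s
      show "(if s = 0 then indicator {0..t} (0::real) *\<^sub>R L 0 else lim (\<lambda>n. indicator {0..t} s *\<^sub>R I n s)) = indicator {0..t} s *\<^sub>R L s"
        using limI[OF I_tendsto[of s]] by (auto simp: indicator_def)
    qed
    finally show ?thesis .
  qed
  have dom: "integrable lborel (\<lambda>s. indicator {0..t} s *\<^sub>R (\<beta> * ?q s))"
    using set_integrable_mult_right[OF set_integrable_inverse_sqrt[OF t], of \<beta>] by (simp add: set_integrable_def)
  have conv: "AE s in lborel. (\<lambda>n. indicator {0..t} s *\<^sub>R I n s) \<longlonglongrightarrow> indicator {0..t} s *\<^sub>R L s"
    using AE0 by eventually_elim (auto simp: indicator_def I_tendsto)
  have bound: "AE s in lborel. norm (indicator {0..t} s *\<^sub>R I n s) \<le> indicator {0..t} s *\<^sub>R (\<beta> * ?q s)" for n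
    using AE0
  proof eventually_elim
    case (elim s)
    then show ?case using I_bd[of s n] by (simp add: indicator_def)
  qed
  have I_meas: "(\<lambda>s. indicator {0..t} s *\<^sub>R I n s) \<in> borel_measurable lborel" for n
    using I_int[of n] by (simp add: set_integrable_def)
  show "set_integrable lborel {0..t} (\<lambda>s. \<beta> * (?q s * local_survival \<beta> (t - s)))"
    using integrable_dominated_convergence[OF L_meas I_meas dom conv bound] by (simp add: set_integrable_def L_def)
  have "(\<lambda>n. LINT s:{0..t}|lborel. I n s) \<longlonglongrightarrow> (LINT s:{0..t}|lborel. L s)"
    unfolding set_lebesgue_integral_def by (rule integral_dominated_convergence[OF L_meas I_meas dom conv bound])
  moreover have "(\<lambda>n. LINT s:{0..t}|lborel. I n s) \<longlonglongrightarrow> 1 - local_survival \<beta> t"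
    unfolding fk[symmetric] by (intro tendsto_intros survival_tent_tendsto assms)
  ultimately show "1 - local_survival \<beta> t = (LINT s:{0..t}|lborel. \<beta> * (?q s * local_survival \<beta> (t - s)))"
    unfolding L_def by (rule LIMSEQ_unique[rotated])
qed

end

subsection \<open>The renewal equation\<close>

text \<open>Taken over the whole line and in [0,\<infinity>]: commutativity and associativity then
  need measurability only, and one-sidedness is expressed by functions that vanish at negative
  arguments.\<close>

definition conv :: "(real \<Rightarrow> ennreal) \<Rightarrow> (real \<Rightarrow> ennreal) \<Rightarrow> real \<Rightarrow> ennreal" where
  "conv f g t = (\<integral>\<^sup>+s. f s * g (t - s) \<partial>lborel)"

definition measure_conv :: "real measure \<Rightarrow> (real \<Rightarrow> ennreal) \<Rightarrow> real \<Rightarrow> ennreal" where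
  "measure_conv \<mu> g t = (\<integral>\<^sup>+r. g (t - r) \<partial>\<mu>)"

lemma measurable_conv [measurable]:
  assumes [measurable]: "f \<in> borel_measurable borel" "g \<in> borel_measurable borel"
  shows "conv f g \<in> borel_measurable borel"
  unfolding conv_def[abs_def] by measurable

lemma measurable_measure_conv [measurable]:
  assumes "sigma_finite_measure \<mu>" and [measurable_cong]: "sets \<mu> = sets borel" and [measurable]: "g \<in> borel_measurable borel"
  shows "measure_conv \<mu> g \<in> borel_measurable borel"
proof -
  interpret sigma_finite_measure \<mu> by fact
  show ?thesis
    unfolding measure_conv_def[abs_def] by measurable
qed

lemma conv_commute:
  assumes [measurable]: "f \<in> borel_measurable borel" "g \<in> borel_measurable borel"
  shows "conv f g = conv g f"
proof
  fix t
  show "conv f g t = conv g f t"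
    unfolding conv_def
    by (subst nn_integral_real_affine[where c = "-1" and t = t]) (auto simp: mult.commute)
qed

lemma conv_assoc:
  assumes [measurable]: "f \<in> borel_measurable borel" "g \<in> borel_measurable borel" "h \<in> borel_measurable borel"
  shows "conv (conv f g) h = conv f (conv g h)"
proof
  fix t
  have "conv (conv f g) h t = (\<integral>\<^sup>+s. \<integral>\<^sup>+r. f r * g (s - r) * h (t - s) \<partial>lborel \<partial>lborel)"
    unfolding conv_def by (simp add: nn_integral_multc)
  also have "\<dots> = (\<integral>\<^sup>+r. \<integral>\<^sup>+s. f r * g (s - r) * h (t - s) \<partial>lborel \<partial>lborel)"
    by (rule lborel_pair.Fubini') measurable
  also have "\<dots> = (\<integral>\<^sup>+r. f r * (\<integral>\<^sup>+s. g (s - r) * h (t - s) \<partial>lborel) \<partial>lborel)"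
    by (simp add: mult.assoc nn_integral_cmult)
  also have "\<dots> = (\<integral>\<^sup>+r. f r * (\<integral>\<^sup>+s. g s * h (t - r - s) \<partial>lborel) \<partial>lborel)"
  proof -
    have "(\<integral>\<^sup>+s. g (s - r) * h (t - s) \<partial>lborel) = (\<integral>\<^sup>+s. g s * h (t - r - s) \<partial>lborel)" for r
      by (subst nn_integral_real_affine[where c = 1 and t = r]) (auto simp: diff_diff_eq)
    then show ?thesis by (simp only:)
  qed
  finally show "conv (conv f g) h t = conv f (conv g h) t"
    by (simp add: conv_def)
qed

lemma conv_add_right:
  assumes [measurable]: "f \<in> borel_measurable borel" "g \<in> borel_measurable borel" "h \<in> borel_measurable borel"
  shows "conv f (\<lambda>t. g t + h t) t = conv f g t + conv f h t"
  unfolding conv_def by (simp add: distrib_left nn_integral_add)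

lemma conv_cmult_right:
  assumes [measurable]: "f \<in> borel_measurable borel" "g \<in> borel_measurable borel"
  shows "conv f (\<lambda>t. c * g t) t = c * conv f g t"
  unfolding conv_def by (simp add: mult.left_commute nn_integral_cmult)

lemma conv_cmult_left:
  assumes [measurable]: "f \<in> borel_measurable borel" "g \<in> borel_measurable borel"
  shows "conv (\<lambda>t. c * f t) g t = c * conv f g t"
  unfolding conv_def by (simp add: mult.assoc nn_integral_cmult)

lemma conv_mono: "(\<And>s. f s \<le> f' s) \<Longrightarrow> (\<And>s. g s \<le> g' s) \<Longrightarrow> conv f g t \<le> conv f' g' t"
  unfolding conv_def by (intro nn_integral_mono mult_mono) auto

lemma measure_conv_conv:
  assumes \<mu>: "sigma_finite_measure \<mu>" and s [measurable_cong]: "sets \<mu> = sets borel"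
    and [measurable]: "f \<in> borel_measurable borel" "g \<in> borel_measurable borel"
  shows "measure_conv \<mu> (conv f g) = conv f (measure_conv \<mu> g)"
proof
  fix t
  interpret sigma_finite_measure \<mu> by fact
  interpret pair_sigma_finite \<mu> lborel ..
  have "measure_conv \<mu> (conv f g) t = (\<integral>\<^sup>+r. \<integral>\<^sup>+s. f s * g (t - r - s) \<partial>lborel \<partial>\<mu>)"
    by (simp add: measure_conv_def conv_def)
  also have "\<dots> = (\<integral>\<^sup>+s. \<integral>\<^sup>+r. f s * g (t - r - s) \<partial>\<mu> \<partial>lborel)"
    by (rule Fubini'[symmetric]) measurable
  also have "\<dots> = conv f (measure_conv \<mu> g) t"
    by (simp add: measure_conv_def conv_def nn_integral_cmult cong: measurable_cong_sets) (simp add: algebra_simps)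
  finally show "measure_conv \<mu> (conv f g) t = conv f (measure_conv \<mu> g) t" .
qed

abbreviation unit_step :: "real \<Rightarrow> ennreal" where
  "unit_step \<equiv> indicator {0..}"

lemma conv_unit_step:
  assumes "\<And>s. s < 0 \<Longrightarrow> f s = 0"
  shows "conv f unit_step t = (\<integral>\<^sup>+s. f s * indicator {0..t} s \<partial>lborel)"
  unfolding conv_def
  using assms by (intro nn_integral_cong) (auto simp: indicator_def not_le)

lemma nn_integral_power_Icc:
  assumes "0 \<le> t"
  shows "(\<integral>\<^sup>+s. ennreal (s ^ n) * indicator {0..t} s \<partial>lborel) = ennreal (t ^ Suc n / real (Suc n))"
proof -
  have "(\<integral>\<^sup>+s. ennreal (s ^ n) * indicator {0..t} s \<partial>lborel) = ennreal (t ^ Suc n / real (Suc n) - 0 ^ Suc n / real (Suc n))"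
    by (rule nn_integral_FTC_Icc) (use assms in \<open>auto intro!: derivative_eq_intros simp del: power_Suc\<close>)
  then show ?thesis by simp
qed

text \<open>Iterating the inequality from the bound \<open>C\<close> gives C (c t)^n / n!, which
  tends to 0.\<close>

lemma gronwall_zero:
  fixes D :: "real \<Rightarrow> ennreal"
  assumes [measurable]: "D \<in> borel_measurable borel" and c: "0 \<le> c" and C: "0 \<le> C"
    and bd: "\<And>t. t \<le> t0 \<Longrightarrow> D t \<le> ennreal C"
    and le: "\<And>t. 0 \<le> t \<Longrightarrow> t \<le> t0 \<Longrightarrow> D t \<le> ennreal c * (\<integral>\<^sup>+s. D s * indicator {0..t} s \<partial>lborel)"
    and t: "0 \<le> t" "t \<le> t0"
  shows "D t = 0"
proof -
  have it: "D t \<le> ennreal (C * (c * t) ^ n / fact n)" if "0 \<le> t" "t \<le> t0" for t n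
    using that
  proof (induction n arbitrary: t)
    case 0
    then show ?case using bd by simp
  next
    case (Suc n)
    have "D t \<le> ennreal c * (\<integral>\<^sup>+s. D s * indicator {0..t} s \<partial>lborel)"
      by (rule le) fact+
    also have "\<dots> \<le> ennreal c * (\<integral>\<^sup>+s. ennreal (C * c ^ n / fact n) * (ennreal (s ^ n) * indicator {0..t} s) \<partial>lborel)"
    proof (intro mult_left_mono nn_integral_mono)
      fix s
      show "D s * indicator {0..t} s \<le> ennreal (C * c ^ n / fact n) * (ennreal (s ^ n) * indicator {0..t} s)"
        using Suc.IH[of s] Suc.prems c C
        by (auto simp: indicator_def power_mult_distrib mult_ac simp flip: ennreal_mult)
    qed simp
    also have "\<dots> = ennreal c * (ennreal (C * c ^ n / fact n) * ennreal (t ^ Suc n / real (Suc n)))"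
      using Suc.prems by (simp add: nn_integral_cmult nn_integral_power_Icc del: power_Suc)
    also have "\<dots> = ennreal (c * ((C * c ^ n / fact n) * (t ^ Suc n / real (Suc n))))"
      using c C Suc.prems by (simp only: ennreal_mult mult_nonneg_nonneg divide_nonneg_nonneg zero_le_power of_nat_0_le_iff fact_ge_zero)
    also have "c * ((C * c ^ n / fact n) * (t ^ Suc n / real (Suc n))) = C * (c * t) ^ Suc n / fact (Suc n)"
      by (simp add: power_mult_distrib mult_ac)
    finally show ?case .
  qed
  have "(\<lambda>n. C * ((c * t) ^ n / fact n)) \<longlonglongrightarrow> C * 0"
    using summable_LIMSEQ_zero[OF summable_exp[of "c * t"]] by (intro tendsto_intros) (simp add: divide_inverse mult.commute)
  then have "(\<lambda>n. ennreal (C * (c * t) ^ n / fact n)) \<longlonglongrightarrow> ennreal 0"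
    by (intro tendsto_ennrealI) simp
  then have "D t \<le> ennreal 0"
    by (rule LIMSEQ_le_const) (use it t in auto)
  then show ?thesis by simp
qed

section \<open>The singular kernel q\<close>

text \<open>The density at 0 of a centred Gaussian of variance \<open>s\<close>, times \<beta>; that
  is, \<beta> times the expected rate at which local time accrues at time \<open>s\<close>.\<close>

definition sqrt_kernel :: "real \<Rightarrow> real \<Rightarrow> ennreal" where
  "sqrt_kernel \<beta> s = (if 0 < s then ennreal (\<beta> / sqrt (2 * pi * s)) else 0)"

lemma measurable_sqrt_kernel [measurable]: "sqrt_kernel \<beta> \<in> borel_measurable borel"
  unfolding sqrt_kernel_def[abs_def] by measurable

lemma sqrt_kernel_neg: "s < 0 \<Longrightarrow> sqrt_kernel \<beta> s = 0"
  by (simp add: sqrt_kernel_def)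

lemma Beta_half_half: "Beta (1/2) (1/2 :: real) = pi"
  by (simp add: Beta_def Gamma_one_half_real)

text \<open>Substituting s = t x turns the integral into Beta(1/2, 1/2) = pi, and the powers of
  \<open>t\<close> cancel. Since the square of the singular kernel is constant, one further
  convolution brings an inequality with this kernel into the form that Gronwall's estimate
  handles.\<close>

lemma conv_sqrt_kernel:
  assumes \<beta>: "0 \<le> \<beta>" and t: "0 < t"
  shows "conv (sqrt_kernel \<beta>) (sqrt_kernel \<beta>) t = ennreal (\<beta>\<^sup>2 / 2)"
proof -
  have B: "((\<lambda>x::real. x powr (-1/2) * (1 - x) powr (-1/2)) has_integral pi) {0..1}"
    using has_integral_Beta_real[of "1/2" "1/2"] by (simp add: Beta_half_half)
  have "conv (sqrt_kernel \<beta>) (sqrt_kernel \<beta>) t = (\<integral>\<^sup>+s. sqrt_kernel \<beta> s * sqrt_kernel \<beta> (t - s) \<partial>lborel)"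
    by (simp add: conv_def)
  also have "\<dots> = ennreal t * (\<integral>\<^sup>+x. sqrt_kernel \<beta> (t * x) * sqrt_kernel \<beta> (t - t * x) \<partial>lborel)"
    using t by (subst nn_integral_real_affine[where c = t and t = 0]) auto
  also have "(\<integral>\<^sup>+x. sqrt_kernel \<beta> (t * x) * sqrt_kernel \<beta> (t - t * x) \<partial>lborel)
     = (\<integral>\<^sup>+x. ennreal (\<beta>\<^sup>2 / (2 * pi * t)) * (ennreal (x powr (-1/2) * (1 - x) powr (-1/2)) * indicator {0..1} x) \<partial>lborel)"
  proof (intro nn_integral_cong)
    fix x
    show "sqrt_kernel \<beta> (t * x) * sqrt_kernel \<beta> (t - t * x) = ennreal (\<beta>\<^sup>2 / (2 * pi * t)) * (ennreal (x powr (-1/2) * (1 - x) powr (-1/2)) * indicator {0..1} x)"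
    proof (cases "0 < x \<and> x < 1")
      case True
      then have pos: "0 < t * x" "0 < t - t * x" using t by auto
      have tx: "t - t * x = t * (1 - x)" by (simp add: right_diff_distrib)
      have "\<beta> / sqrt (2 * pi * (t * x)) * (\<beta> / sqrt (2 * pi * (t * (1 - x)))) = \<beta>\<^sup>2 / (2 * pi * t) * (1 / sqrt x * (1 / sqrt (1 - x)))"
        using True t by (simp add: real_sqrt_mult power2_eq_square) (simp add: field_simps)
      also have "1 / sqrt x * (1 / sqrt (1 - x)) = x powr (-1/2) * (1 - x) powr (-1/2)"
        using True by (simp add: powr_minus powr_half_sqrt divide_simps)
      finally have eq: "\<beta> / sqrt (2 * pi * (t * x)) * (\<beta> / sqrt (2 * pi * (t * (1 - x)))) = \<beta>\<^sup>2 / (2 * pi * t) * (x powr (-1/2) * (1 - x) powr (-1/2))" .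
      have "sqrt_kernel \<beta> (t * x) * sqrt_kernel \<beta> (t - t * x) = ennreal (\<beta> / sqrt (2 * pi * (t * x)) * (\<beta> / sqrt (2 * pi * (t * (1 - x)))))"
        unfolding sqrt_kernel_def using pos \<beta> by (simp add: tx ennreal_mult[symmetric])
      also have "\<dots> = ennreal (\<beta>\<^sup>2 / (2 * pi * t)) * ennreal (x powr (-1/2) * (1 - x) powr (-1/2))"
        unfolding eq using t by (intro ennreal_mult) auto
      finally show ?thesis using True by simp
    next
      case False
      then have "t * x \<le> 0 \<or> t - t * x \<le> 0"
        using t by (auto simp: mult_le_0_iff not_less)
      then have "sqrt_kernel \<beta> (t * x) * sqrt_kernel \<beta> (t - t * x) = 0"
        by (auto simp: sqrt_kernel_def)
      \<comment> \<open>At x = 0 and x = 1 the right-hand side vanishes as well, because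
        \<open>0 powr a\<close> is 0.\<close>
      moreover have "x powr (-1/2) * (1 - x) powr (-1/2) = 0 \<or> x \<notin> {0..1}"
        using False by (auto simp: not_less)
      ultimately show ?thesis by auto
    qed
  qed
  also have "\<dots> = ennreal (\<beta>\<^sup>2 / (2 * pi * t)) * ennreal pi"
  proof -
    have "(\<integral>\<^sup>+x. ennreal (x powr (-1/2) * (1 - x) powr (-1/2)) * indicator {0..1} x \<partial>lborel) = ennreal pi"
      by (rule nn_integral_has_integral_lebesgue'[OF _ B]) simp
    moreover have "(\<integral>\<^sup>+x. ennreal (\<beta>\<^sup>2 / (2 * pi * t)) * (ennreal (x powr (-1/2) * (1 - x) powr (-1/2)) * indicator {0..1} x) \<partial>lborel)
      = ennreal (\<beta>\<^sup>2 / (2 * pi * t)) * (\<integral>\<^sup>+x. ennreal (x powr (-1/2) * (1 - x) powr (-1/2)) * indicator {0..1} x \<partial>lborel)"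
      by (rule nn_integral_cmult) measurable
    ultimately show ?thesis by (simp only:)
  qed
  also have "ennreal t * \<dots> = ennreal (t * (\<beta>\<^sup>2 / (2 * pi * t) * pi))"
    using t by (simp add: ennreal_mult[symmetric])
  also have "t * (\<beta>\<^sup>2 / (2 * pi * t) * pi) = \<beta>\<^sup>2 / 2"
    using t by simp
  finally show ?thesis .
qed

lemma conv_conv_sqrt_kernel:
  assumes \<beta>: "0 \<le> \<beta>" and [measurable]: "h \<in> borel_measurable borel" and h: "\<And>s. s < 0 \<Longrightarrow> h s = 0"
  shows "conv (sqrt_kernel \<beta>) (conv (sqrt_kernel \<beta>) h) t = ennreal (\<beta>\<^sup>2 / 2) * (\<integral>\<^sup>+s. h s * indicator {0..t} s \<partial>lborel)"
proof -
  have "conv (sqrt_kernel \<beta>) (conv (sqrt_kernel \<beta>) h) t = conv (conv (sqrt_kernel \<beta>) (sqrt_kernel \<beta>)) h t"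
    by (simp add: conv_assoc)
  also have "\<dots> = (\<integral>\<^sup>+s. (ennreal (\<beta>\<^sup>2 / 2) * unit_step s) * h (t - s) \<partial>lborel)"
    unfolding conv_def[of "conv (sqrt_kernel \<beta>) (sqrt_kernel \<beta>)"]
  proof (rule nn_integral_cong_AE)
    show "AE s in lborel. conv (sqrt_kernel \<beta>) (sqrt_kernel \<beta>) s * h (t - s) = (ennreal (\<beta>\<^sup>2 / 2) * unit_step s) * h (t - s)"
      using AE_lborel_singleton[of "0::real"]
    proof eventually_elim
      case (elim s)
      have "conv (sqrt_kernel \<beta>) (sqrt_kernel \<beta>) s = 0" if "s < 0"
      proof -
        have "conv (sqrt_kernel \<beta>) (sqrt_kernel \<beta>) s = (\<integral>\<^sup>+(r::real). 0 \<partial>lborel)"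
          unfolding conv_def by (rule nn_integral_cong) (use that in \<open>auto simp: sqrt_kernel_def\<close>)
        then show ?thesis by simp
      qed
      with elim conv_sqrt_kernel[OF \<beta>, of s] show ?case
        by (cases "0 < s") auto
    qed
  qed
  also have "\<dots> = ennreal (\<beta>\<^sup>2 / 2) * conv unit_step h t"
    unfolding conv_def by (simp add: mult.assoc nn_integral_cmult)
  also have "conv unit_step h t = conv h unit_step t"
    by (simp add: conv_commute)
  finally show ?thesis by (simp add: conv_unit_step h)
qed


section \<open>The function m, its derivative and its Volterra equation\<close>

definition growth :: "real \<Rightarrow> real \<Rightarrow> real" where
  "growth \<beta> t = 2 * std_normal_cdf (\<beta> * sqrt t) * exp (\<beta>\<^sup>2 / 2 * t)"

lemma integrable_exp_square: "integrable lborel (\<lambda>w::real. exp (- (w\<^sup>2) / 2))"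
  and integral_exp_square: "(\<integral>w. exp (- (w\<^sup>2) / 2) \<partial>lborel) = sqrt (2 * pi)"
proof -
  have eq: "exp (- (w\<^sup>2) / 2) = sqrt (2 * pi) * normal_density 0 1 w" for w :: real
    by (simp add: normal_density_def)
  show "integrable lborel (\<lambda>w::real. exp (- (w\<^sup>2) / 2))"
    unfolding eq by (intro integrable_mult_right integrable_normal_density) simp
  have "(\<integral>w. sqrt (2 * pi) * normal_density 0 1 w \<partial>lborel) = sqrt (2 * pi) * 1"
    by (simp add: integral_normal_density)
  then show "(\<integral>w. exp (- (w\<^sup>2) / 2) \<partial>lborel) = sqrt (2 * pi)"
    unfolding eq by simp
qed

lemma std_normal_cdf_0: "std_normal_cdf 0 = 1 / 2"
proof -
  let ?f = "\<lambda>w::real. exp (- (w\<^sup>2) / 2)"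
  have I: "set_integrable lborel A ?f" if "A \<in> sets borel" for A
    unfolding set_integrable_def using integrable_mult_indicator[OF _ integrable_exp_square, of A] that by simp
  have "(LINT w:{..0}|lborel. ?f w) = (LINT w:{0..}|lborel. ?f w)"
    unfolding set_lebesgue_integral_def
    by (subst lborel_integral_real_affine[where c = "-1" and t = 0]) (auto simp: indicator_def intro!: Bochner_Integration.integral_cong)
  also have "\<dots> = (LINT w:{0<..}|lborel. ?f w)"
    unfolding set_lebesgue_integral_def
    by (intro integral_cong_AE) (auto intro!: eventually_mono[OF AE_lborel_singleton[of "0::real"]] simp: indicator_def)
  finally have "2 * (LINT w:{..0}|lborel. ?f w) = (LINT w:{..0}|lborel. ?f w) + (LINT w:{0<..}|lborel. ?f w)"
    by simp
  also have "\<dots> = (LINT w:{..0} \<union> {0<..}|lborel. ?f w)"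
    by (rule set_integral_Un[symmetric]) ((rule I | force)+)
  also have "{..0} \<union> {0<..} = (UNIV::real set)"
    by auto
  also have "(LINT w:UNIV|lborel. ?f w) = sqrt (2 * pi)"
    unfolding set_lebesgue_integral_def using integral_exp_square by simp
  finally show ?thesis
    by (simp add: std_normal_cdf_def)
qed

lemma std_normal_cdf_eq:
  assumes "0 \<le> x"
  shows "std_normal_cdf x = 1 / 2 + 1 / sqrt (2 * pi) * integral {0..x} (\<lambda>w. exp (- (w\<^sup>2) / 2))"
proof -
  let ?f = "\<lambda>w::real. exp (- (w\<^sup>2) / 2)"
  have I: "set_integrable lborel A ?f" if "A \<in> sets borel" for A
    unfolding set_integrable_def using integrable_mult_indicator[OF _ integrable_exp_square, of A] that by simp
  have "{..x} = {..0} \<union> {0<..x}" using assms by auto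
  then have "(LINT w:{..x}|lborel. ?f w) = (LINT w:{..0}|lborel. ?f w) + (LINT w:{0<..x}|lborel. ?f w)"
    by (simp only:) (rule set_integral_Un, (rule I | force)+)
  also have "(LINT w:{0<..x}|lborel. ?f w) = (LINT w:{0..x}|lborel. ?f w)"
    unfolding set_lebesgue_integral_def
    by (intro integral_cong_AE) (auto intro!: eventually_mono[OF AE_lborel_singleton[of "0::real"]] simp: indicator_def)
  also have "\<dots> = integral {0..x} ?f"
    by (rule set_borel_integral_eq_integral(2)) (rule I, simp)
  also have "(LINT w:{..0}|lborel. ?f w) = sqrt (2 * pi) / 2"
    using std_normal_cdf_0 by (simp add: std_normal_cdf_def field_simps)
  finally show ?thesis
    by (simp add: std_normal_cdf_def field_simps)
qed

lemma std_normal_cdf_derivative: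
  assumes "0 < x"
  shows "(std_normal_cdf has_real_derivative 1 / sqrt (2 * pi) * exp (- (x\<^sup>2) / 2)) (at x)"
proof -
  let ?f = "\<lambda>w::real. exp (- (w\<^sup>2) / 2)"
  have "((\<lambda>u. integral {0..u} ?f) has_real_derivative ?f x) (at x within {0..x + 1})"
    by (rule integral_has_real_derivative) (use assms in \<open>auto intro!: continuous_intros\<close>)
  then have "((\<lambda>u. integral {0..u} ?f) has_real_derivative ?f x) (at x)"
    using assms by (subst (asm) at_within_interior) auto
  then have "((\<lambda>u. 1 / 2 + 1 / sqrt (2 * pi) * integral {0..u} ?f) has_real_derivative 1 / sqrt (2 * pi) * ?f x) (at x)"
    by (rule DERIV_cong[OF DERIV_add[OF DERIV_const DERIV_cmult]]) simp
  then show ?thesis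
    by (rule has_field_derivative_transform_within_open[where S = "{0<..}"]) (use assms in \<open>auto simp: std_normal_cdf_eq\<close>)
qed

text \<open>The Gaussian density at \<beta> sqrt t cancels against exp (\<beta>^2 t / 2) and leaves
  exactly the kernel: m' = (\<beta>^2 / 2) m + q. The same comes out of m = 1 + q * m by inserting
  it into itself, using that q * q is constant, and differentiating.\<close>

lemma growth_derivative:
  assumes t: "0 < t" and \<beta>: "0 < \<beta>"
  shows "(growth \<beta> has_real_derivative \<beta>\<^sup>2 / 2 * growth \<beta> t + \<beta> / sqrt (2 * pi * t)) (at t)"
proof -
  have "((\<lambda>t. 2 * std_normal_cdf (\<beta> * sqrt t) * exp (\<beta>\<^sup>2 / 2 * t)) has_real_derivative
    2 * ((1 / sqrt (2 * pi) * exp (- ((\<beta> * sqrt t)\<^sup>2) / 2)) * (\<beta> * (inverse (sqrt t) / 2))) * exp (\<beta>\<^sup>2 / 2 * t)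
    + 2 * std_normal_cdf (\<beta> * sqrt t) * (exp (\<beta>\<^sup>2 / 2 * t) * (\<beta>\<^sup>2 / 2))) (at t)"
  proof (rule DERIV_cong)
    have "((\<lambda>t. std_normal_cdf (\<beta> * sqrt t)) has_real_derivative (1 / sqrt (2 * pi) * exp (- ((\<beta> * sqrt t)\<^sup>2) / 2)) * (\<beta> * (inverse (sqrt t) / 2))) (at t)"
      by (rule DERIV_chain2[OF std_normal_cdf_derivative DERIV_cmult[OF DERIV_real_sqrt]]) (use t \<beta> in auto)
    then show "((\<lambda>t. 2 * std_normal_cdf (\<beta> * sqrt t) * exp (\<beta>\<^sup>2 / 2 * t)) has_real_derivative
       (2 * ((1 / sqrt (2 * pi) * exp (- ((\<beta> * sqrt t)\<^sup>2) / 2)) * (\<beta> * (inverse (sqrt t) / 2)))) * exp (\<beta>\<^sup>2 / 2 * t)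
      + (exp (\<beta>\<^sup>2 / 2 * t) * (\<beta>\<^sup>2 / 2)) * (2 * std_normal_cdf (\<beta> * sqrt t))) (at t)"
      by (intro DERIV_mult DERIV_cmult) (auto intro!: derivative_eq_intros)
  qed simp
  moreover have "exp (- ((\<beta> * sqrt t)\<^sup>2) / 2) * exp (\<beta>\<^sup>2 / 2 * t) = 1"
    using t by (simp add: power_mult_distrib flip: exp_add)
  then have "2 * ((1 / sqrt (2 * pi) * exp (- ((\<beta> * sqrt t)\<^sup>2) / 2)) * (\<beta> * (inverse (sqrt t) / 2))) * exp (\<beta>\<^sup>2 / 2 * t)
      = \<beta> / sqrt (2 * pi * t)"
  proof -
    have "2 * ((1 / sqrt (2 * pi) * a) * (\<beta> * (inverse (sqrt t) / 2))) * b = (a * b) * (\<beta> / (sqrt (2 * pi) * sqrt t))" for a b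
      by (simp add: field_simps)
    then show ?thesis
      using \<open>_ = 1\<close> by (simp only: real_sqrt_mult[of "2 * pi" t] mult_1)
  qed
  ultimately show ?thesis
    unfolding growth_def[abs_def] by (simp add: algebra_simps)
qed

lemma growth_0: "growth \<beta> 0 = 1"
  by (simp add: growth_def std_normal_cdf_0)

text \<open>For \<beta> > 0 the derivative blows up at 0, so continuity up to the endpoint has to
  come from the formula; with it the fundamental theorem applies from 0 on although the derivative
  exists in the interior only.\<close>

lemma continuous_on_growth:
  assumes "0 \<le> \<beta>"
  shows "continuous_on {0..t} (growth \<beta>)"
proof (cases "0 \<le> t")
  case True
  let ?f = "\<lambda>w::real. exp (- (w\<^sup>2) / 2)"
  have "continuous_on {0..\<beta> * sqrt t} (\<lambda>x. integral {0..x} ?f)"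
    by (intro indefinite_integral_continuous_1 integrable_continuous_interval) (auto intro!: continuous_intros)
  then have "continuous_on {0..t} (\<lambda>s. integral {0..\<beta> * sqrt s} ?f)"
    by (rule continuous_on_compose2) (use assms in \<open>auto intro!: continuous_intros mult_left_mono\<close>)
  then have "continuous_on {0..t} (\<lambda>s. 2 * (1 / 2 + 1 / sqrt (2 * pi) * integral {0..\<beta> * sqrt s} ?f) * exp (\<beta>\<^sup>2 / 2 * s))"
    by (intro continuous_intros)
  then show ?thesis
    by (rule continuous_on_cong[THEN iffD1, OF refl, rotated]) (use assms in \<open>simp add: growth_def std_normal_cdf_eq\<close>)
qed simp

text \<open>Ensures that m - 1 passes to \<open>ennreal\<close> without truncation on the
  nonnegative half-line.\<close>

lemma growth_ge_1:
  assumes "0 \<le> \<beta>" "0 \<le> t"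
  shows "1 \<le> growth \<beta> t"
proof -
  have "0 \<le> integral {0..\<beta> * sqrt t} (\<lambda>w. exp (- (w\<^sup>2) / 2))"
    by (intro integral_nonneg integrable_continuous_interval) (auto intro!: continuous_intros)
  then have "1 \<le> 2 * std_normal_cdf (\<beta> * sqrt t)"
    using assms by (subst std_normal_cdf_eq) auto
  then have "1 * 1 \<le> 2 * std_normal_cdf (\<beta> * sqrt t) * exp (\<beta>\<^sup>2 / 2 * t)"
    using assms by (intro mult_mono) auto
  then show ?thesis by (simp add: growth_def)
qed

text \<open>The derivative of m in closed form, which is visibly measurable and has a definite value
  0 at time 0 and before, where \<open>deriv\<close> would be out of control.\<close>

definition growth_density :: "real \<Rightarrow> real \<Rightarrow> ennreal" where
  "growth_density \<beta> s = (if 0 < s then ennreal (\<beta>\<^sup>2 / 2 * growth \<beta> s + \<beta> / sqrt (2 * pi * s)) else 0)"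

text \<open>m - 1, which will turn out to be the expected number of splits up to time
  \<open>t\<close>; it vanishes before time 0 to fit convolutions over the line.\<close>

definition excess :: "real \<Rightarrow> real \<Rightarrow> ennreal" where
  "excess \<beta> t = (if 0 \<le> t then ennreal (growth \<beta> t - 1) else 0)"

lemma measurable_growth: "0 \<le> \<beta> \<Longrightarrow> (\<lambda>s. if 0 \<le> s then growth \<beta> s else 0) \<in> borel_measurable borel"
proof -
  assume \<beta>: "0 \<le> \<beta>"
  have "continuous_on {0..} (growth \<beta>)"
    unfolding continuous_on_eq_continuous_within
  proof
    fix x :: real assume x: "x \<in> {0..}"
    have "continuous (at x within {0..x + 1}) (growth \<beta>)"
      using continuous_on_growth[OF \<beta>, of "x + 1"] x by (auto simp: continuous_on_eq_continuous_within)
    moreover have "at x within {0..x + 1} = at x within {0..}"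
      by (rule at_within_nhd[of _ "{..<x + 1}"]) auto
    ultimately show "continuous (at x within {0..}) (growth \<beta>)" by simp
  qed
  then have "(\<lambda>s. if s \<in> {0..} then growth \<beta> s else 0) \<in> borel_measurable borel"
    by (intro borel_measurable_continuous_on_if) auto
  then show ?thesis by simp
qed

lemma measurable_excess [measurable]: "0 \<le> \<beta> \<Longrightarrow> excess \<beta> \<in> borel_measurable borel"
proof -
  assume "0 \<le> \<beta>"
  note [measurable] = measurable_growth[OF this]
  have "(\<lambda>t. if 0 \<le> t then ennreal ((if 0 \<le> t then growth \<beta> t else 0) - 1) else 0) \<in> borel_measurable borel"
    by measurable
  then show ?thesis
    unfolding excess_def[abs_def] by (simp cong: if_cong)
qed

lemma measurable_growth_density [measurable]: "0 \<le> \<beta> \<Longrightarrow> growth_density \<beta> \<in> borel_measurable borel"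
proof -
  assume "0 \<le> \<beta>"
  note [measurable] = measurable_growth[OF this]
  have "(\<lambda>t. if 0 < t then ennreal (\<beta>\<^sup>2 / 2 * (if 0 \<le> t then growth \<beta> t else 0) + \<beta> / sqrt (2 * pi * t)) else 0) \<in> borel_measurable borel"
    by measurable
  also have "(\<lambda>t. if 0 < t then ennreal (\<beta>\<^sup>2 / 2 * (if 0 \<le> t then growth \<beta> t else 0) + \<beta> / sqrt (2 * pi * t)) else 0) = growth_density \<beta>"
    by (auto simp: growth_density_def fun_eq_iff)
  finally show ?thesis .
qed

lemma growth_density_eq_deriv:
  assumes "0 < \<beta>" "0 < s"
  shows "growth_density \<beta> s = ennreal (deriv (growth \<beta>) s)"
  using DERIV_imp_deriv[OF growth_derivative[OF assms(2,1)]] assms by (simp add: growth_density_def)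

lemma excess_eq_conv:
  assumes \<beta>: "0 < \<beta>"
  shows "excess \<beta> t = conv (growth_density \<beta>) unit_step t"
proof -
  have conv_eq: "conv (growth_density \<beta>) unit_step t = (\<integral>\<^sup>+s. growth_density \<beta> s * indicator {0..t} s \<partial>lborel)"
    by (rule conv_unit_step) (simp add: growth_density_def)
  show ?thesis
  proof (cases "0 \<le> t")
    case True
    let ?d = "\<lambda>s. if 0 < s then \<beta>\<^sup>2 / 2 * growth \<beta> s + \<beta> / sqrt (2 * pi * s) else 0"
    have "(?d has_integral growth \<beta> t - growth \<beta> 0) {0..t}"
      using True \<beta> growth_derivative[OF _ \<beta>]
      by (intro fundamental_theorem_of_calculus_interior continuous_on_growth) (auto simp: has_real_derivative_iff_has_vector_derivative)
    moreover have "0 \<le> ?d s" for s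
      using growth_ge_1[of \<beta> s] \<beta> by auto
    ultimately have "(\<integral>\<^sup>+s. ennreal (?d s) * indicator {0..t} s \<partial>lborel) = ennreal (growth \<beta> t - growth \<beta> 0)"
      by (intro nn_integral_has_integral_lebesgue') auto
    moreover have "ennreal (?d s) = growth_density \<beta> s" for s
      by (simp add: growth_density_def)
    ultimately show ?thesis
      unfolding conv_eq using True by (simp add: excess_def growth_0)
  next
    case False
    then show ?thesis unfolding conv_eq by (simp add: excess_def)
  qed
qed


lemma conv_le_bound:
  assumes "f \<in> borel_measurable borel" and c: "\<And>s. s \<le> t \<Longrightarrow> g s \<le> ennreal c * unit_step s" and "\<And>s. s < 0 \<Longrightarrow> f s = 0"
  shows "conv f g t \<le> ennreal c * conv f unit_step t"
proof -
  note [measurable] = assms(1)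
  have "conv f g t \<le> (\<integral>\<^sup>+s. ennreal c * (f s * unit_step (t - s)) \<partial>lborel)"
    unfolding conv_def
  proof (intro nn_integral_mono)
    fix s
    show "f s * g (t - s) \<le> ennreal c * (f s * unit_step (t - s))"
    proof (cases "s < 0")
      case False
      then show ?thesis
        using mult_left_mono[OF c[of "t - s"], of "f s"] by (simp add: mult.left_commute)
    qed (simp add: assms(3))
  qed
  also have "\<dots> = ennreal c * conv f unit_step t"
    unfolding conv_def by (rule nn_integral_cmult) measurable
  finally show ?thesis .
qed

lemma conv_sqrt_kernel_unit_step:
  assumes "0 \<le> \<beta>"
  shows "conv (sqrt_kernel \<beta>) unit_step t < \<infinity>"
proof (cases "0 \<le> t")
  case True
  have "conv (sqrt_kernel \<beta>) unit_step t = (\<integral>\<^sup>+s. sqrt_kernel \<beta> s * indicator {0..t} s \<partial>lborel)"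
    by (rule conv_unit_step) (rule sqrt_kernel_neg)
  also have "\<dots> \<le> (\<integral>\<^sup>+s. ennreal \<beta> * (ennreal (s powr (-1/2)) * indicator {0..t} s) \<partial>lborel)"
  proof (intro nn_integral_mono)
    fix s
    have "\<beta> / sqrt (2 * pi * s) \<le> \<beta> * s powr (-1/2)" if "0 < s"
    proof -
      have "1 / sqrt (2 * pi * s) \<le> 1 / sqrt (1 * s)"
        using that pi_gt3 by (intro divide_left_mono real_sqrt_le_mono mult_right_mono) auto
      also have "\<dots> = s powr (-1/2)"
        using that by (simp add: powr_minus powr_half_sqrt divide_simps)
      finally show ?thesis
        using mult_left_mono[OF _ assms] by fastforce
    qed
    then show "sqrt_kernel \<beta> s * indicator {0..t} s \<le> ennreal \<beta> * (ennreal (s powr (-1/2)) * indicator {0..t} s)"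
      using assms by (auto simp: sqrt_kernel_def indicator_def ennreal_mult[symmetric] intro!: ennreal_leI)
  qed
  also have "\<dots> = ennreal \<beta> * (\<integral>\<^sup>+s. ennreal (s powr (-1/2)) * indicator {0..t} s \<partial>lborel)"
    by (rule nn_integral_cmult) measurable
  also have "(\<integral>\<^sup>+s. ennreal (s powr (-1/2)) * indicator {0..t} s \<partial>lborel) = ennreal (t powr (-1/2 + 1) / (-1/2 + 1))"
    by (rule nn_integral_has_integral_lebesgue'[OF _ has_integral_powr_from_0]) (use True in auto)
  also have "ennreal \<beta> * \<dots> < \<infinity>" by (simp add: ennreal_mult_less_top)
  finally show ?thesis .
next
  case False
  have "conv (sqrt_kernel \<beta>) unit_step t = (\<integral>\<^sup>+(s::real). 0 \<partial>lborel)"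
    unfolding conv_def by (rule nn_integral_cong) (use False in \<open>auto simp: sqrt_kernel_def indicator_def\<close>)
  then show ?thesis by simp
qed

text \<open>Both cases of the comparison below are instances of \<open>\<bar>X - Y\<bar> \<le> K * \<bar>X - Y\<bar>\<close>, with \<open>\<bar>X - Y\<bar>\<close> encoded
  by truncated subtraction in \<open>ennreal\<close>.\<close>

definition gap :: "(real \<Rightarrow> ennreal) \<Rightarrow> (real \<Rightarrow> ennreal) \<Rightarrow> real \<Rightarrow> ennreal" where
  "gap f g t = max (f t - g t) (g t - f t)"

lemma gap_commute: "gap f g = gap g f"
  by (simp add: gap_def fun_eq_iff max.commute)

lemma measurable_gap [measurable]:
  "f \<in> borel_measurable borel \<Longrightarrow> g \<in> borel_measurable borel \<Longrightarrow> gap f g \<in> borel_measurable borel"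
  unfolding gap_def[abs_def] by (intro borel_measurable_max borel_measurable_minus_ennreal)

lemma le_add_gap: "f t \<le> g t + gap f g t"
proof -
  have "f t \<le> g t + (f t - g t)"
    by (cases "f t \<le> g t") (auto simp: add_diff_inverse_ennreal intro: order_trans)
  also have "\<dots> \<le> g t + gap f g t"
    by (intro add_left_mono) (simp add: gap_def)
  finally show ?thesis .
qed

lemma gap_zeroD: "gap f g t = 0 \<Longrightarrow> f t = g t"
  by (auto simp: gap_def max_def diff_eq_0_iff_ennreal split: if_splits intro!: antisym)

text \<open>The second alternative is the subtraction-free form of X - K * X = Y - K * Y. Either
  equation bounds the difference of \<open>X\<close> and \<open>Y\<close> by that of their
  convolutions with \<open>K\<close>; finiteness is what permits cancelling in
  \<open>ennreal\<close>.\<close>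

lemma gap_le_conv:
  assumes [measurable]: "K \<in> borel_measurable borel" "X \<in> borel_measurable borel" "Y \<in> borel_measurable borel"
    and fin: "conv K X t < \<infinity>" "conv K Y t < \<infinity>" "X t < \<infinity>" "Y t < \<infinity>"
    and eq: "X t + conv K X t = Y t + conv K Y t \<or> X t + conv K Y t = Y t + conv K X t"
  shows "gap X Y t \<le> conv K (gap X Y) t"
proof -
  have *: "X t - Y t \<le> conv K (gap X Y) t"
    if [measurable]: "X \<in> borel_measurable borel" "Y \<in> borel_measurable borel"
      and fin: "conv K X t < \<infinity>" "conv K Y t < \<infinity>" "X t < \<infinity>" "Y t < \<infinity>"
      and eq: "X t + conv K X t = Y t + conv K Y t \<or> X t + conv K Y t = Y t + conv K X t" for X Y
  proof -
    have XY: "conv K X t \<le> conv K Y t + conv K (gap X Y) t"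
      unfolding conv_add_right[symmetric, OF assms(1) that(2) measurable_gap[OF that(1,2)]]
      by (intro conv_mono le_add_gap) simp
    have YX: "conv K Y t \<le> conv K X t + conv K (gap X Y) t"
      unfolding conv_add_right[symmetric, OF assms(1) that(1) measurable_gap[OF that(1,2)]]
      by (intro conv_mono) (auto intro: le_add_gap[of Y _ X, unfolded gap_commute[of Y X]])
    from eq have "X t \<le> Y t + conv K (gap X Y) t"
    proof
      assume "X t + conv K X t = Y t + conv K Y t"
      also have "\<dots> \<le> Y t + (conv K X t + conv K (gap X Y) t)"
        by (intro add_left_mono YX)
      finally have "conv K X t + X t \<le> conv K X t + (Y t + conv K (gap X Y) t)"
        by (simp add: ac_simps)
      then show ?thesis
        using fin by (subst (asm) ennreal_add_left_cancel_le) auto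
    next
      assume "X t + conv K Y t = Y t + conv K X t"
      also have "\<dots> \<le> Y t + (conv K Y t + conv K (gap X Y) t)"
        by (intro add_left_mono XY)
      finally have "conv K Y t + X t \<le> conv K Y t + (Y t + conv K (gap X Y) t)"
        by (simp add: ac_simps)
      then show ?thesis
        using fin by (subst (asm) ennreal_add_left_cancel_le) auto
    qed
    then show ?thesis
      using fin(3) by (auto simp: ennreal_minus_le_iff add.commute)
  qed
  show ?thesis
    unfolding gap_def[of X Y t]
    using *[OF assms(2,3) fin eq] *[OF assms(3,2) fin(2,1,4,3)] eq
    by (auto simp: gap_commute[of Y X])
qed

text \<open>Integrating the differential equation of m gives M = q * 1 + c * 1 + c * M for M = m -
  1, where c is the constant \<beta>^2 / 2 on the half-line. As q * q = c, the right-hand side X = q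
  * 1 + q * M of the claim solves the same equation, X = q * 1 + c * 1 + c * X. The kernel c is
  bounded, so Gronwall's estimate forces M = X.\<close>

lemma excess_Volterra:
  assumes \<beta>: "0 < \<beta>"
  shows "excess \<beta> t = conv (sqrt_kernel \<beta>) unit_step t + conv (sqrt_kernel \<beta>) (excess \<beta>) t"
proof (cases "0 \<le> t")
  case False
  have "conv (sqrt_kernel \<beta>) f t = 0" if "\<And>s. s < 0 \<Longrightarrow> f s = 0" for f
  proof -
    have "conv (sqrt_kernel \<beta>) f t = (\<integral>\<^sup>+(s::real). 0 \<partial>lborel)"
      unfolding conv_def by (rule nn_integral_cong) (use False that in \<open>auto simp: sqrt_kernel_def\<close>)
    then show ?thesis by simp
  qed
  from this[of unit_step] this[of "excess \<beta>"] show ?thesis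
    using False by (simp add: excess_def)
next
  case t: True
  have b0: "0 \<le> \<beta>" using \<beta> by simp
  let ?K = "sqrt_kernel \<beta>" and ?b = "ennreal (\<beta>\<^sup>2 / 2)"
  note [measurable] = measurable_excess[OF b0] measurable_growth_density[OF b0]
  define c where "c s = ?b * unit_step s" for s :: real
  define X where "X = (\<lambda>t. conv ?K unit_step t + conv ?K (excess \<beta>) t)"
  have [measurable]: "c \<in> borel_measurable borel" "X \<in> borel_measurable borel"
    unfolding c_def[abs_def] X_def by measurable
  have c_conv: "conv c f t = ?b * (\<integral>\<^sup>+s. f s * indicator {0..t} s \<partial>lborel)"
    if [measurable]: "f \<in> borel_measurable borel" and "\<And>s. s < 0 \<Longrightarrow> f s = 0" for f t
  proof -
    have "conv c f t = ?b * conv unit_step f t"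
      unfolding c_def[abs_def] by (rule conv_cmult_left) measurable
    then show ?thesis
      using conv_unit_step[OF that(2)] conv_commute[of unit_step f] by simp
  qed
  \<comment> \<open>At s = 0 the two sides differ, the step being 1 there and the density 0; a
    single point does not affect the integral.\<close>
  have dens: "growth_density \<beta> s = ?b * (unit_step s + excess \<beta> s) + ?K s" if "s \<noteq> 0" for s
  proof (cases "0 < s")
    case True
    have "growth_density \<beta> s = ennreal (\<beta>\<^sup>2 / 2 * (1 + (growth \<beta> s - 1)) + \<beta> / sqrt (2 * pi * s))"
      using True by (simp add: growth_density_def)
    also have "\<dots> = ennreal (\<beta>\<^sup>2 / 2) * (ennreal 1 + ennreal (growth \<beta> s - 1)) + ennreal (\<beta> / sqrt (2 * pi * s))"
      using growth_ge_1[OF b0, of s] True \<beta>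
      by (subst ennreal_plus[symmetric]) (auto simp: ennreal_mult[symmetric] ennreal_plus[symmetric] simp del: ennreal_plus)
    finally show ?thesis
      using True by (simp add: excess_def sqrt_kernel_def)
  next
    case False
    then show ?thesis using that by (simp add: growth_density_def excess_def sqrt_kernel_def)
  qed
  have M: "excess \<beta> t = conv ?K unit_step t + conv c unit_step t + conv c (excess \<beta>) t" for t
  proof -
    have d: "growth_density \<beta> s = ?K s + (?b * unit_step s + ?b * excess \<beta> s)" if "s \<noteq> 0" for s
      by (simp only: dens[OF that] distrib_left add.commute[of _ "?K s"])
    have "excess \<beta> t = (\<integral>\<^sup>+s. growth_density \<beta> s * unit_step (t - s) \<partial>lborel)"
      using excess_eq_conv[OF \<beta>, of t] by (simp only: conv_def)
    also have "\<dots> = (\<integral>\<^sup>+s. (?K s + (?b * unit_step s + ?b * excess \<beta> s)) * unit_step (t - s) \<partial>lborel)"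
      by (intro nn_integral_cong_AE eventually_mono[OF AE_lborel_singleton[of "0::real"]]) (use d in simp)
    also have "\<dots> = conv ?K unit_step t + (conv c unit_step t + ?b * conv (excess \<beta>) unit_step t)"
      unfolding conv_def c_def by (simp add: distrib_right nn_integral_add nn_integral_cmult[symmetric] mult.assoc)
    also have "?b * conv (excess \<beta>) unit_step t = conv c (excess \<beta>) t"
    proof -
      have "excess \<beta> s = 0" if "s < 0" for s
        using that by (simp add: excess_def)
      then show ?thesis
        using c_conv[of "excess \<beta>" t] conv_unit_step[of "excess \<beta>" t] by simp
    qed
    finally show ?thesis by (simp add: ac_simps)
  qed
  have KK: "conv ?K (conv ?K f) t = conv c f t" if "f \<in> borel_measurable borel" "\<And>s. s < 0 \<Longrightarrow> f s = 0" for f t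
    using conv_conv_sqrt_kernel[OF b0 that, of t] c_conv[OF that, of t] by simp
  have KM: "conv ?K (excess \<beta>) t = conv c unit_step t + conv c (conv ?K unit_step) t + conv c (conv ?K (excess \<beta>)) t" for t
  proof -
    have "conv ?K (excess \<beta>) t = conv ?K (\<lambda>t. conv ?K unit_step t + conv c unit_step t + conv c (excess \<beta>) t) t"
      by (subst M[abs_def]) simp
    also have "\<dots> = conv ?K (conv ?K unit_step) t + conv ?K (conv c unit_step) t + conv ?K (conv c (excess \<beta>)) t"
      by (simp add: conv_add_right)
    also have "\<dots> = conv c unit_step t + conv c (conv ?K unit_step) t + conv c (conv ?K (excess \<beta>)) t"
    proof -
      have com: "conv ?K (conv c f) = conv c (conv ?K f)" if [measurable]: "f \<in> borel_measurable borel" for f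
        by (simp add: conv_assoc[symmetric] conv_commute[of ?K c])
      have KK1: "conv ?K (conv ?K unit_step) t = conv c unit_step t"
        by (rule KK) auto
      have "conv ?K (conv c unit_step) = conv c (conv ?K unit_step)" "conv ?K (conv c (excess \<beta>)) = conv c (conv ?K (excess \<beta>))"
        by (rule com, measurable)+
      with KK1 show ?thesis by (simp only:)
    qed
    finally show ?thesis .
  qed
  have X_eq: "X t = conv ?K unit_step t + conv c unit_step t + conv c X t" for t
    unfolding X_def by (subst conv_add_right; simp add: KM[of t] ac_simps)
  have mono: "excess \<beta> s \<le> excess \<beta> u" if "s \<le> u" for s u
    unfolding excess_eq_conv[OF \<beta>] conv_def
    using that by (intro nn_integral_mono mult_left_mono) (auto simp: indicator_def)
  define C where "C = growth \<beta> t - 1"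
  have C0: "0 \<le> C" using growth_ge_1[OF b0 t] by (simp add: C_def)
  have M_le: "excess \<beta> s \<le> ennreal C * unit_step s" if "s \<le> t" for s
    using mono[OF that] t by (auto simp: excess_def C_def)
  obtain k where k: "conv ?K unit_step t = ennreal k" "0 \<le> k"
    using conv_sqrt_kernel_unit_step[OF b0, of t] by (cases "conv ?K unit_step t") auto
  have K_mono: "conv ?K unit_step s \<le> ennreal k" if "s \<le> t" for s
    unfolding k(1)[symmetric] conv_def
    using that by (intro nn_integral_mono mult_left_mono) (auto simp: indicator_def)
  have X_le: "X s \<le> ennreal (k + C * k) * unit_step s" if "s \<le> t" for s
  proof (cases "0 \<le> s")
    case True
    have "conv ?K (excess \<beta>) s \<le> ennreal C * conv ?K unit_step s"
      by (rule conv_le_bound) (use M_le that in \<open>auto simp: sqrt_kernel_neg\<close>)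
    also have "\<dots> \<le> ennreal C * ennreal k"
      by (intro mult_left_mono K_mono that) simp
    finally have "X s \<le> ennreal k + ennreal C * ennreal k"
      unfolding X_def using K_mono[OF that] by (intro add_mono)
    then show ?thesis
      using True C0 k by (simp add: ennreal_mult[symmetric])
  next
    case False
    have "conv ?K f s = 0" if "\<And>s. s < 0 \<Longrightarrow> f s = 0" for f
    proof -
      have "conv ?K f s = (\<integral>\<^sup>+(r::real). 0 \<partial>lborel)"
        unfolding conv_def by (rule nn_integral_cong) (use False that in \<open>auto simp: sqrt_kernel_def\<close>)
      then show ?thesis by simp
    qed
    from this[of unit_step] this[of "excess \<beta>"] show ?thesis
      using False by (simp add: X_def excess_def)
  qed
  have c1: "conv c unit_step s < \<infinity>" for s
  proof -
    have "(\<integral>\<^sup>+r. unit_step r * indicator {0..s} r \<partial>lborel) = (\<integral>\<^sup>+r. indicator {0..s} r \<partial>lborel)"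
      by (rule nn_integral_cong) (auto simp: indicator_def)
    also have "\<dots> = emeasure lborel {0..s}"
      by simp
    finally have "conv c unit_step s = ?b * emeasure lborel {0..s}"
      using c_conv[of unit_step s] by simp
    then show ?thesis
      by (simp add: ennreal_mult_less_top emeasure_lborel_Icc_eq)
  qed
  have fin: "conv c (excess \<beta>) s < \<infinity>" "conv c X s < \<infinity>" if "s \<le> t" for s
  proof -
    have "conv c (excess \<beta>) s \<le> ennreal C * conv c unit_step s"
      by (rule conv_le_bound) (use M_le that in \<open>auto simp: c_def\<close>)
    then show "conv c (excess \<beta>) s < \<infinity>"
      using c1[of s] by (auto simp: ennreal_mult_less_top elim!: order.strict_trans1)
    have "conv c X s \<le> ennreal (k + C * k) * conv c unit_step s"
      by (rule conv_le_bound) (use X_le that in \<open>auto simp: c_def\<close>)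
    then show "conv c X s < \<infinity>"
      using c1[of s] by (auto simp: ennreal_mult_less_top elim!: order.strict_trans1)
  qed
  have "gap (excess \<beta>) X t = 0"
  proof (rule gronwall_zero[where c = "\<beta>\<^sup>2 / 2" and C = "C + (k + C * k)" and t0 = t])
    fix s assume s: "s \<le> t"
    have "gap (excess \<beta>) X s \<le> excess \<beta> s + X s"
      unfolding gap_def by (auto intro: order_trans[OF diff_le_self_ennreal])
    also have "\<dots> \<le> ennreal C * unit_step s + ennreal (k + C * k) * unit_step s"
      by (intro add_mono M_le X_le s)
    also have "\<dots> \<le> ennreal (C + (k + C * k))"
      using C0 k by (auto simp: indicator_def)
    finally show "gap (excess \<beta>) X s \<le> ennreal (C + (k + C * k))" .
    have neg: "gap (excess \<beta>) X r = 0" if "r < 0" for r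
      using X_le[of r] M_le[of r] that t by (simp add: gap_def)
    have "gap (excess \<beta>) X s \<le> conv c (gap (excess \<beta>) X) s"
    proof (rule gap_le_conv)
      show "excess \<beta> s < \<infinity>" "X s < \<infinity>"
        using M_le[OF s] X_le[OF s] by (auto simp: ennreal_mult_less_top indicator_def elim!: order.strict_trans1)
    qed (use M[of s] X_eq[of s] fin[OF s] in \<open>auto simp: ac_simps\<close>)
    then show "gap (excess \<beta>) X s \<le> ?b * (\<integral>\<^sup>+r. gap (excess \<beta>) X r * indicator {0..s} r \<partial>lborel)"
      by (subst (asm) c_conv) (auto simp: neg)
  qed (use C0 k t in auto)
  then show ?thesis
    by (auto dest: gap_zeroD simp: X_def)
qed


section \<open>The renewal equation for the expected number of splits\<close>

lemma excess_mono:
  assumes "0 < \<beta>" "s \<le> u"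
  shows "excess \<beta> s \<le> excess \<beta> u"
  unfolding excess_eq_conv[OF assms(1)] conv_def
  using assms(2) by (intro nn_integral_mono mult_left_mono) (auto simp: indicator_def)

text \<open>The 2 counts the offspring. Write M = m - 1, F for the distribution function of
  \<open>\<mu>\<close> and A for the convolution of \<open>\<mu>\<close> with M. The hypothesis F +
  q * F = q * 1, convolved with m', becomes A + q * A = q * M. Hence R = F + 2 A has R + q * R = q *
  1 + 2 q * M, which by the Volterra equation of M is M + q * M. It remains to see that X + q * X
  determines X.\<close>

lemma excess_renewal:
  fixes \<mu> :: "real measure"
  assumes \<beta>: "0 < \<beta>" and "prob_space \<mu>" and s\<mu> [measurable_cong]: "sets \<mu> = sets borel"
    and nonneg: "AE r in \<mu>. 0 \<le> r"
    and Volterra: "\<And>t. measure_conv \<mu> unit_step t + conv (sqrt_kernel \<beta>) (measure_conv \<mu> unit_step) t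
      = conv (sqrt_kernel \<beta>) unit_step t"
  shows "excess \<beta> t = measure_conv \<mu> unit_step t + 2 * measure_conv \<mu> (excess \<beta>) t"
proof (cases "0 \<le> t")
  case False
  have "measure_conv \<mu> f t = 0" if "\<And>s. s < 0 \<Longrightarrow> f s = 0" for f
  proof -
    have "measure_conv \<mu> f t = (\<integral>\<^sup>+r. 0 \<partial>\<mu>)"
      unfolding measure_conv_def using False that by (intro nn_integral_cong_AE eventually_mono[OF nonneg]) auto
    then show ?thesis by simp
  qed
  from this[of unit_step] this[of "excess \<beta>"] show ?thesis
    using False by (simp add: excess_def)
next
  case t: True
  interpret prob_space \<mu> by fact
  have sf: "sigma_finite_measure \<mu>" ..
  have b0: "0 \<le> \<beta>" using \<beta> by simp
  let ?K = "sqrt_kernel \<beta>"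
  note [measurable] = measurable_excess[OF b0] measurable_growth_density[OF b0]
  define F where "F = measure_conv \<mu> unit_step"
  define A where "A = measure_conv \<mu> (excess \<beta>)"
  define R where "R = (\<lambda>t. F t + 2 * A t)"
  have [measurable]: "F \<in> borel_measurable borel" "A \<in> borel_measurable borel"
    unfolding F_def A_def by (auto intro!: measurable_measure_conv sf s\<mu>)
  have [measurable]: "R \<in> borel_measurable borel" unfolding R_def by measurable
  have M: "excess \<beta> = conv (growth_density \<beta>) unit_step"
    using excess_eq_conv[OF \<beta>] by (simp add: fun_eq_iff)
  \<comment> \<open>M is m' convolved with the unit step, and the convolution with
    \<open>\<mu>\<close> is moved onto the step.\<close>
  have A: "A = conv (growth_density \<beta>) F"
    unfolding A_def M F_def by (rule measure_conv_conv) (auto simp: sf s\<mu>)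
  have AK: "A t + conv ?K A t = conv ?K (excess \<beta>) t" for t
  proof -
    have "A t + conv ?K A t = conv (growth_density \<beta>) F t + conv (growth_density \<beta>) (conv ?K F) t"
      unfolding A by (simp add: conv_assoc[symmetric] conv_commute[of ?K "growth_density \<beta>"])
    also have "\<dots> = conv (growth_density \<beta>) (\<lambda>t. F t + conv ?K F t) t"
      by (simp add: conv_add_right)
    also have "(\<lambda>t. F t + conv ?K F t) = conv ?K unit_step"
      using Volterra by (simp add: F_def fun_eq_iff)
    also have "conv (growth_density \<beta>) (conv ?K unit_step) = conv ?K (excess \<beta>)"
      unfolding M by (simp add: conv_assoc[symmetric] conv_commute[of ?K "growth_density \<beta>"])
    finally show ?thesis .
  qed
  have RK: "excess \<beta> t + conv ?K (excess \<beta>) t = R t + conv ?K R t" for t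
  proof -
    have "R t + conv ?K R t = (F t + conv ?K F t) + 2 * (A t + conv ?K A t)"
    proof -
      have "conv ?K R t = conv ?K F t + conv ?K (\<lambda>t. 2 * A t) t"
        unfolding R_def by (rule conv_add_right) measurable
      also have "conv ?K (\<lambda>t. 2 * A t) t = 2 * conv ?K A t"
        by (rule conv_cmult_right) measurable
      finally show ?thesis
        by (simp only: R_def distrib_left ac_simps)
    qed
    also have "\<dots> = conv ?K unit_step t + 2 * conv ?K (excess \<beta>) t"
      using Volterra[of t] by (simp add: AK F_def)
    also have "\<dots> = excess \<beta> t + conv ?K (excess \<beta>) t"
      unfolding excess_Volterra[OF \<beta>, of t] mult_2 by (simp add: ac_simps)
    finally show ?thesis by simp
  qed
  define C where "C = growth \<beta> t - 1"
  have C0: "0 \<le> C" using growth_ge_1[OF b0 t] by (simp add: C_def)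
  have M_le: "excess \<beta> s \<le> ennreal C * unit_step s" if "s \<le> t" for s
    using excess_mono[OF \<beta> that] t by (auto simp: excess_def C_def)
  have mc_le: "measure_conv \<mu> f s \<le> ennreal c * unit_step s"
    if "s \<le> t" and f: "\<And>s. s \<le> t \<Longrightarrow> f s \<le> ennreal c * unit_step s" for f c s
  proof -
    have "measure_conv \<mu> f s \<le> (\<integral>\<^sup>+r. ennreal c * unit_step s \<partial>\<mu>)"
      unfolding measure_conv_def
    proof (intro nn_integral_mono_AE eventually_mono[OF nonneg])
      fix r :: real assume r: "0 \<le> r"
      have "f (s - r) \<le> ennreal c * unit_step (s - r)"
        using r that(1) by (intro f) simp
      also have "\<dots> \<le> ennreal c * unit_step s"
        using r by (intro mult_left_mono) (auto simp: indicator_def)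
      finally show "f (s - r) \<le> ennreal c * unit_step s" .
    qed
    then show ?thesis by (simp add: emeasure_space_1)
  qed
  have R_le: "R s \<le> ennreal (1 + 2 * C) * unit_step s" if "s \<le> t" for s
  proof -
    have "R s \<le> ennreal 1 * unit_step s + 2 * (ennreal C * unit_step s)"
      unfolding R_def F_def A_def by (intro add_mono mult_left_mono mc_le that) (auto simp: M_le)
    also have "\<dots> = ennreal (1 + 2 * C) * unit_step s"
      using C0 by (auto simp: indicator_def ennreal_plus ennreal_mult)
    finally show ?thesis .
  qed
  have Kfin: "conv ?K f s < \<infinity>" if "s \<le> t" "\<And>s. s \<le> t \<Longrightarrow> f s \<le> ennreal c * unit_step s" for f c s
  proof -
    have "conv ?K f s \<le> ennreal c * conv ?K unit_step s"
      by (rule conv_le_bound) (use that in \<open>auto simp: sqrt_kernel_neg\<close>)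
    then show ?thesis
      using conv_sqrt_kernel_unit_step[OF b0, of s] by (auto simp: ennreal_mult_less_top elim!: order.strict_trans1)
  qed
  have neg: "gap (excess \<beta>) R r = 0" if "r < 0" for r
    using R_le[of r] M_le[of r] that t by (simp add: gap_def)
  have gap_le: "gap (excess \<beta>) R s \<le> conv ?K (gap (excess \<beta>) R) s" if s: "s \<le> t" for s
  proof (rule gap_le_conv)
    show "excess \<beta> s < \<infinity>" "R s < \<infinity>"
      using M_le[OF s] R_le[OF s] by (auto simp: ennreal_mult_less_top indicator_def elim!: order.strict_trans1)
    show "conv ?K (excess \<beta>) s < \<infinity>" "conv ?K R s < \<infinity>"
      using Kfin[OF s M_le] Kfin[OF s R_le] by auto
  qed (use RK[of s] in auto)
  have "gap (excess \<beta>) R t = 0"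
  proof (rule gronwall_zero[where c = "\<beta>\<^sup>2 / 2" and C = "C + (1 + 2 * C)" and t0 = t])
    fix s assume s: "s \<le> t"
    have "gap (excess \<beta>) R s \<le> excess \<beta> s + R s"
      unfolding gap_def by (auto intro: order_trans[OF diff_le_self_ennreal])
    also have "\<dots> \<le> ennreal C * unit_step s + ennreal (1 + 2 * C) * unit_step s"
      by (intro add_mono M_le R_le s)
    also have "\<dots> \<le> ennreal (C + (1 + 2 * C))"
      using C0 by (cases "0 \<le> s") (auto simp: ennreal_plus[symmetric] simp del: ennreal_plus)
    finally show "gap (excess \<beta>) R s \<le> ennreal (C + (1 + 2 * C))" .
    have "gap (excess \<beta>) R s \<le> conv ?K (gap (excess \<beta>) R) s"
      by (rule gap_le[OF s])
    \<comment> \<open>The unbounded kernel is applied a second time to reach the constant kernel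
      that \<open>gronwall_zero\<close> requires.\<close>
    also have "\<dots> \<le> conv ?K (conv ?K (gap (excess \<beta>) R)) s"
      unfolding conv_def[of ?K _ s]
    proof (intro nn_integral_mono)
      fix r
      show "?K r * gap (excess \<beta>) R (s - r) \<le> ?K r * conv ?K (gap (excess \<beta>) R) (s - r)"
        using gap_le[of "s - r"] s by (cases "r < 0") (auto simp: sqrt_kernel_neg intro: mult_left_mono)
    qed
    also have "\<dots> = ennreal (\<beta>\<^sup>2 / 2) * (\<integral>\<^sup>+r. gap (excess \<beta>) R r * indicator {0..s} r \<partial>lborel)"
      by (rule conv_conv_sqrt_kernel[OF b0 _ neg]) measurable
    finally show "gap (excess \<beta>) R s \<le> ennreal (\<beta>\<^sup>2 / 2) * (\<integral>\<^sup>+r. gap (excess \<beta>) R r * indicator {0..s} r \<partial>lborel)" .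
  qed (use C0 t in auto)
  then show ?thesis
    by (auto dest: gap_zeroD simp: R_def F_def A_def)
qed

text \<open>Term \<open>k\<close> is the distribution function of a sum of k + 1 independent
  variables with law \<open>\<mu>\<close>; for lifespans this is the split time of a label of length
  k.\<close>

fun renewal_term :: "real measure \<Rightarrow> nat \<Rightarrow> real \<Rightarrow> ennreal" where
  "renewal_term \<mu> 0 = measure_conv \<mu> unit_step"
| "renewal_term \<mu> (Suc k) = measure_conv \<mu> (renewal_term \<mu> k)"

text \<open>After n iterations of the renewal equation the remainder is 2^n times the n-fold
  convolution of \<open>excess\<close>. It is at most a fixed multiple of the last term summed, and
  the terms tend to 0 because their partial sums stay below the finite value
  \<open>excess \<beta> t\<close>. No decay rate for \<mu> enters.\<close>

lemma excess_eq_suminf: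
  fixes \<mu> :: "real measure"
  assumes \<beta>: "0 < \<beta>" and "prob_space \<mu>" and s\<mu> [measurable_cong]: "sets \<mu> = sets borel"
    and nonneg: "AE r in \<mu>. 0 \<le> r"
    and Volterra: "\<And>t. measure_conv \<mu> unit_step t + conv (sqrt_kernel \<beta>) (measure_conv \<mu> unit_step) t
      = conv (sqrt_kernel \<beta>) unit_step t"
  shows "(\<Sum>k. 2 ^ k * renewal_term \<mu> k t) = excess \<beta> t"
proof -
  interpret prob_space \<mu> by fact
  have sf: "sigma_finite_measure \<mu>" ..
  have b0: "0 \<le> \<beta>" using \<beta> by simp
  note [measurable] = measurable_excess[OF b0]
  have rt_meas [measurable]: "renewal_term \<mu> k \<in> borel_measurable borel" for k
    by (induction k) (auto intro!: measurable_measure_conv sf s\<mu>)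
  define rest where "rest = (\<lambda>k. (measure_conv \<mu> ^^ k) (excess \<beta>))"
  have rest_meas [measurable]: "rest k \<in> borel_measurable borel" for k
    unfolding rest_def by (induction k) (auto intro!: measurable_measure_conv sf s\<mu>)
  have rest_Suc: "rest (Suc k) = measure_conv \<mu> (rest k)" for k
    by (simp add: rest_def)
  have mc_add: "measure_conv \<mu> (\<lambda>t. f t + c * g t) t = measure_conv \<mu> f t + c * measure_conv \<mu> g t"
    if [measurable]: "f \<in> borel_measurable borel" "g \<in> borel_measurable borel" for f g c t
    unfolding measure_conv_def by (simp add: nn_integral_add nn_integral_cmult)
  have step: "rest k t = renewal_term \<mu> k t + 2 * rest (Suc k) t" for k t
  proof (induction k arbitrary: t)
    case 0
    then show ?case
      using excess_renewal[OF assms] by (simp add: rest_def)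
  next
    case (Suc k)
    have eq: "rest k = (\<lambda>t. renewal_term \<mu> k t + 2 * rest (Suc k) t)"
      by (rule ext) (rule Suc.IH)
    have "rest (Suc k) t = measure_conv \<mu> (rest k) t"
      by (simp only: rest_Suc)
    also have "\<dots> = measure_conv \<mu> (\<lambda>t. renewal_term \<mu> k t + 2 * rest (Suc k) t) t"
      by (rule arg_cong[where f = "\<lambda>f. measure_conv \<mu> f t"]) (rule eq)
    also have "\<dots> = renewal_term \<mu> (Suc k) t + 2 * rest (Suc (Suc k)) t"
      by (simp add: mc_add rest_Suc[of "Suc k"])
    finally show ?case .
  qed
  have partial: "excess \<beta> t = (\<Sum>k<n. 2 ^ k * renewal_term \<mu> k t) + 2 ^ n * rest n t" for n t
  proof (induction n)
    case 0
    then show ?case by (simp add: rest_def)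
  next
    case (Suc n)
    then show ?case
      by (subst (asm) step) (simp add: distrib_left ac_simps)
  qed
  have fin: "excess \<beta> t < \<infinity>"
    by (simp add: excess_def)
  have rt_neg: "renewal_term \<mu> k t = 0" if "t < 0" for k t
    using that
  proof (induction k arbitrary: t)
    case 0
    have "measure_conv \<mu> unit_step t = (\<integral>\<^sup>+r. 0 \<partial>\<mu>)"
      unfolding measure_conv_def using 0 by (intro nn_integral_cong_AE eventually_mono[OF nonneg]) auto
    then show ?case by simp
  next
    case (Suc k)
    have "measure_conv \<mu> (renewal_term \<mu> k) t = (\<integral>\<^sup>+r. 0 \<partial>\<mu>)"
      unfolding measure_conv_def using Suc by (intro nn_integral_cong_AE eventually_mono[OF nonneg]) auto
    then show ?case by simp
  qed
  \<comment> \<open>Up to time \<open>t\<close> the function \<open>excess\<close> lies below its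
    value at \<open>t\<close> times the unit step, so one convolution with \<mu> turns the remainder
    into a multiple of a renewal term.\<close>
  have rest_le: "rest (Suc k) s \<le> excess \<beta> t * renewal_term \<mu> k s" if "s \<le> t" for k s
    using that
  proof (induction k arbitrary: s)
    case 0
    have "measure_conv \<mu> (excess \<beta>) s \<le> (\<integral>\<^sup>+r. excess \<beta> t * unit_step (s - r) \<partial>\<mu>)"
      unfolding measure_conv_def
    proof (intro nn_integral_mono_AE eventually_mono[OF nonneg])
      fix r :: real assume "0 \<le> r"
      then show "excess \<beta> (s - r) \<le> excess \<beta> t * unit_step (s - r)"
        using excess_mono[OF \<beta>, of "s - r" t] 0 by (cases "0 \<le> s - r") (auto simp: excess_def)
    qed
    also have "\<dots> = excess \<beta> t * measure_conv \<mu> unit_step s"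
      unfolding measure_conv_def by (rule nn_integral_cmult) measurable
    finally show ?case by (simp add: rest_def)
  next
    case (Suc k)
    have "measure_conv \<mu> (rest (Suc k)) s \<le> (\<integral>\<^sup>+r. excess \<beta> t * renewal_term \<mu> k (s - r) \<partial>\<mu>)"
      unfolding measure_conv_def
      using Suc by (intro nn_integral_mono_AE eventually_mono[OF nonneg]) auto
    also have "\<dots> = excess \<beta> t * measure_conv \<mu> (renewal_term \<mu> k) s"
      unfolding measure_conv_def by (rule nn_integral_cmult) measurable
    finally show ?case by (simp add: rest_Suc)
  qed
  define S where "S = (\<Sum>k. 2 ^ k * renewal_term \<mu> k t)"
  have part_le: "(\<Sum>k<n. 2 ^ k * renewal_term \<mu> k t) \<le> excess \<beta> t" for n
    using partial[of t n] by simp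
  have S_le: "S \<le> excess \<beta> t"
    unfolding S_def by (intro suminf_le_const part_le) auto
  have term_fin: "2 ^ k * renewal_term \<mu> k t < top" for k
  proof -
    have "2 ^ k * renewal_term \<mu> k t \<le> (\<Sum>k<Suc k. 2 ^ k * renewal_term \<mu> k t)"
      by simp
    then show ?thesis
      using order.strict_trans1[OF order_trans[OF _ part_le[of "Suc k"]] fin] by simp
  qed
  have "(\<lambda>k. enn2real (2 ^ k * renewal_term \<mu> k t)) \<longlonglongrightarrow> 0"
  proof (rule summable_LIMSEQ_zero, rule summableI_nonneg_bounded)
    show "(\<Sum>k<n. enn2real (2 ^ k * renewal_term \<mu> k t)) \<le> enn2real (excess \<beta> t)" for n
      using enn2real_mono[OF part_le[of n]] fin term_fin by (simp add: enn2real_sum comp_def)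
  qed simp
  then have "(\<lambda>k. ennreal (enn2real (2 ^ k * renewal_term \<mu> k t))) \<longlonglongrightarrow> ennreal 0"
    by (rule tendsto_ennrealI)
  then have a0: "(\<lambda>k. 2 ^ k * renewal_term \<mu> k t) \<longlonglongrightarrow> 0"
    using term_fin by simp
  have "(\<lambda>k. S + (2 * excess \<beta> t) * (2 ^ k * renewal_term \<mu> k t)) \<longlonglongrightarrow> S + (2 * excess \<beta> t) * 0"
    by (intro tendsto_add tendsto_const ennreal_tendsto_cmult a0) (use fin in \<open>simp add: ennreal_mult_less_top\<close>)
  moreover have "excess \<beta> t \<le> S + (2 * excess \<beta> t) * (2 ^ k * renewal_term \<mu> k t)" for k
  proof -
    have "excess \<beta> t = (\<Sum>i<Suc k. 2 ^ i * renewal_term \<mu> i t) + 2 ^ Suc k * rest (Suc k) t"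
      by (rule partial)
    also have "\<dots> \<le> S + 2 ^ Suc k * (excess \<beta> t * renewal_term \<mu> k t)"
      unfolding S_def by (intro add_mono mult_left_mono rest_le sum_le_suminf) auto
    finally show ?thesis by (simp add: mult_ac)
  qed
  ultimately have "excess \<beta> t \<le> S"
    by (intro LIMSEQ_le_const) auto
  with S_le show ?thesis by (simp add: S_def)
qed

subsection \<open>Independence of the particles\<close>

text \<open>For \<epsilon> below \<open>c\<close> the occupation of (-\<epsilon>, \<epsilon>) does
  not change between \<open>a\<close> and \<open>b\<close>. The candidate limits are then the same,
  so the two values of \<open>Lim\<close> agree even where no limit exists.\<close>

lemma local_time_constant:
  assumes "a \<le> b" and c: "0 < c" "\<And>s. a \<le> s \<Longrightarrow> s \<le> b \<Longrightarrow> c \<le> \<bar>x s\<bar>" and a: "0 \<le> a"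
  shows "local_time x a = local_time x b"
proof -
  let ?f = "\<lambda>t \<epsilon>. 1 / (2 * \<epsilon>) * (LINT s:{0..t}|lborel. indicator {y. \<bar>y\<bar> < \<epsilon>} (x s))"
  have ev: "\<forall>\<^sub>F \<epsilon> in at_right 0. ?f a \<epsilon> = ?f b \<epsilon>"
    unfolding eventually_at_right_field
  proof (intro exI[of _ c] conjI allI impI c)
    fix \<epsilon> :: real assume \<epsilon>: "0 < \<epsilon>" "\<epsilon> < c"
    have "indicator {0..a} s *\<^sub>R indicator {y. \<bar>y\<bar> < \<epsilon>} (x s) = indicator {0..b} s *\<^sub>R (indicator {y. \<bar>y\<bar> < \<epsilon>} (x s) :: real)" for s
      using c(2)[of s] \<epsilon> assms(1) a by (cases "a \<le> s") (auto simp: indicator_def)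
    then show "?f a \<epsilon> = ?f b \<epsilon>"
      unfolding set_lebesgue_integral_def by (simp only:)
  qed
  have "(\<lambda>l. (?f a \<longlongrightarrow> l) (at_right 0)) = (\<lambda>l. (?f b \<longlongrightarrow> l) (at_right 0))"
    using tendsto_cong[OF ev] by auto
  then show ?thesis
    unfolding local_time_def Topological_Spaces.Lim_def by (simp only:)
qed

text \<open>The conditional probability of surviving past age \<open>t\<close> given the motion. It
  is 1 for negative \<open>t\<close> because lifespans are nonnegative, and \<open>max 0\<close>
  keeps it in [0, 1] on exceptional codes, where the value of the local time is arbitrary.\<close>

definition code_survival :: "real \<Rightarrow> real \<Rightarrow> (nat \<times> nat \<Rightarrow> real) \<Rightarrow> real" where
  "code_survival \<beta> t c = (if t < 0 then 1 else exp (- (\<beta> * max 0 (code_local_time c t))))"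

lemma measurable_code_survival [measurable]: "code_survival \<beta> t \<in> borel_measurable code_space"
  unfolding code_survival_def[abs_def] by measurable

lemma code_survival_bounds:
  assumes "0 \<le> \<beta>"
  shows "0 \<le> code_survival \<beta> t c" "code_survival \<beta> t c \<le> 1"
  using assms by (auto simp: code_survival_def)

section \<open>Splits happen at the origin\<close>

context catalytic_bbm
begin

lemma T_measurable' [measurable]: "T u \<in> borel_measurable M"
  by (rule T_measurable)

lemma B_measurable: "0 \<le> a \<Longrightarrow> B u a \<in> borel_measurable M"
  by (rule std_brownian_motion.W_measurable[OF B_brownian])

lemma code_measurable [measurable]: "path_code (B u) \<in> measurable M code_space"
  by (rule std_brownian_motion.path_code_measurable[OF B_brownian])

lemma environment_generators:
  "{B v a -` A \<inter> space M | v a A. 0 \<le> a \<and> A \<in> sets borel} \<union>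
      {T w -` A \<inter> space M | w A. \<not> suffix u w \<and> A \<in> sets borel} \<subseteq> sets M"
  by (auto intro!: measurable_sets[OF B_measurable] measurable_sets[OF T_measurable])

lemma sets_environment:
  "sets (environment M B T u) = sigma_sets (space M)
     ({B v a -` A \<inter> space M | v a A. 0 \<le> a \<and> A \<in> sets borel} \<union>
      {T w -` A \<inter> space M | w A. \<not> suffix u w \<and> A \<in> sets borel})"
  unfolding environment_def by (rule sets_measure_of) auto

lemma space_environment: "space (environment M B T u) = space M"
  unfolding environment_def by (rule space_measure_of) auto

lemma subalgebra_environment: "subalgebra M (environment M B T u)"
  unfolding subalgebra_def space_environment sets_environment
  by (auto intro: sets.sigma_sets_subset[OF environment_generators, THEN subsetD])

lemma environment_B: "0 \<le> a \<Longrightarrow> B v a \<in> borel_measurable (environment M B T u)"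
  by (rule measurableI) (auto simp: space_environment sets_environment intro!: sigma_sets.Basic)

lemma environment_T: "\<not> suffix u w \<Longrightarrow> T w \<in> borel_measurable (environment M B T u)"
  by (rule measurableI) (auto simp: space_environment sets_environment intro!: sigma_sets.Basic UnI2)

lemma environment_code: "path_code (B v) \<in> measurable (environment M B T u) code_space"
  by (rule measurable_path_code) (rule environment_B)

text \<open>The splitting rule tested against a bounded function of the environment. The vanishing
  birth place enters here: the path whose local time governs the split is then the driving motion
  itself, so the conditional probability is a function of its code.\<close>

lemma integral_split:
  assumes birth: "AE \<omega> in M. birth_place B T u \<omega> = 0" and \<beta>: "0 \<le> \<beta>"
    and f: "f \<in> borel_measurable (environment M B T u)" "\<And>\<omega>. \<bar>f \<omega>\<bar> \<le> K"
  shows "(\<integral>\<omega>. f \<omega> * indicator {t<..} (T u \<omega>) \<partial>M) = (\<integral>\<omega>. f \<omega> * code_survival \<beta> t (path_code (B u) \<omega>) \<partial>M)"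
proof (cases "t < 0")
  case True
  then have "indicator {t<..} (T u \<omega>) = (1::real)" if "\<omega> \<in> space M" for \<omega>
    using T_nonneg[OF that, of u] by simp
  then show ?thesis
    using True by (intro Bochner_Integration.integral_cong) (auto simp: code_survival_def)
next
  case False
  then have t: "0 \<le> t" by simp
  interpret W: std_brownian_motion M "B u" by (rule B_brownian)
  interpret E: sigma_finite_subalgebra M "environment M B T u"
    by (intro finite_measure_subalgebra_is_sigma_finite finite_measure_subalgebra.intro finite_measure_subalgebra_axioms.intro
       subalgebra_environment finite_measure_axioms)
  note [measurable] = measurable_from_subalg[OF subalgebra_environment f(1)]
  let ?g = "indicator {\<omega>' \<in> space M. T u \<omega>' > t} :: 'w \<Rightarrow> real"
  have g_meas [measurable]: "?g \<in> borel_measurable M" by measurable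
  have int: "integrable M (\<lambda>\<omega>. f \<omega> * ?g \<omega>)"
  proof (rule integrable_bounded_real)
    show "\<bar>f \<omega> * ?g \<omega>\<bar> \<le> K" for \<omega>
      using f(2)[of \<omega>] by (auto simp: indicator_def)
  qed measurable
  have "(\<integral>\<omega>. f \<omega> * indicator {t<..} (T u \<omega>) \<partial>M) = (\<integral>\<omega>. f \<omega> * ?g \<omega> \<partial>M)"
    by (intro Bochner_Integration.integral_cong) (auto simp: indicator_def)
  also have "\<dots> = (\<integral>\<omega>. f \<omega> * real_cond_exp M (environment M B T u) ?g \<omega> \<partial>M)"
    by (rule E.real_cond_exp_intg(2)[symmetric, OF int f(1) g_meas])
  also have "\<dots> = (\<integral>\<omega>. f \<omega> * code_survival \<beta> t (path_code (B u) \<omega>) \<partial>M)"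
  proof (rule integral_cong_AE)
    show "(\<lambda>\<omega>. f \<omega> * real_cond_exp M (environment M B T u) ?g \<omega>) \<in> borel_measurable M"
      by measurable
    show "(\<lambda>\<omega>. f \<omega> * code_survival \<beta> t (path_code (B u) \<omega>)) \<in> borel_measurable M"
      by measurable
    show "AE \<omega> in M. f \<omega> * real_cond_exp M (environment M B T u) ?g \<omega> = f \<omega> * code_survival \<beta> t (path_code (B u) \<omega>)"
      using T_split[OF t, of u] birth W.AE_local_time[OF t] W.AE_code_local_time_nonneg[OF t]
    proof eventually_elim
      case (elim \<omega>)
      have "path B T u \<omega> = (\<lambda>a. B u a \<omega>)"
        using elim(2) by (simp add: path_def fun_eq_iff)
      with elim show ?case
        using t by (simp add: code_survival_def)
    qed
  qed
  finally show ?thesis .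
qed

text \<open>Inspecting rational times only makes this an event of the environment; by continuity it
  says that the motion stays away from 0 on all of [a, b] when a < b are rational.\<close>

definition off_zero :: "bool list \<Rightarrow> real \<Rightarrow> real \<Rightarrow> 'w set" where
  "off_zero u a b = {\<omega> \<in> space M. \<exists>n::nat. \<forall>q\<in>\<rat> \<inter> {a..b}. 1 / real (Suc n) \<le> \<bar>B u q \<omega>\<bar>}"

lemma AE_code_survival_eq:
  assumes "0 \<le> a" "a < b" and ab: "a \<in> \<rat>" "b \<in> \<rat>"
  shows "AE \<omega> in M. \<omega> \<in> off_zero u a b \<longrightarrow> code_survival \<beta> a (path_code (B u) \<omega>) = code_survival \<beta> b (path_code (B u) \<omega>)"
proof -
  interpret W: std_brownian_motion M "B u" by (rule B_brownian)
  have b: "0 \<le> b" using assms by simp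
  show ?thesis
    using W.AE_local_time[OF assms(1)] W.AE_local_time[OF b]
  proof eventually_elim
    case (elim \<omega>)
    have "local_time (\<lambda>s. B u s \<omega>) a = local_time (\<lambda>s. B u s \<omega>) b" if G: "\<omega> \<in> off_zero u a b"
    proof -
      from G have \<omega>: "\<omega> \<in> space M" and ex: "\<exists>n::nat. \<forall>q\<in>\<rat> \<inter> {a..b}. 1 / real (Suc n) \<le> \<bar>B u q \<omega>\<bar>"
        unfolding off_zero_def by blast+
      from ex obtain n :: nat where n': "\<forall>q\<in>\<rat> \<inter> {a..b}. 1 / real (Suc n) \<le> \<bar>B u q \<omega>\<bar>"
        by blast
      have n: "1 / real (Suc n) \<le> \<bar>B u q \<omega>\<bar>" if "q \<in> \<rat>" "a \<le> q" "q \<le> b" for q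
        using that by (intro n'[rule_format]) auto
      have "1 / real (Suc n) \<le> \<bar>B u s \<omega>\<bar>" if s: "a \<le> s" "s \<le> b" for s
      proof (rule ccontr)
        assume neg: "\<not> 1 / real (Suc n) \<le> \<bar>B u s \<omega>\<bar>"
        \<comment> \<open>Rational endpoints are covered directly; an interior time has a whole
          neighbourhood inside the interval, and that contains rationals.\<close>
        have "s \<noteq> a" "s \<noteq> b" using neg n ab assms(2) by auto
        then have s': "a < s" "s < b" using s by auto
        have "continuous_on {a<..<b} (\<lambda>s. \<bar>B u s \<omega>\<bar>)"
          by (intro continuous_intros continuous_on_subset[OF W.W_continuous[OF \<omega>]]) (use assms in auto)
        then have "open ({a<..<b} \<inter> (\<lambda>s. \<bar>B u s \<omega>\<bar>) -` {..<1 / real (Suc n)})"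
          by (rule continuous_open_preimage) auto
        moreover have "s \<in> {a<..<b} \<inter> (\<lambda>s. \<bar>B u s \<omega>\<bar>) -` {..<1 / real (Suc n)}"
          using s' neg by auto
        ultimately obtain e where e: "0 < e" "ball s e \<subseteq> {a<..<b} \<inter> (\<lambda>s. \<bar>B u s \<omega>\<bar>) -` {..<1 / real (Suc n)}"
          unfolding open_contains_ball by blast
        obtain q where q: "q \<in> \<rat>" "s < q" "q < s + e"
          using Rats_dense_in_real[of s "s + e"] e by auto
        then have "q \<in> {a<..<b} \<inter> (\<lambda>s. \<bar>B u s \<omega>\<bar>) -` {..<1 / real (Suc n)}"
          by (intro e(2)[THEN subsetD]) (auto simp: dist_real_def)
        then have "\<bar>B u q \<omega>\<bar> < 1 / real (Suc n)" "a \<le> q" "q \<le> b" by auto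
        with n[OF q(1)] show False by linarith
      qed
      then show ?thesis
        using assms by (intro local_time_constant[where c = "1 / real (Suc n)"]) auto
    qed
    with elim show ?case
      using assms b by (auto simp: code_survival_def)
  qed
qed

text \<open>A split away from 0 would fall into a rational interval (a, b] such that the motion
  avoids 0 on [a, b]. There the local time is flat, the survival probabilities at \<open>a\<close>
  and \<open>b\<close> agree, and so a split in between has probability 0; only countably many
  intervals have to be excluded. At age 0 the motion is at 0 anyway.\<close>

lemma AE_split_at_zero:
  assumes birth: "AE \<omega> in M. birth_place B T u \<omega> = 0" and \<beta>: "0 \<le> \<beta>"
  shows "AE \<omega> in M. B u (T u \<omega>) \<omega> = 0"
proof -
  interpret W: std_brownian_motion M "B u" by (rule B_brownian)
  define G where "G a b = off_zero u a b" for a b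
  let ?E = "environment M B T u"
  have G_env: "G a b \<in> sets ?E" if "0 \<le> a" for a b
  proof -
    have *: "{\<omega> \<in> space ?E. 1 / real (Suc n) \<le> \<bar>B u q \<omega>\<bar>} \<in> sets ?E" if "q \<in> \<rat> \<inter> {a..b}" for n q
    proof -
      have [measurable]: "B u q \<in> borel_measurable ?E"
        using that \<open>0 \<le> a\<close> by (intro environment_B) auto
      show ?thesis by measurable
    qed
    have c: "countable (\<rat> \<inter> {a..b})" by (auto intro: countable_rat)
    have "{\<omega> \<in> space ?E. \<forall>q\<in>\<rat> \<inter> {a..b}. 1 / real (Suc n) \<le> \<bar>B u q \<omega>\<bar>} \<in> sets ?E" for n
      by (rule sets.sets_Collect_countable_All'[OF * c])
    then have "{\<omega> \<in> space ?E. \<exists>n::nat. \<forall>q\<in>\<rat> \<inter> {a..b}. 1 / real (Suc n) \<le> \<bar>B u q \<omega>\<bar>} \<in> sets ?E"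
      by (rule sets.sets_Collect_countable_Ex)
    then show ?thesis
      by (simp add: G_def off_zero_def space_environment)
  qed
  have null: "AE \<omega> in M. \<not> (\<omega> \<in> G a b \<and> a < T u \<omega> \<and> T u \<omega> \<le> b)" if ab: "0 \<le> a" "a < b" "a \<in> \<rat>" "b \<in> \<rat>" for a b
  proof -
    let ?f = "indicator (G a b) :: 'w \<Rightarrow> real"
    have f_env: "?f \<in> borel_measurable ?E"
      using G_env[OF ab(1)] by measurable
    have [measurable]: "?f \<in> borel_measurable M"
      by (rule measurable_from_subalg[OF subalgebra_environment f_env])
    have f1: "\<bar>?f \<omega>\<bar> \<le> 1" for \<omega> by (simp add: indicator_def)
    have i: "integrable M (\<lambda>\<omega>. ?f \<omega> * indicator {t<..} (T u \<omega>))" for t :: real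
    proof (rule integrable_bounded_real)
      show "\<bar>?f \<omega> * indicator {t<..} (T u \<omega>)\<bar> \<le> 1" for \<omega>
        by (simp add: indicator_def)
    qed measurable
    \<comment> \<open>The difference is the indicator of a split during (a, b] on the event
      \<open>G a b\<close>, so a vanishing integral makes that event null.\<close>
    have "(\<integral>\<omega>. ?f \<omega> * indicator {a<..} (T u \<omega>) - ?f \<omega> * indicator {b<..} (T u \<omega>) \<partial>M)
      = (\<integral>\<omega>. ?f \<omega> * indicator {a<..} (T u \<omega>) \<partial>M) - (\<integral>\<omega>. ?f \<omega> * indicator {b<..} (T u \<omega>) \<partial>M)"
      by (rule Bochner_Integration.integral_diff[OF i i])
    also have "\<dots> = (\<integral>\<omega>. ?f \<omega> * code_survival \<beta> a (path_code (B u) \<omega>) \<partial>M) - (\<integral>\<omega>. ?f \<omega> * code_survival \<beta> b (path_code (B u) \<omega>) \<partial>M)"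
      using integral_split[OF birth \<beta> f_env f1] by simp
    also have "(\<integral>\<omega>. ?f \<omega> * code_survival \<beta> a (path_code (B u) \<omega>) \<partial>M) = (\<integral>\<omega>. ?f \<omega> * code_survival \<beta> b (path_code (B u) \<omega>) \<partial>M)"
    proof (rule integral_cong_AE)
      show "AE \<omega> in M. ?f \<omega> * code_survival \<beta> a (path_code (B u) \<omega>) = ?f \<omega> * code_survival \<beta> b (path_code (B u) \<omega>)"
        using AE_code_survival_eq[OF ab, of u] by eventually_elim (auto simp: G_def indicator_def)
    qed measurable
    finally have zero: "(\<integral>\<omega>. ?f \<omega> * indicator {a<..} (T u \<omega>) - ?f \<omega> * indicator {b<..} (T u \<omega>) \<partial>M) = 0" by simp
    have "AE \<omega> in M. ?f \<omega> * indicator {a<..} (T u \<omega>) - ?f \<omega> * indicator {b<..} (T u \<omega>) = 0"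
    proof (subst integral_nonneg_eq_0_iff_AE[symmetric])
      show "integrable M (\<lambda>\<omega>. ?f \<omega> * indicator {a<..} (T u \<omega>) - ?f \<omega> * indicator {b<..} (T u \<omega>))"
        by (intro Bochner_Integration.integrable_diff i)
      show "AE \<omega> in M. 0 \<le> ?f \<omega> * indicator {a<..} (T u \<omega>) - ?f \<omega> * indicator {b<..} (T u \<omega>)"
        using ab by (auto simp: indicator_def)
    qed (rule zero)
    then show ?thesis
      by eventually_elim (auto simp: indicator_def split: if_splits)
  qed
  have "AE \<omega> in M. \<forall>a\<in>\<rat>. \<forall>b\<in>\<rat>. 0 \<le> a \<longrightarrow> a < b \<longrightarrow> \<not> (\<omega> \<in> G a b \<and> a < T u \<omega> \<and> T u \<omega> \<le> b)"
    using null by (subst AE_ball_countable[OF countable_rat], intro ballI, subst AE_ball_countable[OF countable_rat]) auto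
  then show ?thesis
    using AE_space
  proof eventually_elim
    case (elim \<omega>)
    show ?case
    proof (rule ccontr)
      assume nz: "B u (T u \<omega>) \<omega> \<noteq> 0"
      let ?\<tau> = "T u \<omega>"
      have \<tau>0: "0 < ?\<tau>"
        using nz W.W_zero[OF elim(2)] T_nonneg[OF elim(2), of u] by (cases "?\<tau> = 0") auto
      obtain n :: nat where n: "1 / real (Suc n) < \<bar>B u ?\<tau> \<omega>\<bar>"
        using reals_Archimedean[of "\<bar>B u ?\<tau> \<omega>\<bar>"] nz by (auto simp: inverse_eq_divide)
      have "continuous_on {0<..} (\<lambda>s. \<bar>B u s \<omega>\<bar>)"
        by (intro continuous_intros continuous_on_subset[OF W.W_continuous[OF elim(2)]]) auto
      then have "isCont (\<lambda>s. \<bar>B u s \<omega>\<bar>) ?\<tau>"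
        using \<tau>0 by (simp add: continuous_on_eq_continuous_at)
      then have "\<forall>\<^sub>F s in nhds ?\<tau>. 1 / real (Suc n) < \<bar>B u s \<omega>\<bar>"
        using n unfolding continuous_at by (intro order_tendstoD) (auto simp: tendsto_nhds_iff isCont_def)
      moreover have "\<forall>\<^sub>F s in nhds ?\<tau>. 0 < s"
        using \<tau>0 by (rule eventually_nhds_in_open[of "{0<..}", simplified, rotated]) simp
      ultimately have "\<forall>\<^sub>F s in nhds ?\<tau>. 1 / real (Suc n) < \<bar>B u s \<omega>\<bar> \<and> 0 < s"
        by (rule eventually_conj)
      then obtain e where e: "0 < e" "\<And>s. dist s ?\<tau> < e \<Longrightarrow> 1 / real (Suc n) < \<bar>B u s \<omega>\<bar> \<and> 0 < s"
        unfolding eventually_nhds_metric by auto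
      obtain a where a: "a \<in> \<rat>" "?\<tau> - e < a" "a < ?\<tau>"
        using Rats_dense_in_real[of "?\<tau> - e" ?\<tau>] e by auto
      obtain b where b: "b \<in> \<rat>" "?\<tau> < b" "b < ?\<tau> + e"
        using Rats_dense_in_real[of ?\<tau> "?\<tau> + e"] e by auto
      have near: "1 / real (Suc n) < \<bar>B u s \<omega>\<bar> \<and> 0 < s" if "a \<le> s" "s \<le> b" for s
        using that a b by (intro e(2)) (auto simp: dist_real_def)
      have "\<omega> \<in> G a b"
        unfolding G_def off_zero_def using near elim(2) by (auto intro!: exI[of _ n] less_imp_le)
      moreover have "0 \<le> a" using near[of a] a b by simp
      moreover have "a < b" "?\<tau> \<le> b" using a b by auto
      ultimately show False using elim(1) a(1,3) b(1) by blast
    qed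
  qed
qed

text \<open>The induction runs over generations: once u is known to be born at 0, it splits at 0,
  and this places its children at 0.\<close>

lemma AE_birth_place:
  assumes \<beta>: "0 \<le> \<beta>"
  shows "AE \<omega> in M. birth_place B T u \<omega> = 0"
proof (induction u)
  case (Cons i u)
  show ?case
    using Cons AE_split_at_zero[OF Cons \<beta>] by eventually_elim simp
qed simp

text \<open>Lifespans are replaced one at a time, a longest label first: the environment of w
  contains the lifespans of all labels that do not descend from w, and no other label of
  \<open>J\<close> descends from it. The weights \<open>g\<close> are arbitrary so that each
  survival factor produced can be absorbed into them.\<close>

lemma expectation_lifespans:
  assumes \<beta>: "0 \<le> \<beta>" and "finite J" "finite K" "J \<subseteq> K"
    and g: "\<And>v. g v \<in> borel_measurable code_space" "\<And>v c. 0 \<le> g v c" "\<And>v c. g v c \<le> 1"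
  shows "(\<integral>\<omega>. (\<Prod>w\<in>J. indicator {t w<..} (T w \<omega>)) * (\<Prod>v\<in>K. g v (path_code (B v) \<omega>)) \<partial>M)
    = (\<integral>\<omega>. (\<Prod>w\<in>J. code_survival \<beta> (t w) (path_code (B w) \<omega>)) * (\<Prod>v\<in>K. g v (path_code (B v) \<omega>)) \<partial>M)"
  using assms(2,4) g
proof (induction "card J" arbitrary: J g)
  case 0
  then show ?case by simp
next
  case (Suc n)
  then have "J \<noteq> {}" by auto
  have "Max (length ` J) \<in> length ` J"
    using \<open>finite J\<close> \<open>J \<noteq> {}\<close> by (intro Max_in) auto
  then obtain w where w0: "w \<in> J" "length w = Max (length ` J)"
    by auto
  have w: "w \<in> J" "\<And>v. v \<in> J \<Longrightarrow> length v \<le> length w"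
    using w0 \<open>finite J\<close> by auto
  define J' where "J' = J - {w}"
  have J': "finite J'" "w \<notin> J'" "J = insert w J'" "J' \<subseteq> K" "card J' = n" "w \<in> K"
    using w Suc.prems Suc.hyps(2) by (auto simp: J'_def)
  have nsuf: "\<not> suffix w v" if "v \<in> J'" for v
  proof
    assume "suffix w v"
    moreover have "length v \<le> length w" "v \<noteq> w" using that w by (auto simp: J'_def)
    ultimately show False
      by (auto simp: suffix_def)
  qed
  note [measurable] = Suc.prems(3)
  define f where "f \<omega> = (\<Prod>w\<in>J'. indicator {t w<..} (T w \<omega>)) * (\<Prod>v\<in>K. g v (path_code (B v) \<omega>))" for \<omega>
  have f_env: "f \<in> borel_measurable (environment M B T w)"
  proof -
    have "(\<lambda>\<omega>. indicator {t v<..} (T v \<omega>)) \<in> borel_measurable (environment M B T w)" if "v \<in> J'" for v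
      by (rule measurable_compose[OF environment_T[OF nsuf[OF that]]]) measurable
    moreover have "(\<lambda>\<omega>. g v (path_code (B v) \<omega>)) \<in> borel_measurable (environment M B T w)" for v
      by (rule measurable_compose[OF environment_code]) (rule Suc.prems(3))
    ultimately show ?thesis
      unfolding f_def[abs_def] by (intro borel_measurable_times borel_measurable_prod) auto
  qed
  have f_bd: "\<bar>f \<omega>\<bar> \<le> 1" for \<omega>
  proof -
    have "0 \<le> (\<Prod>w\<in>J'. indicator {t w<..} (T w \<omega>) :: real)" "(\<Prod>w\<in>J'. indicator {t w<..} (T w \<omega>) :: real) \<le> 1"
      by (auto intro!: prod_nonneg prod_le_1)
    moreover have "0 \<le> (\<Prod>v\<in>K. g v (path_code (B v) \<omega>))" "(\<Prod>v\<in>K. g v (path_code (B v) \<omega>)) \<le> 1"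
      using Suc.prems(4,5) by (auto intro!: prod_nonneg prod_le_1)
    ultimately show ?thesis
      unfolding f_def abs_mult by (intro mult_le_one) auto
  qed
  \<comment> \<open>The survival factor of \<open>w\<close> is a function of its motion with values
    in [0, 1], so the modified weights are admissible in the induction hypothesis.\<close>
  define g' where "g' v c = (if v = w then g v c * code_survival \<beta> (t w) c else g v c)" for v c
  have g'_prod: "(\<Prod>v\<in>K. g' v (path_code (B v) \<omega>)) = (\<Prod>v\<in>K. g v (path_code (B v) \<omega>)) * code_survival \<beta> (t w) (path_code (B w) \<omega>)" for \<omega>
    using J'(6) \<open>finite K\<close> by (simp add: g'_def prod.remove[of K w] mult_ac cong: prod.cong) (auto intro!: prod.cong)
  have "(\<integral>\<omega>. (\<Prod>w\<in>J. indicator {t w<..} (T w \<omega>)) * (\<Prod>v\<in>K. g v (path_code (B v) \<omega>)) \<partial>M)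
    = (\<integral>\<omega>. f \<omega> * indicator {t w<..} (T w \<omega>) \<partial>M)"
    using J' by (intro Bochner_Integration.integral_cong) (simp_all add: f_def mult_ac)
  also have "\<dots> = (\<integral>\<omega>. f \<omega> * code_survival \<beta> (t w) (path_code (B w) \<omega>) \<partial>M)"
    by (rule integral_split[OF AE_birth_place[OF \<beta>] \<beta> f_env f_bd])
  also have "\<dots> = (\<integral>\<omega>. (\<Prod>w\<in>J'. indicator {t w<..} (T w \<omega>)) * (\<Prod>v\<in>K. g' v (path_code (B v) \<omega>)) \<partial>M)"
    by (simp add: f_def g'_prod mult_ac)
  also have "\<dots> = (\<integral>\<omega>. (\<Prod>w\<in>J'. code_survival \<beta> (t w) (path_code (B w) \<omega>)) * (\<Prod>v\<in>K. g' v (path_code (B v) \<omega>)) \<partial>M)"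
  proof (rule Suc.hyps(1))
    show "g' v \<in> borel_measurable code_space" for v
      unfolding g'_def[abs_def] using Suc.prems(3) by (cases "v = w") auto
    show "0 \<le> g' v c" "g' v c \<le> 1" for v c
      using Suc.prems(4,5) code_survival_bounds[OF \<beta>, of "t w" c] by (auto simp: g'_def intro!: mult_le_one)
  qed (use J' in auto)
  also have "\<dots> = (\<integral>\<omega>. (\<Prod>w\<in>J. code_survival \<beta> (t w) (path_code (B w) \<omega>)) * (\<Prod>v\<in>K. g v (path_code (B v) \<omega>)) \<partial>M)"
    using J' by (simp add: g'_prod mult_ac)
  finally show ?case .
qed

section \<open>Independence and common law of the pairs (motion, lifespan)\<close>

lemma indep_codes: "indep_vars (\<lambda>_. code_space) (\<lambda>u. path_code (B u)) UNIV"
proof -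
  have "indep_vars (\<lambda>_. code_space) (\<lambda>u \<omega>. (\<lambda>x j. x (dyadic j)) (\<lambda>a\<in>{0..}. B u a \<omega>)) UNIV"
    by (rule indep_vars_compose2[OF B_indep]) (auto intro!: measurable_PiM_single' measurable_component_singleton)
  then show ?thesis
    by (simp add: path_code_def[abs_def] fun_eq_iff cong: indep_vars_cong)
qed

definition particle :: "bool list \<Rightarrow> 'w \<Rightarrow> (nat \<times> nat \<Rightarrow> real) \<times> real" where
  "particle u \<omega> = (path_code (B u) \<omega>, T u \<omega>)"

abbreviation particle_space :: "((nat \<times> nat \<Rightarrow> real) \<times> real) measure" where
  "particle_space \<equiv> code_space \<Otimes>\<^sub>M borel"

lemma particle_measurable [measurable]: "particle u \<in> measurable M particle_space"
  unfolding particle_def[abs_def] by measurable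

text \<open>Once lifespans are replaced by survival factors, the integrand is a product of functions
  of single motions, and the motions are independent.\<close>

lemma prob_particles:
  assumes \<beta>: "0 \<le> \<beta>" and J: "finite J" and A: "\<And>u. A u \<in> sets code_space"
  shows "prob {\<omega> \<in> space M. \<forall>u\<in>J. path_code (B u) \<omega> \<in> A u \<and> t u < T u \<omega>}
    = (\<Prod>u\<in>J. \<integral>\<omega>. code_survival \<beta> (t u) (path_code (B u) \<omega>) * indicator (A u) (path_code (B u) \<omega>) \<partial>M)"
proof -
  note [measurable] = A
  define X where "X u \<omega> = code_survival \<beta> (t u) (path_code (B u) \<omega>) * indicator (A u) (path_code (B u) \<omega>)" for u \<omega>
  have "{\<omega> \<in> space M. \<forall>u\<in>J. path_code (B u) \<omega> \<in> A u \<and> t u < T u \<omega>} \<in> events"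
  proof (cases "J = {}")
    case False
    with J show ?thesis by (intro sets.sets_Collect_finite_All') auto
  qed simp
  then have "prob {\<omega> \<in> space M. \<forall>u\<in>J. path_code (B u) \<omega> \<in> A u \<and> t u < T u \<omega>}
    = (\<integral>\<omega>. indicator {\<omega> \<in> space M. \<forall>u\<in>J. path_code (B u) \<omega> \<in> A u \<and> t u < T u \<omega>} \<omega> \<partial>M)"
    by simp
  also have "\<dots> = (\<integral>\<omega>. (\<Prod>w\<in>J. indicator {t w<..} (T w \<omega>)) * (\<Prod>v\<in>J. indicator (A v) (path_code (B v) \<omega>)) \<partial>M)"
  proof (rule Bochner_Integration.integral_cong[OF refl])
    fix \<omega> assume "\<omega> \<in> space M"
    then show "indicator {\<omega> \<in> space M. \<forall>u\<in>J. path_code (B u) \<omega> \<in> A u \<and> t u < T u \<omega>} \<omega>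
      = (\<Prod>w\<in>J. indicator {t w<..} (T w \<omega>)) * (\<Prod>v\<in>J. indicator (A v) (path_code (B v) \<omega>) :: real)"
      using J unfolding prod.distrib[symmetric]
      by (cases "\<forall>u\<in>J. path_code (B u) \<omega> \<in> A u \<and> t u < T u \<omega>") (auto simp: indicator_def intro!: prod_zero[symmetric])
  qed
  also have "\<dots> = (\<integral>\<omega>. (\<Prod>w\<in>J. code_survival \<beta> (t w) (path_code (B w) \<omega>)) * (\<Prod>v\<in>J. indicator (A v) (path_code (B v) \<omega>)) \<partial>M)"
    by (rule expectation_lifespans[OF \<beta> J J]) auto
  also have "\<dots> = (\<integral>\<omega>. (\<Prod>u\<in>J. X u \<omega>) \<partial>M)"
    by (simp add: X_def prod.distrib)
  also have "\<dots> = (\<Prod>u\<in>J. \<integral>\<omega>. X u \<omega> \<partial>M)"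
  proof (rule indep_vars_lebesgue_integral[OF J])
    have "indep_vars (\<lambda>_. borel) (\<lambda>u \<omega>. (\<lambda>c. code_survival \<beta> (t u) c * indicator (A u) c) (path_code (B u) \<omega>)) UNIV"
      by (rule indep_vars_compose2[OF indep_codes]) measurable
    then show "indep_vars (\<lambda>_. borel) X J"
      unfolding X_def[abs_def] by (rule indep_vars_subset) auto
    show "integrable M (X u)" for u
      unfolding X_def[abs_def]
      by (rule integrable_bounded_real[where B = 1]) (use code_survival_bounds[OF \<beta>] in \<open>auto simp: indicator_def\<close>)
  qed
  finally show ?thesis by (simp add: X_def)
qed

text \<open>Events that put the motion into a set and the lifespan above a threshold are stable
  under intersection and generate the pair, and for them the product formula is already
  known.\<close>

lemma indep_particles:
  assumes \<beta>: "0 \<le> \<beta>"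
  shows "indep_vars (\<lambda>_. particle_space) particle UNIV"
proof -
  define E where "E u = {{\<omega> \<in> space M. path_code (B u) \<omega> \<in> A \<and> t < T u \<omega>} | A t. A \<in> sets code_space}" for u
  have E_events: "E u \<subseteq> events" for u
    by (auto simp: E_def)
  have "indep_sets E UNIV"
  proof (rule indep_setsI)
    fix X and J :: "bool list set"
    assume J: "finite J" "J \<noteq> {}" and X: "\<forall>u\<in>J. X u \<in> E u"
    have "\<exists>p. fst p \<in> sets code_space \<and> X u = {\<omega> \<in> space M. path_code (B u) \<omega> \<in> fst p \<and> snd p < T u \<omega>}" if u: "u \<in> J" for u
    proof -
      from X[rule_format, OF u] obtain A t where "A \<in> sets code_space" "X u = {\<omega> \<in> space M. path_code (B u) \<omega> \<in> A \<and> t < T u \<omega>}"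
        unfolding E_def by blast
      then show ?thesis by (intro exI[of _ "(A, t)"]) simp
    qed
    then have "\<forall>u\<in>J. \<exists>p. fst p \<in> sets code_space \<and> X u = {\<omega> \<in> space M. path_code (B u) \<omega> \<in> fst p \<and> snd p < T u \<omega>}"
      by blast
    from bchoice[OF this] obtain p where p: "\<And>u. u \<in> J \<Longrightarrow> fst (p u) \<in> sets code_space"
      "\<And>u. u \<in> J \<Longrightarrow> X u = {\<omega> \<in> space M. path_code (B u) \<omega> \<in> fst (p u) \<and> snd (p u) < T u \<omega>}"
      by blast
    define A where "A u = (if u \<in> J then fst (p u) else {})" for u
    have A: "A u \<in> sets code_space" for u using p by (simp add: A_def)
    have XA: "X u = {\<omega> \<in> space M. path_code (B u) \<omega> \<in> A u \<and> snd (p u) < T u \<omega>}" if "u \<in> J" for u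
      using p(2)[OF that] that by (simp add: A_def)
    have "(\<Inter>u\<in>J. X u) = {\<omega> \<in> space M. \<forall>u\<in>J. path_code (B u) \<omega> \<in> A u \<and> snd (p u) < T u \<omega>}"
      using J XA by auto
    then have "prob (\<Inter>u\<in>J. X u) = (\<Prod>u\<in>J. \<integral>\<omega>. code_survival \<beta> (snd (p u)) (path_code (B u) \<omega>) * indicator (A u) (path_code (B u) \<omega>) \<partial>M)"
      using prob_particles[OF \<beta> J(1) A, where t = "\<lambda>u. snd (p u)"] by simp
    also have "\<dots> = (\<Prod>u\<in>J. prob (X u))"
    proof (rule prod.cong[OF refl])
      fix u assume "u \<in> J"
      then show "(\<integral>\<omega>. code_survival \<beta> (snd (p u)) (path_code (B u) \<omega>) * indicator (A u) (path_code (B u) \<omega>) \<partial>M) = prob (X u)"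
        using prob_particles[OF \<beta>, where A = A and J = "{u}" and t = "\<lambda>u. snd (p u)"] A XA by simp
    qed
    finally show "prob (\<Inter>u\<in>J. X u) = (\<Prod>u\<in>J. prob (X u))" .
  qed (rule E_events)
  moreover have "Int_stable (E u)" for u
  proof (rule Int_stableI)
    fix a b assume "a \<in> E u" "b \<in> E u"
    then obtain A s A' s' where A: "A \<in> sets code_space" "A' \<in> sets code_space"
      and ab: "a = {\<omega> \<in> space M. path_code (B u) \<omega> \<in> A \<and> s < T u \<omega>}" "b = {\<omega> \<in> space M. path_code (B u) \<omega> \<in> A' \<and> s' < T u \<omega>}"
      by (auto simp: E_def)
    then have "a \<inter> b = {\<omega> \<in> space M. path_code (B u) \<omega> \<in> A \<inter> A' \<and> max s s' < T u \<omega>}"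
      by auto
    moreover have "A \<inter> A' \<in> sets code_space" using A by auto
    ultimately show "a \<inter> b \<in> E u"
      unfolding E_def by blast
  qed
  ultimately have ind: "indep_sets (\<lambda>u. sigma_sets (space M) (E u)) UNIV"
    by (intro indep_sets_sigma) auto
  have sub: "{particle u -` X \<inter> space M | X. X \<in> sets particle_space} \<subseteq> sigma_sets (space M) (E u)" for u
  proof -
    let ?S = "sigma (space M) (E u)"
    have ES: "E u \<subseteq> Pow (space M)" by (auto simp: E_def)
    have sets_S: "sets ?S = sigma_sets (space M) (E u)" and space_S: "space ?S = space M"
      using ES by (auto simp: sets_measure_of space_measure_of)
    have "path_code (B u) \<in> measurable ?S code_space"
    proof (rule measurableI)
      fix A assume A: "A \<in> sets code_space"
      \<comment> \<open>The threshold -1 lies below every lifespan, so the condition on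
        \<open>T u\<close> is void and the events of the motion are recovered.\<close>
      have "path_code (B u) -` A \<inter> space M = {\<omega> \<in> space M. path_code (B u) \<omega> \<in> A \<and> -1 < T u \<omega>}"
        using T_nonneg[of _ u] by (auto intro: less_le_trans[of _ 0])
      then show "path_code (B u) -` A \<inter> space ?S \<in> sets ?S"
        unfolding sets_S space_S using A by (auto simp: E_def intro!: sigma_sets.Basic)
    qed (simp add: space_PiM)
    moreover have "T u \<in> borel_measurable ?S"
      unfolding borel_measurable_iff_greater
    proof
      fix a
      have "{w \<in> space M. a < T u w} = {\<omega> \<in> space M. path_code (B u) \<omega> \<in> space code_space \<and> a < T u \<omega>}"
        by (auto simp: space_PiM)
      then show "{w \<in> space ?S. a < T u w} \<in> sets ?S"
        unfolding sets_S space_S by (auto simp: E_def intro!: sigma_sets.Basic)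
    qed
    ultimately have "particle u \<in> measurable ?S particle_space"
      unfolding particle_def[abs_def] by (rule measurable_Pair)
    then show ?thesis
      using measurable_sets[of "particle u" ?S particle_space] unfolding sets_S space_S by auto
  qed
  have "indep_sets (\<lambda>u. {particle u -` X \<inter> space M | X. X \<in> sets particle_space}) UNIV"
    by (rule indep_sets_mono_sets[OF ind sub])
  then show ?thesis
    unfolding indep_vars_def2 by simp
qed

text \<open>With the event for the motion fixed, what remains are finite measures for the lifespan
  on the line. Their masses on half-lines are integrals against the law of the code, which all
  Brownian motions share.\<close>

lemma particle_law:
  assumes \<beta>: "0 \<le> \<beta>"
  shows "distr M particle_space (particle u) = distr M particle_space (particle v)"
proof -
  have rect: "emeasure (distr M particle_space (particle u)) (A \<times> C) = emeasure (distr M particle_space (particle v)) (A \<times> C)"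
    if A [measurable]: "A \<in> sets code_space" and C: "C \<in> sets borel" for A C
  proof -
    define N where "N u = distr (density M (indicator (path_code (B u) -` A \<inter> space M))) borel (T u)" for u
    have [measurable]: "path_code (B u) -` A \<inter> space M \<in> events" for u by measurable
    have N: "emeasure (N u) D = emeasure M {\<omega> \<in> space M. path_code (B u) \<omega> \<in> A \<and> T u \<omega> \<in> D}" if [measurable]: "D \<in> sets borel" for D u
    proof -
      have "emeasure (N u) D = emeasure (density M (indicator (path_code (B u) -` A \<inter> space M))) (T u -` D \<inter> space M)"
        unfolding N_def by (subst emeasure_distr) auto
      also have "\<dots> = (\<integral>\<^sup>+\<omega>. indicator (path_code (B u) -` A \<inter> space M) \<omega> * indicator (T u -` D \<inter> space M) \<omega> \<partial>M)"
        by (rule emeasure_density) auto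
      also have "\<dots> = (\<integral>\<^sup>+\<omega>. indicator {\<omega> \<in> space M. path_code (B u) \<omega> \<in> A \<and> T u \<omega> \<in> D} \<omega> \<partial>M)"
        by (rule nn_integral_cong) (auto simp: indicator_def)
      finally show ?thesis by simp
    qed
    have key: "emeasure (N u) {x<..} = ennreal (\<integral>c. code_survival \<beta> x c * indicator A c \<partial>distr M code_space (path_code (B u)))" for u x
    proof -
      have "prob {\<omega> \<in> space M. path_code (B u) \<omega> \<in> A \<and> x < T u \<omega>} = (\<integral>\<omega>. code_survival \<beta> x (path_code (B u) \<omega>) * indicator A (path_code (B u) \<omega>) \<partial>M)"
        using prob_particles[OF \<beta>, where J = "{u}" and A = "\<lambda>_. A" and t = "\<lambda>_. x"] A by simp
      also have "\<dots> = (\<integral>c. code_survival \<beta> x c * indicator A c \<partial>distr M code_space (path_code (B u)))"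
        by (subst integral_distr) auto
      finally show ?thesis
        using N[of "{x<..}" u] by (simp add: emeasure_eq_measure)
    qed
    have "N u = N v"
    proof (rule measure_eqI_lessThan)
      show "emeasure (N u) {x<..} < \<infinity>" for x
        unfolding key by simp
      show "emeasure (N u) {x<..} = emeasure (N v) {x<..}" for x
        unfolding key path_code_law_unique[OF B_brownian B_brownian, of u v] ..
    qed (simp_all add: N_def)
    moreover have "emeasure (distr M particle_space (particle u)) (A \<times> C) = emeasure (N u) C" for u
      using C by (subst emeasure_distr) (auto simp: N particle_def intro!: arg_cong[where f = "emeasure M"])
    ultimately show ?thesis by simp
  qed
  let ?G = "{a \<times> b | a b. a \<in> sets code_space \<and> b \<in> sets (borel :: real measure)}"
  show ?thesis
  proof (rule measure_eqI_generator_eq[where E = ?G and \<Omega> = UNIV and A = "\<lambda>_. UNIV"])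
    show "Int_stable ?G" by (rule Int_stable_pair_measure_generator)
    show "sets (distr M particle_space (particle u)) = sigma_sets UNIV ?G"
      "sets (distr M particle_space (particle v)) = sigma_sets UNIV ?G"
      by (simp_all add: sets_pair_measure space_PiM)
    show "range (\<lambda>_::nat. UNIV) \<subseteq> ?G"
      using sets.top[of code_space] by (auto simp: space_PiM intro!: exI[of _ UNIV])
    show "emeasure (distr M particle_space (particle u)) UNIV \<noteq> \<infinity>" for i :: nat
    proof -
      interpret D: prob_space "distr M particle_space (particle u)" by (rule prob_space_distr) measurable
      show ?thesis by simp
    qed
  qed (use rect in auto)
qed

end

subsection \<open>Pairs of particles\<close>

text \<open>Turns the sum in \<open>particle_sum\<close> into an integral against counting measure,
  where Tonelli is available. Enumerating the countable type gives an increasing sequence of finite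
  sets, as monotone convergence needs in place of the directed family behind
  \<open>infsum\<close>.\<close>

lemma infsum_eq_nn_integral_count_space:
  fixes f :: "'a :: countable \<Rightarrow> ennreal"
  shows "infsum f A = (\<integral>\<^sup>+x. f x * indicator A x \<partial>count_space UNIV)"
proof (rule antisym)
  have fin: "(\<integral>\<^sup>+x. f x * indicator F x \<partial>count_space UNIV) = sum f F" if "finite F" for F
    using that by (simp add: nn_integral_count_space_indicator[symmetric] nn_integral_count_space_finite)
  have inf: "infsum f A = (SUP F\<in>{F. finite F \<and> F \<subseteq> A}. sum f F)"
    by (rule nonneg_infsum_complete) simp
  show "infsum f A \<le> (\<integral>\<^sup>+x. f x * indicator A x \<partial>count_space UNIV)"
    unfolding inf
  proof (rule SUP_least)
    fix F assume "F \<in> {F. finite F \<and> F \<subseteq> A}"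
    then have "sum f F = (\<integral>\<^sup>+x. f x * indicator F x \<partial>count_space UNIV)" and "F \<subseteq> A"
      by (auto simp: fin)
    then show "sum f F \<le> (\<integral>\<^sup>+x. f x * indicator A x \<partial>count_space UNIV)"
      by (auto intro!: nn_integral_mono mult_left_mono simp: indicator_def)
  qed
  define F where "F n = A \<inter> from_nat ` {..n}" for n :: nat
  have "(\<integral>\<^sup>+x. f x * indicator A x \<partial>count_space UNIV) = (\<integral>\<^sup>+x. (SUP n. f x * indicator (F n) x) \<partial>count_space UNIV)"
  proof (rule nn_integral_cong)
    fix x
    show "f x * indicator A x = (SUP n. f x * indicator (F n) x)"
    proof (cases "x \<in> A")
      case True
      then have "x \<in> F (to_nat x)"
        by (auto simp: F_def intro!: image_eqI[of _ _ "to_nat x"])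
      then have "f x \<le> (SUP n. f x * indicator (F n) x)"
        by (intro SUP_upper2[of "to_nat x"]) auto
      moreover have "(SUP n. f x * indicator (F n) x) \<le> f x"
        by (intro SUP_least) (auto simp: indicator_def)
      ultimately show ?thesis using True by simp
    qed (simp add: F_def)
  qed
  also have "\<dots> = (SUP n. \<integral>\<^sup>+x. f x * indicator (F n) x \<partial>count_space UNIV)"
    by (rule nn_integral_monotone_convergence_SUP)
      (auto simp: incseq_def le_fun_def F_def indicator_def intro!: mult_left_mono)
  also have "\<dots> \<le> infsum f A"
    unfolding inf
    by (intro SUP_least) (auto simp: fin F_def intro!: SUP_upper)
  finally show "(\<integral>\<^sup>+x. f x * indicator A x \<partial>count_space UNIV) \<le> infsum f A" .
qed

section \<open>Configurations and the last common ancestor\<close>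

type_synonym config = "bool list \<Rightarrow> (nat \<times> nat \<Rightarrow> real) \<times> real"

primrec config_birth :: "config \<Rightarrow> bool list \<Rightarrow> real" where
  "config_birth \<zeta> [] = 0"
| "config_birth \<zeta> (i # u) = config_birth \<zeta> u + snd (\<zeta> u)"

definition split_time :: "config \<Rightarrow> bool list \<Rightarrow> real" where
  "split_time \<zeta> u = config_birth \<zeta> u + snd (\<zeta> u)"

text \<open>With the youngest generation first, the descendants of z are the words that end in z,
  and \<open>v @ z\<close> is the one that has label v as seen from z.\<close>

definition subtree :: "bool list \<Rightarrow> config \<Rightarrow> config" where
  "subtree z \<zeta> v = \<zeta> (v @ z)"

text \<open>The birth place is left out: the particle is put at the value of its own motion, which
  almost surely is its position since birth places vanish.\<close>

definition contribution :: "(real \<Rightarrow> real) \<Rightarrow> config \<Rightarrow> bool list \<Rightarrow> real \<Rightarrow> ennreal" where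
  "contribution h \<zeta> u t = (if config_birth \<zeta> u \<le> t \<and> t < split_time \<zeta> u
     then ennreal (h (code_eval (fst (\<zeta> u)) (t - config_birth \<zeta> u))) else 0)"

definition config_sum :: "(real \<Rightarrow> real) \<Rightarrow> config \<Rightarrow> real \<Rightarrow> ennreal" where
  "config_sum h \<zeta> t = (\<integral>\<^sup>+u. contribution h \<zeta> u t \<partial>count_space UNIV)"

lemma config_birth_append: "config_birth \<zeta> (u @ z) = config_birth \<zeta> z + config_birth (subtree z \<zeta>) u"
  by (induction u) (simp_all add: subtree_def)

lemma split_time_append: "split_time \<zeta> (u @ z) = config_birth \<zeta> z + split_time (subtree z \<zeta>) u"
  by (simp add: split_time_def config_birth_append subtree_def)

text \<open>A child of w is born at the split time of w, so what lies below it is the same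
  functional of its subtree with the clock restarted at that time.\<close>

lemma contribution_append:
  "contribution h \<zeta> (u @ i # w) t = contribution h (subtree (i # w) \<zeta>) u (t - split_time \<zeta> w)"
proof -
  have "config_birth \<zeta> (i # w) = split_time \<zeta> w"
    by (simp add: split_time_def)
  then have "config_birth \<zeta> (u @ i # w) = split_time \<zeta> w + config_birth (subtree (i # w) \<zeta>) u"
    "split_time \<zeta> (u @ i # w) = split_time \<zeta> w + split_time (subtree (i # w) \<zeta>) u"
    using config_birth_append[of \<zeta> u "i # w"] split_time_append[of \<zeta> u "i # w"] by simp_all
  then show ?thesis
    by (simp add: contribution_def subtree_def diff_diff_eq le_diff_eq diff_less_eq add.commute cong: if_cong)
qed

lemma config_birth_nonneg: "(\<And>u. 0 \<le> snd (\<zeta> u)) \<Longrightarrow> 0 \<le> config_birth \<zeta> u"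
  by (induction u) auto

lemma contribution_neg: "(\<And>u. 0 \<le> snd (\<zeta> u)) \<Longrightarrow> t < 0 \<Longrightarrow> contribution h \<zeta> u t = 0"
  using config_birth_nonneg[of \<zeta> u] by (auto simp: contribution_def)

text \<open>A proper descendant is born no earlier than the split of its ancestor, and lifetimes are
  closed on the left and open on the right; the two are never alive together.\<close>

lemma contribution_ancestor:
  assumes "\<And>u. 0 \<le> snd (\<zeta> u)" "suffix u v" "u \<noteq> v"
  shows "contribution f \<zeta> u t * contribution g \<zeta> v t = 0"
proof -
  obtain v' i where v: "v = v' @ i # u"
    using assms(2,3) by (metis suffix_def append_Nil rev_exhaust append.assoc append_Cons)
  have "contribution g \<zeta> v t = 0" if "t < split_time \<zeta> u"
    unfolding v contribution_append using that assms(1) by (intro contribution_neg) (auto simp: subtree_def)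
  moreover have "contribution f \<zeta> u t = 0" if "\<not> t < split_time \<zeta> u"
    using that by (simp add: contribution_def)
  ultimately show ?thesis by (cases "t < split_time \<zeta> u") auto
qed

definition unrelated :: "(bool list \<times> bool list) set" where
  "unrelated = {(u, v). \<not> suffix u v \<and> \<not> suffix v u}"

text \<open>Two labels neither of which descends from the other have a last common ancestor w; the
  first lies below the child i # w, the second below the other child. Since i is part of the data,
  each ordered pair occurs exactly once.\<close>

lemma bij_betw_unrelated:
  "bij_betw (\<lambda>((w, i), (u, v)). (u @ i # w, v @ (\<not> i) # w)) UNIV unrelated"
  unfolding bij_betw_def
proof
  show "inj (\<lambda>((w, i), (u, v)). (u @ i # w, v @ (\<not> i) # w) :: bool list \<times> bool list)"
  proof (rule injI, clarsimp)
    fix w i u v w' i' u' v'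
    assume eq: "u @ i # w = u' @ i' # w'" "v @ (\<not> i) # w = v' @ (\<not> i') # w'"
    have aux: "length w' \<le> length w" if "u @ i # w = u' @ i' # w'" "v @ (\<not> i) # w = v' @ (\<not> i') # w'"
      for u v w i u' v' w' i'
    proof (rule ccontr)
      assume "\<not> length w' \<le> length w"
      \<comment> \<open>In both reversed words the letter at position \<open>length w\<close> then
        belongs to w', so it is the same one; yet the shorter factorization prescribes i there in
        the first word and its negation in the second.\<close>
      then have "length w < length w'" by simp
      from that(1) have "rev w @ i # rev u = rev w' @ i' # rev u'"
        by (metis rev_append rev.simps(2) append.assoc append_Cons append_Nil)
      then have "(rev w @ i # rev u) ! length w = (rev w' @ i' # rev u') ! length w" by simp
      then have 1: "rev w' ! length w = i"
        using \<open>length w < length w'\<close> by (simp add: nth_append)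
      from that(2) have "rev w @ (\<not> i) # rev v = rev w' @ (\<not> i') # rev v'"
        by (metis rev_append rev.simps(2) append.assoc append_Cons append_Nil)
      then have "(rev w @ (\<not> i) # rev v) ! length w = (rev w' @ (\<not> i') # rev v') ! length w" by simp
      then have 2: "rev w' ! length w = (\<not> i)"
        using \<open>length w < length w'\<close> by (simp add: nth_append)
      from 1 2 show False by simp
    qed
    have "length w = length w'"
      using aux[OF eq] aux[OF eq[symmetric]] by simp
    then show "w = w' \<and> i = i' \<and> u = u' \<and> v = v'"
      using eq by (auto simp: append_eq_append_conv)
  qed
  show "range (\<lambda>((w, i), (u, v)). (u @ i # w, v @ (\<not> i) # w)) = unrelated"
  proof (intro equalityI subsetI)
    fix p assume "p \<in> range (\<lambda>((w, i), (u, v)). (u @ i # w, v @ (\<not> i) # w) :: bool list \<times> bool list)"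
    then obtain w i u v where p: "p = (u @ i # w, v @ (\<not> i) # w)" by auto
    have aux: "\<not> suffix (u @ i # w) (v @ (\<not> i) # w)" for u v i
    proof
      assume "suffix (u @ i # w) (v @ (\<not> i) # w)"
      then obtain z where z: "v @ (\<not> i) # w = z @ u @ i # w"
        by (auto simp: suffix_def)
      then have "v @ [\<not> i] = (z @ u) @ [i]" by simp
      then show False by (cases i) (simp_all only: append1_eq_conv, simp_all)
    qed
    show "p \<in> unrelated"
      using aux[of u i v] aux[of v "\<not> i" u] by (auto simp: p unrelated_def)
  next
    fix p :: "bool list \<times> bool list" assume "p \<in> unrelated"
    then obtain u v where p: "p = (u, v)" "\<not> suffix u v" "\<not> suffix v u" by (auto simp: unrelated_def)
    \<comment> \<open>Reversal turns suffixes into prefixes, and incomparable words split at their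
      first differing letter.\<close>
    then have "rev u \<parallel> rev v"
      by (auto simp: suffix_to_prefix parallel_def)
    from parallel_decomp[OF this] obtain as b bs c cs where d: "b \<noteq> c" "rev u = as @ b # bs" "rev v = as @ c # cs"
      by (elim exE conjE) (rule that)
    have "u = rev bs @ b # rev as" "v = rev cs @ c # rev as"
      using d(2,3) by (simp_all add: rev_swap)
    moreover have "c = (\<not> b)" using d(1) by auto
    ultimately have "p = (\<lambda>((w, i), (u, v)). (u @ i # w, v @ (\<not> i) # w)) ((rev as, b), (rev bs, rev cs))"
      using p by simp
    then show "p \<in> range (\<lambda>((w, i), (u, v)). (u @ i # w, v @ (\<not> i) # w))"
      by (rule range_eqI)
  qed
qed

text \<open>Among the pairs of labels the diagonal gives the sum for f g, pairs of an ancestor and a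
  descendant contribute 0, and the unrelated ones are sorted by last common ancestor
  \<open>w\<close> and by the child through which the first of them descends. Both values of
  \<open>i\<close> occur, which is the origin of the factor 2 in the theorem.\<close>

lemma config_sum_mult:
  assumes nn: "\<And>u. 0 \<le> snd (\<zeta> u)" and fg: "\<And>x. 0 \<le> f x" "\<And>x. 0 \<le> g x"
  shows "config_sum f \<zeta> t * config_sum g \<zeta> t = config_sum (\<lambda>x. f x * g x) \<zeta> t +
    (\<integral>\<^sup>+w. \<integral>\<^sup>+i. config_sum f (subtree (i # w) \<zeta>) (t - split_time \<zeta> w) *
       config_sum g (subtree ((\<not> i) # w) \<zeta>) (t - split_time \<zeta> w) \<partial>count_space UNIV \<partial>count_space UNIV)"
proof -
  define \<Phi> :: "(bool list \<times> bool) \<times> (bool list \<times> bool list) \<Rightarrow> bool list \<times> bool list"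
    where "\<Phi> = (\<lambda>((w, i), (u, v)). (u @ i # w, v @ (\<not> i) # w))"
  have \<Phi>: "bij_betw \<Phi> UNIV unrelated"
    unfolding \<Phi>_def by (rule bij_betw_unrelated)
  define c where "c p = contribution f \<zeta> (fst p) t * contribution g \<zeta> (snd p) t" for p
  have prod: "config_sum f \<zeta>1 s * config_sum g \<zeta>2 s = (\<integral>\<^sup>+p. contribution f \<zeta>1 (fst p) s * contribution g \<zeta>2 (snd p) s \<partial>count_space UNIV)" for \<zeta>1 \<zeta>2 s
    by (simp add: config_sum_def nn_integral_fst_count_space[symmetric] nn_integral_cmult nn_integral_multc)
  have split: "c p = c p * indicator (range (\<lambda>u. (u, u))) p + c p * indicator unrelated p" for p
  proof (cases p)
    case (Pair u v)
    show ?thesis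
    proof (cases "u = v")
      case True
      then show ?thesis by (simp add: Pair unrelated_def)
    next
      case ne: False
      show ?thesis
      proof (cases "suffix u v \<or> suffix v u")
        case True
        then have "c p = 0"
          using contribution_ancestor[where \<zeta> = \<zeta>, OF nn, where u = u and v = v and f = f and g = g and t = t] contribution_ancestor[where \<zeta> = \<zeta>, OF nn, where u = v and v = u and f = g and g = f and t = t] ne
          by (auto simp: c_def Pair mult.commute)
        then show ?thesis by simp
      next
        case False
        then show ?thesis using ne by (auto simp: Pair unrelated_def indicator_def)
      qed
    qed
  qed
  have diag: "bij_betw (\<lambda>u. (u, u)) UNIV (range (\<lambda>u :: bool list. (u, u)))"
    by (auto simp: bij_betw_def inj_on_def)
  have "config_sum f \<zeta> t * config_sum g \<zeta> t = (\<integral>\<^sup>+p. c p \<partial>count_space UNIV)"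
    by (simp add: prod c_def)
  also have "\<dots> = (\<integral>\<^sup>+p. c p * indicator (range (\<lambda>u. (u, u))) p + c p * indicator unrelated p \<partial>count_space UNIV)"
    by (rule nn_integral_cong) (rule split)
  also have "\<dots> = (\<integral>\<^sup>+p. c p \<partial>count_space (range (\<lambda>u. (u, u)))) + (\<integral>\<^sup>+p. c p \<partial>count_space unrelated)"
    by (simp add: nn_integral_add nn_integral_count_space_indicator)
  also have "(\<integral>\<^sup>+p. c p \<partial>count_space (range (\<lambda>u. (u, u)))) = config_sum (\<lambda>x. f x * g x) \<zeta> t"
    unfolding nn_integral_bij_count_space[OF diag, symmetric] config_sum_def
    using fg by (intro nn_integral_cong) (auto simp: c_def contribution_def ennreal_mult)
  also have "(\<integral>\<^sup>+p. c p \<partial>count_space unrelated) = (\<integral>\<^sup>+q. c (\<Phi> q) \<partial>count_space UNIV)"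
    by (rule nn_integral_bij_count_space[OF \<Phi>, symmetric])
  also have "\<dots> = (\<integral>\<^sup>+wi. \<integral>\<^sup>+uv. c (\<Phi> (wi, uv)) \<partial>count_space UNIV \<partial>count_space UNIV)"
    by (rule nn_integral_fst_count_space[symmetric])
  also have "\<dots> = (\<integral>\<^sup>+w. \<integral>\<^sup>+i. \<integral>\<^sup>+uv. c (\<Phi> ((w, i), uv)) \<partial>count_space UNIV \<partial>count_space UNIV \<partial>count_space UNIV)"
    by (rule nn_integral_fst_count_space[symmetric])
  also have "\<dots> = (\<integral>\<^sup>+w. \<integral>\<^sup>+i. config_sum f (subtree (i # w) \<zeta>) (t - split_time \<zeta> w) *
       config_sum g (subtree ((\<not> i) # w) \<zeta>) (t - split_time \<zeta> w) \<partial>count_space UNIV \<partial>count_space UNIV)"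
    by (intro nn_integral_cong) (simp add: prod c_def \<Phi>_def case_prod_unfold contribution_append)
  finally show ?thesis .
qed

abbreviation config_space :: "config measure" where
  "config_space \<equiv> PiM UNIV (\<lambda>_. code_space \<Otimes>\<^sub>M borel)"

lemma measurable_config_birth [measurable]: "(\<lambda>\<zeta>. config_birth \<zeta> u) \<in> borel_measurable config_space"
  by (induction u) (simp_all, measurable)

lemma measurable_split_time [measurable]: "(\<lambda>\<zeta>. split_time \<zeta> u) \<in> borel_measurable config_space"
  unfolding split_time_def by measurable

lemma measurable_contribution [measurable]:
  assumes [measurable]: "h \<in> borel_measurable borel"
  shows "(\<lambda>p. contribution h (fst p) u (snd p)) \<in> borel_measurable (config_space \<Otimes>\<^sub>M borel)"
  unfolding contribution_def by measurable

lemma measurable_config_sum: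
  assumes [measurable]: "h \<in> borel_measurable borel"
  shows "(\<lambda>p. config_sum h (fst p) (snd p)) \<in> borel_measurable (config_space \<Otimes>\<^sub>M borel)"
proof -
  interpret sigma_finite_measure "count_space (UNIV :: bool list set)"
    by (rule sigma_finite_measure_count_space)
  have "(\<lambda>q. contribution h (fst (snd q)) (fst q) (snd (snd q))) \<in> borel_measurable (count_space UNIV \<Otimes>\<^sub>M (config_space \<Otimes>\<^sub>M borel))"
    by (rule measurable_pair_measure_countable1) auto
  from measurable_compose[OF _ this, of "\<lambda>q. (snd q, fst q)" "(config_space \<Otimes>\<^sub>M borel) \<Otimes>\<^sub>M count_space UNIV"]
  have "(\<lambda>q. contribution h (fst (fst q)) (snd q) (snd (fst q))) \<in> borel_measurable ((config_space \<Otimes>\<^sub>M borel) \<Otimes>\<^sub>M count_space UNIV)"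
    by simp
  then show ?thesis
    unfolding config_sum_def by (intro borel_measurable_nn_integral) (simp add: case_prod_unfold)
qed

lemma measurable_config_sum' [measurable (raw)]:
  assumes "h \<in> borel_measurable borel" "f \<in> measurable N config_space" "g \<in> borel_measurable N"
  shows "(\<lambda>x. config_sum h (f x) (g x)) \<in> borel_measurable N"
  using measurable_compose[OF measurable_Pair[OF assms(2,3)] measurable_config_sum[OF assms(1)]] by simp

lemma measurable_subtree [measurable]: "subtree z \<in> measurable config_space config_space"
  unfolding subtree_def[abs_def] by (rule measurable_PiM_single') (auto simp: space_PiM space_pair_measure)

lemma nn_integral_count_space_length:
  fixes f :: "nat \<Rightarrow> ennreal"
  shows "(\<integral>\<^sup>+w. f (length w) \<partial>count_space (UNIV :: bool list set)) = (\<Sum>k. 2 ^ k * f k)"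
proof -
  have "(\<integral>\<^sup>+w. f (length w) \<partial>count_space (UNIV :: bool list set)) = (\<integral>\<^sup>+(w :: bool list). \<integral>\<^sup>+k. f k * indicator {w. length w = k} w \<partial>count_space UNIV \<partial>count_space UNIV)"
  proof (rule nn_integral_cong)
    fix w :: "bool list"
    have "(\<integral>\<^sup>+k. f k * indicator {w. length w = k} w \<partial>count_space UNIV) = (\<integral>\<^sup>+k. f k * indicator {length w} k \<partial>count_space UNIV)"
      by (intro nn_integral_cong) (auto simp: indicator_def)
    then show "f (length w) = (\<integral>\<^sup>+k. f k * indicator {w. length w = k} w \<partial>count_space UNIV)"
      by (simp add: nn_integral_count_space_indicator[symmetric] nn_integral_count_space_finite)
  qed
  also have "\<dots> = (\<integral>\<^sup>+k. \<integral>\<^sup>+(w :: bool list). f k * indicator {w. length w = k} w \<partial>count_space UNIV \<partial>count_space UNIV)"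
    by (rule nn_integral_count_space_nn_integral) auto
  also have "\<dots> = (\<Sum>k. \<integral>\<^sup>+(w :: bool list). f k * indicator {w. length w = k} w \<partial>count_space UNIV)"
    by (rule nn_integral_count_space_nat)
  also have "\<dots> = (\<Sum>k. 2 ^ k * f k)"
  proof (intro arg_cong[where f = suminf] ext)
    fix k
    have fin: "finite {w :: bool list. length w = k}" and card: "card {w :: bool list. length w = k} = 2 ^ k"
      using finite_lists_length_eq[of "UNIV :: bool set" k] card_lists_length_eq[of "UNIV :: bool set" k] by simp_all
    have "(\<integral>\<^sup>+w. f k * indicator {w :: bool list. length w = k} w \<partial>count_space UNIV) = f k * of_nat (card {w :: bool list. length w = k})"
      using fin by (simp add: nn_integral_cmult)
    then show "(\<integral>\<^sup>+w. f k * indicator {w :: bool list. length w = k} w \<partial>count_space UNIV) = 2 ^ k * f k"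
      by (simp add: card mult.commute)
  qed
  finally show ?thesis .
qed

lemma (in prob_space) nn_integral_indep_var:
  assumes ind: "indep_var S X N Y" and [measurable]: "F \<in> borel_measurable (S \<Otimes>\<^sub>M N)"
  shows "(\<integral>\<^sup>+\<omega>. F (X \<omega>, Y \<omega>) \<partial>M) = (\<integral>\<^sup>+\<omega>. \<integral>\<^sup>+\<omega>'. F (X \<omega>, Y \<omega>') \<partial>M \<partial>M)"
proof -
  have [measurable]: "X \<in> measurable M S" "Y \<in> measurable M N"
    using indep_var_rv1[OF ind] indep_var_rv2[OF ind] by auto
  interpret D: prob_space "distr M N Y" by (rule prob_space_distr) measurable
  have "(\<integral>\<^sup>+\<omega>. F (X \<omega>, Y \<omega>) \<partial>M) = (\<integral>\<^sup>+p. F p \<partial>distr M (S \<Otimes>\<^sub>M N) (\<lambda>\<omega>. (X \<omega>, Y \<omega>)))"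
    by (subst nn_integral_distr) auto
  also have "distr M (S \<Otimes>\<^sub>M N) (\<lambda>\<omega>. (X \<omega>, Y \<omega>)) = distr M S X \<Otimes>\<^sub>M distr M N Y"
    using ind by (simp add: indep_var_distribution_eq)
  also have "(\<integral>\<^sup>+p. F p \<partial>(distr M S X \<Otimes>\<^sub>M distr M N Y)) = (\<integral>\<^sup>+x. \<integral>\<^sup>+y. F (x, y) \<partial>distr M N Y \<partial>distr M S X)"
    by (subst D.nn_integral_fst[symmetric]) (auto cong: measurable_cong_sets)
  also have "\<dots> = (\<integral>\<^sup>+x. \<integral>\<^sup>+\<omega>'. F (x, Y \<omega>') \<partial>M \<partial>distr M S X)"
    by (intro nn_integral_cong nn_integral_distr) auto
  also have "\<dots> = (\<integral>\<^sup>+\<omega>. \<integral>\<^sup>+\<omega>'. F (X \<omega>, Y \<omega>') \<partial>M \<partial>M)"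
    by (subst nn_integral_distr) auto
  finally show ?thesis .
qed

lemma split_time_cong:
  assumes "\<And>v. suffix v u \<Longrightarrow> \<zeta> v = \<zeta>' v"
  shows "split_time \<zeta> u = split_time \<zeta>' u"
proof -
  have "config_birth \<zeta> w = config_birth \<zeta>' w" if "suffix w u" for w
    using that
  proof (induction w)
    case (Cons i w)
    then have "suffix w u" by (auto simp: suffix_def)
    with Cons show ?case using assms[of w] by simp
  qed simp
  then show ?thesis
    using assms[of u] by (simp add: split_time_def)
qed

section \<open>The branching property\<close>

context catalytic_bbm
begin

definition config :: "'w \<Rightarrow> config" where
  "config \<omega> u = particle u \<omega>"

lemma config_measurable [measurable]: "config \<in> measurable M (PiM UNIV (\<lambda>_. particle_space))"
  unfolding config_def[abs_def] by (rule measurable_PiM_single') (auto simp: space_PiM space_pair_measure)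

lemma snd_config: "snd (config \<omega> u) = T u \<omega>"
  by (simp add: config_def particle_def)

lemma config_nonneg: "\<omega> \<in> space M \<Longrightarrow> 0 \<le> snd (config \<omega> u)"
  by (simp add: snd_config T_nonneg)

lemma config_birth_config: "config_birth (config \<omega>) u = birth_time T u \<omega>"
  by (induction u) (simp_all add: snd_config)

lemma particle_sum_eq:
  assumes "\<omega> \<in> space M" "\<And>u. birth_place B T u \<omega> = 0"
  shows "particle_sum B T h t \<omega> = config_sum h (config \<omega>) t"
proof -
  have "particle_sum B T h t \<omega> = (\<integral>\<^sup>+u. ennreal (h (position B T u t \<omega>)) * indicator (alive T t \<omega>) u \<partial>count_space UNIV)"
    unfolding particle_sum_def by (rule infsum_eq_nn_integral_count_space)
  also have "\<dots> = config_sum h (config \<omega>) t"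
    unfolding config_sum_def
  proof (rule nn_integral_cong)
    fix u
    interpret W: std_brownian_motion M "B u" by (rule B_brownian)
    show "ennreal (h (position B T u t \<omega>)) * indicator (alive T t \<omega>) u = contribution h (config \<omega>) u t"
      using assms(2)[of u] W.code_eval_W[OF assms(1), of "t - birth_time T u \<omega>"]
      by (auto simp: contribution_def alive_def split_time_def config_birth_config snd_config position_def path_def config_def particle_def)
  qed
  finally show ?thesis .
qed

definition mean_config_sum :: "(real \<Rightarrow> real) \<Rightarrow> real \<Rightarrow> ennreal" where
  "mean_config_sum h t = (\<integral>\<^sup>+\<omega>. config_sum h (config \<omega>) t \<partial>M)"

lemma measurable_mean_config_sum [measurable]:
  assumes [measurable]: "h \<in> borel_measurable borel"
  shows "mean_config_sum h \<in> borel_measurable borel"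
  unfolding mean_config_sum_def[abs_def] by measurable

lemma AE_particle_sum:
  assumes "0 \<le> \<beta>"
  shows "AE \<omega> in M. \<forall>h t. particle_sum B T h t \<omega> = config_sum h (config \<omega>) t"
proof -
  have "AE \<omega> in M. \<forall>u. birth_place B T u \<omega> = 0"
    by (subst AE_all_countable) (intro allI AE_birth_place assms)
  then show ?thesis
    using AE_space by eventually_elim (auto simp: particle_sum_eq)
qed

lemma mean_sum_eq: "0 \<le> \<beta> \<Longrightarrow> mean_sum M B T h t = mean_config_sum h t"
  unfolding mean_sum_def mean_config_sum_def
  by (intro nn_integral_cong_AE eventually_mono[OF AE_particle_sum]) auto

lemma mean_config_sum_neg: "t < 0 \<Longrightarrow> mean_config_sum h t = 0"
  unfolding mean_config_sum_def config_sum_def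
  by (simp add: contribution_neg config_nonneg cong: nn_integral_cong)

lemma config_law:
  assumes "0 \<le> \<beta>"
  shows "distr M (PiM UNIV (\<lambda>_. particle_space)) config = PiM UNIV (\<lambda>_. distr M particle_space (particle []))"
proof -
  have "distr M (PiM UNIV (\<lambda>_. particle_space)) config = distr M (PiM UNIV (\<lambda>_. particle_space)) (\<lambda>\<omega>. \<lambda>u\<in>UNIV. particle u \<omega>)"
    by (simp add: config_def[abs_def] restrict_def)
  also have "\<dots> = PiM UNIV (\<lambda>u. distr M particle_space (particle u))"
    using indep_particles[OF assms] by (subst (asm) indep_vars_iff_distr_eq_PiM') auto
  also have "\<dots> = PiM UNIV (\<lambda>_. distr M particle_space (particle []))"
    using particle_law[OF assms] by (intro PiM_cong) auto
  finally show ?thesis .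
qed

text \<open>An i.i.d. family read along the injection from v to \<open>v @ z\<close> is an i.i.d.
  family with the same law.\<close>

lemma subtree_law:
  assumes "0 \<le> \<beta>"
  shows "distr M (PiM UNIV (\<lambda>_. particle_space)) (\<lambda>\<omega>. subtree z (config \<omega>)) = distr M (PiM UNIV (\<lambda>_. particle_space)) config"
proof -
  let ?R = "distr M particle_space (particle [])"
  have "distr M (PiM UNIV (\<lambda>_. particle_space)) (\<lambda>\<omega>. subtree z (config \<omega>)) = distr (distr M (PiM UNIV (\<lambda>_. particle_space)) config) (PiM UNIV (\<lambda>_. particle_space)) (subtree z)"
    by (subst distr_distr) (auto simp: comp_def)
  also have "\<dots> = distr (PiM UNIV (\<lambda>_. ?R)) (PiM UNIV (\<lambda>_. ?R)) (\<lambda>\<zeta>. \<lambda>v\<in>UNIV. \<zeta> (v @ z))"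
    unfolding config_law[OF assms] by (rule distr_cong) (auto simp: subtree_def fun_eq_iff intro!: sets_PiM_cong)
  also have "\<dots> = PiM UNIV (\<lambda>_. ?R)"
    by (rule distr_PiM_reindex) (auto intro!: prob_space_distr inj_onI)
  finally show ?thesis
    by (simp add: config_law[OF assms])
qed

lemma mean_subtree:
  assumes "0 \<le> \<beta>" and [measurable]: "h \<in> borel_measurable borel"
  shows "(\<integral>\<^sup>+\<omega>. config_sum h (subtree z (config \<omega>)) t \<partial>M) = mean_config_sum h t"
proof -
  let ?P = "PiM UNIV (\<lambda>_::bool list. particle_space)"
  have "(\<integral>\<^sup>+\<omega>. config_sum h (subtree z (config \<omega>)) t \<partial>M) = (\<integral>\<^sup>+\<zeta>. config_sum h \<zeta> t \<partial>distr M ?P (\<lambda>\<omega>. subtree z (config \<omega>)))"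
    by (subst nn_integral_distr) auto
  also have "\<dots> = mean_config_sum h t"
    unfolding subtree_law[OF assms(1)] mean_config_sum_def by (subst nn_integral_distr) auto
  finally show ?thesis .
qed

lemma indep_restrict_particles:
  assumes "0 \<le> \<beta>" "K \<inter> L = {}"
  shows "indep_var (PiM K (\<lambda>_. particle_space)) (\<lambda>\<omega>. \<lambda>u\<in>K. particle u \<omega>) (PiM L (\<lambda>_. particle_space)) (\<lambda>\<omega>. \<lambda>u\<in>L. particle u \<omega>)"
  by (rule indep_var_restrict[OF indep_particles[OF assms(1)] assms(2)]) auto

lemma measurable_extension:
  assumes "z \<in> space N"
  shows "(\<lambda>\<zeta> u. if u \<in> K then \<zeta> u else z) \<in> measurable (PiM K (\<lambda>_. N)) (PiM UNIV (\<lambda>_. N))"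
proof (rule measurable_PiM_single')
  fix u
  show "(\<lambda>\<zeta>. if u \<in> K then \<zeta> u else z) \<in> measurable (PiM K (\<lambda>_. N)) N"
    using assms by (cases "u \<in> K") auto
next
  show "(\<lambda>\<zeta> u. if u \<in> K then \<zeta> u else z) \<in> space (PiM K (\<lambda>_. N)) \<rightarrow> (\<Pi>\<^sub>E i\<in>UNIV. space N)"
    using assms by (auto simp: space_PiM PiE_iff)
qed

text \<open>Disjoint sets of labels carry independent data, so the second argument may be drawn
  afresh. The restricted families are filled up to full configurations with a fixed value, which
  leaves \<open>F\<close> unchanged by the dependence hypothesis.\<close>

lemma nn_integral_disjoint:
  fixes X Y :: "config \<Rightarrow> 'c"
  assumes \<beta>: "0 \<le> \<beta>" and disj: "K \<inter> L = {}"
    and F [measurable]: "F \<in> borel_measurable (PiM UNIV (\<lambda>_. particle_space) \<Otimes>\<^sub>M PiM UNIV (\<lambda>_. particle_space))"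
    and dep: "\<And>\<zeta> \<zeta>' \<xi> \<xi>'. (\<And>u. u \<in> K \<Longrightarrow> \<zeta> u = \<zeta>' u) \<Longrightarrow> (\<And>u. u \<in> L \<Longrightarrow> \<xi> u = \<xi>' u) \<Longrightarrow> F (\<zeta>, \<xi>) = F (\<zeta>', \<xi>')"
  shows "(\<integral>\<^sup>+\<omega>. F (config \<omega>, config \<omega>) \<partial>M) = (\<integral>\<^sup>+\<omega>. \<integral>\<^sup>+\<omega>'. F (config \<omega>, config \<omega>') \<partial>M \<partial>M)"
proof -
  define z where "z = (\<lambda>_::nat \<times> nat. 0::real, 0::real)"
  have z: "z \<in> space particle_space" by (simp add: space_pair_measure space_PiM)
  define e where "e K \<zeta> u = (if u \<in> K then \<zeta> u else z)" for K and \<zeta> :: config and u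
  have [measurable]: "e K \<in> measurable (PiM K (\<lambda>_. particle_space)) (PiM UNIV (\<lambda>_. particle_space))" for K
    unfolding e_def[abs_def] by (rule measurable_extension[OF z])
  let ?X = "\<lambda>\<omega>. \<lambda>u\<in>K. particle u \<omega>" and ?Y = "\<lambda>\<omega>. \<lambda>u\<in>L. particle u \<omega>"
  have eq: "F (config \<omega>, config \<omega>') = F (e K (?X \<omega>), e L (?Y \<omega>'))" for \<omega> \<omega>'
    by (rule dep) (auto simp: e_def config_def)
  have "(\<integral>\<^sup>+\<omega>. (\<lambda>p. F (e K (fst p), e L (snd p))) (?X \<omega>, ?Y \<omega>) \<partial>M) = (\<integral>\<^sup>+\<omega>. \<integral>\<^sup>+\<omega>'. (\<lambda>p. F (e K (fst p), e L (snd p))) (?X \<omega>, ?Y \<omega>') \<partial>M \<partial>M)"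
    by (rule nn_integral_indep_var[OF indep_restrict_particles[OF \<beta> disj]]) measurable
  then show ?thesis by (simp add: eq)
qed

text \<open>Independence is used twice: the split time of w involves w and its ancestors only, hence
  no label of its children's subtrees, and these two subtrees have no label in common. Each of them
  has the law of the full process.\<close>

lemma expectation_pair:
  assumes \<beta>: "0 \<le> \<beta>" and [measurable]: "f \<in> borel_measurable borel" "g \<in> borel_measurable borel"
  shows "(\<integral>\<^sup>+\<omega>. config_sum f (subtree (i # w) (config \<omega>)) (t - split_time (config \<omega>) w) *
      config_sum g (subtree ((\<not> i) # w) (config \<omega>)) (t - split_time (config \<omega>) w) \<partial>M)
    = (\<integral>\<^sup>+\<omega>. mean_config_sum f (t - split_time (config \<omega>) w) * mean_config_sum g (t - split_time (config \<omega>) w) \<partial>M)"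
proof -
  let ?z = "i # w" and ?z' = "(\<not> i) # w"
  have sub: "subtree z \<zeta> = subtree z \<xi>" if "\<And>u. suffix z u \<Longrightarrow> \<zeta> u = \<xi> u" for z \<zeta> \<xi>
    using that by (auto simp: subtree_def fun_eq_iff suffix_def)
  have d1: "{v. suffix v w} \<inter> {v. suffix ?z v \<or> suffix ?z' v} = {}"
    by (auto simp: suffix_def)
  have d2: "{v. suffix ?z v} \<inter> {v. suffix ?z' v} = {}"
  proof -
    have False if "suffix ?z v" "suffix ?z' v" for v
    proof -
      from that obtain a b where "a @ i # w = b @ (\<not> i) # w" by (auto simp: suffix_def)
      then have "a @ [i] = b @ [\<not> i]" by simp
      then show False by (cases i) (simp_all only: append1_eq_conv, simp_all)
    qed
    then show ?thesis by blast
  qed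
  let ?F = "\<lambda>p. config_sum f (subtree ?z (snd p)) (t - split_time (fst p) w) * config_sum g (subtree ?z' (snd p)) (t - split_time (fst p) w)"
  have "(\<integral>\<^sup>+\<omega>. ?F (config \<omega>, config \<omega>) \<partial>M) = (\<integral>\<^sup>+\<omega>. \<integral>\<^sup>+\<omega>'. ?F (config \<omega>, config \<omega>') \<partial>M \<partial>M)"
  proof (rule nn_integral_disjoint[OF \<beta> d1])
    show "?F \<in> borel_measurable (PiM UNIV (\<lambda>_. particle_space) \<Otimes>\<^sub>M PiM UNIV (\<lambda>_. particle_space))"
      by measurable
    fix \<zeta> \<zeta>' \<xi> \<xi>' :: config
    assume 1: "\<And>u. u \<in> {v. suffix v w} \<Longrightarrow> \<zeta> u = \<zeta>' u" and 2: "\<And>u. u \<in> {v. suffix ?z v \<or> suffix ?z' v} \<Longrightarrow> \<xi> u = \<xi>' u"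
    have "split_time \<zeta> w = split_time \<zeta>' w" "subtree ?z \<xi> = subtree ?z \<xi>'" "subtree ?z' \<xi> = subtree ?z' \<xi>'"
      using 1 2 by (auto intro!: split_time_cong sub)
    then show "?F (\<zeta>, \<xi>) = ?F (\<zeta>', \<xi>')" by simp
  qed
  also have "\<dots> = (\<integral>\<^sup>+\<omega>. mean_config_sum f (t - split_time (config \<omega>) w) * mean_config_sum g (t - split_time (config \<omega>) w) \<partial>M)"
  proof (rule nn_integral_cong)
    fix \<omega>
    define a where "a = t - split_time (config \<omega>) w"
    let ?G = "\<lambda>p. config_sum f (subtree ?z (fst p)) a * config_sum g (subtree ?z' (snd p)) a"
    have "(\<integral>\<^sup>+\<omega>'. ?G (config \<omega>', config \<omega>') \<partial>M) = (\<integral>\<^sup>+\<omega>'. \<integral>\<^sup>+\<omega>''. ?G (config \<omega>', config \<omega>'') \<partial>M \<partial>M)"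
    proof (rule nn_integral_disjoint[OF \<beta> d2])
      show "?G \<in> borel_measurable (PiM UNIV (\<lambda>_. particle_space) \<Otimes>\<^sub>M PiM UNIV (\<lambda>_. particle_space))"
        by measurable
      fix \<zeta> \<zeta>' \<xi> \<xi>' :: config
      assume "\<And>u. u \<in> {v. suffix ?z v} \<Longrightarrow> \<zeta> u = \<zeta>' u" "\<And>u. u \<in> {v. suffix ?z' v} \<Longrightarrow> \<xi> u = \<xi>' u"
      then have "subtree ?z \<zeta> = subtree ?z \<zeta>'" "subtree ?z' \<xi> = subtree ?z' \<xi>'"
        by (auto intro!: sub)
      then show "?G (\<zeta>, \<xi>) = ?G (\<zeta>', \<xi>')" by simp
    qed
    also have "\<dots> = (\<integral>\<^sup>+\<omega>'. config_sum f (subtree ?z (config \<omega>')) a \<partial>M) * (\<integral>\<^sup>+\<omega>''. config_sum g (subtree ?z' (config \<omega>'')) a \<partial>M)"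
      by (simp add: nn_integral_cmult nn_integral_multc)
    also have "\<dots> = mean_config_sum f a * mean_config_sum g a"
      by (simp add: mean_subtree \<beta>)
    finally show "(\<integral>\<^sup>+\<omega>'. ?F (config \<omega>, config \<omega>') \<partial>M) = mean_config_sum f (t - split_time (config \<omega>) w) * mean_config_sum g (t - split_time (config \<omega>) w)"
      by (simp add: a_def)
  qed
  finally show ?thesis by simp
qed

section \<open>The intensity measure of the split times\<close>

definition lifespan_law :: "real measure" where
  "lifespan_law = distr M borel (T [])"

lemma lifespan_law_T:
  assumes "0 \<le> \<beta>"
  shows "distr M borel (T u) = lifespan_law"
proof -
  have "distr M borel (T v) = distr (distr M particle_space (particle v)) borel snd" for v
    by (subst distr_distr) (auto simp: comp_def particle_def)
  then show ?thesis
    unfolding lifespan_law_def using particle_law[OF assms, of u "[]"] by simp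
qed

text \<open>The split time of i # w is that of w plus the independent lifespan of i # w;
  conditioning on this lifespan reproduces the recursion of \<open>renewal_term\<close>.\<close>

lemma split_time_distribution:
  assumes \<beta>: "0 \<le> \<beta>"
  shows "emeasure M {\<omega> \<in> space M. split_time (config \<omega>) w \<le> t} = renewal_term lifespan_law (length w) t"
proof (induction w arbitrary: t)
  case Nil
  have "emeasure M {\<omega> \<in> space M. split_time (config \<omega>) [] \<le> t} = (\<integral>\<^sup>+\<omega>. indicator {\<omega> \<in> space M. T [] \<omega> \<le> t} \<omega> \<partial>M)"
    by (simp add: split_time_def snd_config)
  also have "\<dots> = (\<integral>\<^sup>+\<omega>. unit_step (t - T [] \<omega>) \<partial>M)"
    by (intro nn_integral_cong) (auto simp: indicator_def)
  also have "\<dots> = renewal_term lifespan_law (length ([] :: bool list)) t"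
    by (simp add: measure_conv_def lifespan_law_def nn_integral_distr)
  finally show ?case .
next
  case (Cons i w)
  have d: "{i # w} \<inter> {v. suffix v w} = {}"
    by (auto simp: suffix_def)
  let ?F = "\<lambda>p. unit_step (t - snd ((fst p :: config) (i # w)) - split_time (snd p) w)"
  have "emeasure M {\<omega> \<in> space M. split_time (config \<omega>) (i # w) \<le> t} = (\<integral>\<^sup>+\<omega>. indicator {\<omega> \<in> space M. split_time (config \<omega>) (i # w) \<le> t} \<omega> \<partial>M)"
    by simp
  also have "\<dots> = (\<integral>\<^sup>+\<omega>. ?F (config \<omega>, config \<omega>) \<partial>M)"
    by (intro nn_integral_cong) (auto simp: indicator_def split_time_def)
  also have "\<dots> = (\<integral>\<^sup>+\<omega>. \<integral>\<^sup>+\<omega>'. ?F (config \<omega>, config \<omega>') \<partial>M \<partial>M)"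
  proof (rule nn_integral_disjoint[OF \<beta> d])
    show "?F \<in> borel_measurable (PiM UNIV (\<lambda>_. particle_space) \<Otimes>\<^sub>M PiM UNIV (\<lambda>_. particle_space))"
      by measurable
    fix \<zeta> \<zeta>' \<xi> \<xi>' :: config
    assume "\<And>u. u \<in> {i # w} \<Longrightarrow> \<zeta> u = \<zeta>' u" "\<And>u. u \<in> {v. suffix v w} \<Longrightarrow> \<xi> u = \<xi>' u"
    then show "?F (\<zeta>, \<xi>) = ?F (\<zeta>', \<xi>')"
      using split_time_cong[of w \<xi> \<xi>'] by simp
  qed
  also have "\<dots> = (\<integral>\<^sup>+\<omega>. renewal_term lifespan_law (length w) (t - T (i # w) \<omega>) \<partial>M)"
  proof (rule nn_integral_cong)
    fix \<omega>
    have "(\<integral>\<^sup>+\<omega>'. ?F (config \<omega>, config \<omega>') \<partial>M) = (\<integral>\<^sup>+\<omega>'. indicator {\<omega>' \<in> space M. split_time (config \<omega>') w \<le> t - T (i # w) \<omega>} \<omega>' \<partial>M)"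
      by (intro nn_integral_cong) (auto simp: indicator_def snd_config)
    also have "\<dots> = emeasure M {\<omega>' \<in> space M. split_time (config \<omega>') w \<le> t - T (i # w) \<omega>}"
      by simp
    finally show "(\<integral>\<^sup>+\<omega>'. ?F (config \<omega>, config \<omega>') \<partial>M) = renewal_term lifespan_law (length w) (t - T (i # w) \<omega>)"
      by (simp add: Cons.IH)
  qed
  also have "\<dots> = (\<integral>\<^sup>+r. renewal_term lifespan_law (length w) (t - r) \<partial>distr M borel (T (i # w)))"
  proof -
    have "sigma_finite_measure lifespan_law"
      unfolding lifespan_law_def by (intro prob_space_imp_sigma_finite prob_space_distr) measurable
    then have [measurable]: "renewal_term lifespan_law k \<in> borel_measurable borel" for k
      by (induction k) (auto intro!: measurable_measure_conv simp: lifespan_law_def)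
    show ?thesis
      by (subst nn_integral_distr) auto
  qed
  also have "\<dots> = renewal_term lifespan_law (length (i # w)) t"
    by (simp add: lifespan_law_T \<beta> measure_conv_def)
  finally show ?case .
qed

lemma lifespan_survival:
  assumes \<beta>: "0 \<le> \<beta>" and t: "0 \<le> t"
  shows "measure_conv lifespan_law unit_step t = ennreal (1 - std_brownian_motion.local_survival M (B []) \<beta> t)"
proof -
  interpret W: std_brownian_motion M "B []" by (rule B_brownian)
  have "prob {\<omega> \<in> space M. t < T [] \<omega>} = (\<integral>\<omega>. code_survival \<beta> t (path_code (B []) \<omega>) \<partial>M)"
    using prob_particles[OF \<beta>, where J = "{[]}" and A = "\<lambda>_. space code_space" and t = "\<lambda>_. t"] sets.top[of code_space]
    by (simp add: space_PiM)
  also have "\<dots> = W.local_survival \<beta> t"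
    unfolding W.local_survival_def
  proof (rule integral_cong_AE)
    show "AE \<omega> in M. code_survival \<beta> t (path_code (B []) \<omega>) = exp (- (\<beta> * code_local_time (path_code (B []) \<omega>) t))"
      using W.AE_code_local_time_nonneg[OF t] by eventually_elim (use t in \<open>simp add: code_survival_def\<close>)
  qed measurable
  finally have surv: "prob {\<omega> \<in> space M. t < T [] \<omega>} = W.local_survival \<beta> t" .
  have "measure_conv lifespan_law unit_step t = (\<integral>\<^sup>+\<omega>. unit_step (t - T [] \<omega>) \<partial>M)"
    by (simp add: measure_conv_def lifespan_law_def nn_integral_distr)
  also have "\<dots> = (\<integral>\<^sup>+\<omega>. indicator (space M - {\<omega> \<in> space M. t < T [] \<omega>}) \<omega> \<partial>M)"
    by (intro nn_integral_cong) (auto simp: indicator_def)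
  also have "\<dots> = emeasure M (space M - {\<omega> \<in> space M. t < T [] \<omega>})"
    by (rule nn_integral_indicator) measurable
  also have "\<dots> = ennreal (1 - prob {\<omega> \<in> space M. t < T [] \<omega>})"
    unfolding emeasure_eq_measure by (subst prob_compl) auto
  finally show ?thesis by (simp add: surv)
qed

lemma lifespan_nonneg: "AE r in lifespan_law. 0 \<le> r"
  unfolding lifespan_law_def by (subst AE_distr_iff) (auto simp: T_nonneg)

text \<open>With u the survival function and F = 1 - u, the Volterra equation reads F = q * u, and
  adding q * F on both sides gives q convolved with u + F = 1. In this form the equation contains no
  difference.\<close>

lemma lifespan_Volterra:
  assumes \<beta>: "0 \<le> \<beta>"
  shows "measure_conv lifespan_law unit_step t + conv (sqrt_kernel \<beta>) (measure_conv lifespan_law unit_step) t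
    = conv (sqrt_kernel \<beta>) unit_step t"
proof -
  interpret W: std_brownian_motion M "B []" by (rule B_brownian)
  let ?F = "measure_conv lifespan_law unit_step" and ?u = "W.local_survival \<beta>" and ?K = "sqrt_kernel \<beta>"
  have neg: "?F s = 0" if "s < 0" for s
  proof -
    have "?F s = (\<integral>\<^sup>+r. 0 \<partial>lifespan_law)"
      unfolding measure_conv_def using that by (intro nn_integral_cong_AE eventually_mono[OF lifespan_nonneg]) auto
    then show ?thesis by simp
  qed
  have sf: "sigma_finite_measure lifespan_law"
    unfolding lifespan_law_def by (intro prob_space_imp_sigma_finite prob_space_distr) measurable
  have [measurable]: "?F \<in> borel_measurable borel"
    by (rule measurable_measure_conv[OF sf]) (simp_all add: lifespan_law_def)
  show ?thesis
  proof (cases "0 \<le> t")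
    case False
    have zero: "conv ?K f t = 0" if "\<And>s. s < 0 \<Longrightarrow> f s = 0" for f
    proof -
      have "?K s * f (t - s) = 0" for s
        using False that[of "t - s"] by (auto simp: sqrt_kernel_def)
      then show ?thesis by (simp only: conv_def nn_integral_const mult_zero_left)
    qed
    from zero[of ?F, OF neg] zero[of unit_step] show ?thesis
      using neg[of t] False by simp
  next
    case t: True
    let ?g = "\<lambda>s. \<beta> * (1 / sqrt (2 * pi * s) * ?u (t - s))"
    note V = W.local_survival_Volterra[OF \<beta> t]
    have u: "0 \<le> ?u (t - s)" "?u (t - s) \<le> 1" if "s \<le> t" for s
      using that W.local_survival_bounds[OF \<beta>] by auto
    have "?F t = ennreal (LINT s:{0..t}|lborel. ?g s)"
      by (simp only: lifespan_survival[OF \<beta> t] V(1))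
    also have "\<dots> = (\<integral>\<^sup>+s. ennreal (indicator {0..t} s *\<^sub>R ?g s) \<partial>lborel)"
      unfolding set_lebesgue_integral_def
      using V(2) u \<beta> by (intro nn_integral_eq_integral[symmetric]) (auto simp: set_integrable_def indicator_def)
    also have "\<dots> = (\<integral>\<^sup>+s. ?K s * (ennreal (?u (t - s)) * indicator {0..t} s) \<partial>lborel)"
    proof (intro nn_integral_cong_AE eventually_mono[OF AE_lborel_singleton[of "0::real"]])
      fix s :: real assume "s \<noteq> 0"
      then show "ennreal (indicator {0..t} s *\<^sub>R ?g s) = ?K s * (ennreal (?u (t - s)) * indicator {0..t} s)"
        using u[of s] \<beta> by (auto simp: indicator_def sqrt_kernel_def ennreal_mult[symmetric])
    qed
    finally have F: "?F t = (\<integral>\<^sup>+s. ?K s * (ennreal (?u (t - s)) * indicator {0..t} s) \<partial>lborel)" .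
    \<comment> \<open>Measurability of the survival function is taken from that of the distribution
      function, of which it is the complement on the relevant interval.\<close>
    have meas: "(\<lambda>s. ?K s * (ennreal (?u (t - s)) * indicator {0..t} s)) \<in> borel_measurable lborel"
    proof -
      have "ennreal (?u (t - s)) * indicator {0..t} s = (1 - ?F (t - s)) * indicator {0..t} s" for s
      proof (cases "s \<in> {0..t}")
        case True
        then have "1 - ?F (t - s) = ennreal 1 - ennreal (1 - ?u (t - s))"
          using lifespan_survival[OF \<beta>, of "t - s"] by simp
        also have "\<dots> = ennreal (?u (t - s))"
          using u[of s] True by (subst ennreal_minus) auto
        finally show ?thesis by simp
      qed simp
      then show ?thesis by simp
    qed
    have "?F t + conv ?K ?F t = (\<integral>\<^sup>+s. ?K s * (ennreal (?u (t - s)) * indicator {0..t} s) + ?K s * ?F (t - s) \<partial>lborel)"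
      unfolding F conv_def using meas by (intro nn_integral_add[symmetric]) auto
    also have "\<dots> = conv ?K unit_step t"
      unfolding conv_def
    proof (rule nn_integral_cong)
      fix s
      show "?K s * (ennreal (?u (t - s)) * indicator {0..t} s) + ?K s * ?F (t - s) = ?K s * unit_step (t - s)"
      proof (cases "0 < s")
        case True
        then show ?thesis
          using lifespan_survival[OF \<beta>, of "t - s"] u[of s] neg[of "t - s"]
          by (cases "s \<le> t") (auto simp flip: distrib_left ennreal_plus)
      qed (simp add: sqrt_kernel_def)
    qed
    finally show ?thesis .
  qed
qed

text \<open>The image of counting measure times probability under the split times: a set of times
  receives the expected number of splits in it. Lifespans are real-valued, so every label has a
  split time.\<close>

definition split_intensity :: "real measure" where
  "split_intensity = distr (count_space UNIV \<Otimes>\<^sub>M M) borel (\<lambda>p. split_time (config (snd p)) (fst p))"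

lemma nn_integral_split_intensity:
  assumes [measurable]: "\<Gamma> \<in> borel_measurable borel"
  shows "(\<integral>\<^sup>+s. \<Gamma> s \<partial>split_intensity) = (\<integral>\<^sup>+w. \<integral>\<^sup>+\<omega>. \<Gamma> (split_time (config \<omega>) w) \<partial>M \<partial>count_space UNIV)"
proof -
  have "(\<integral>\<^sup>+s. \<Gamma> s \<partial>split_intensity) = (\<integral>\<^sup>+p. \<Gamma> (split_time (config (snd p)) (fst p)) \<partial>(count_space UNIV \<Otimes>\<^sub>M M))"
    unfolding split_intensity_def by (subst nn_integral_distr) auto
  also have "\<dots> = (\<integral>\<^sup>+w. \<integral>\<^sup>+\<omega>. \<Gamma> (split_time (config \<omega>) w) \<partial>M \<partial>count_space UNIV)"
    by (subst nn_integral_fst[symmetric]) auto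
  finally show ?thesis .
qed

text \<open>Summing the distribution functions of the split times over the 2^k labels of each length
  k produces the series whose value is \<open>excess\<close>. The density has the same, finite, mass
  on every half-line.\<close>

lemma split_intensity_eq:
  assumes \<beta>: "0 < \<beta>"
  shows "split_intensity = density lborel (growth_density \<beta>)"
proof -
  have b0: "0 \<le> \<beta>" using \<beta> by simp
  note [measurable] = measurable_growth_density[OF b0]
  have ps: "prob_space lifespan_law"
    unfolding lifespan_law_def by (rule prob_space_distr) measurable
  have le: "emeasure split_intensity {..t} = excess \<beta> t" for t
  proof -
    have "emeasure split_intensity {..t} = (\<integral>\<^sup>+s. indicator {..t} s \<partial>split_intensity)"
      by (rule nn_integral_indicator[symmetric]) (simp add: split_intensity_def)
    also have "\<dots> = (\<integral>\<^sup>+w. \<integral>\<^sup>+\<omega>. indicator {..t} (split_time (config \<omega>) w) \<partial>M \<partial>count_space UNIV)"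
      by (rule nn_integral_split_intensity) measurable
    also have "\<dots> = (\<integral>\<^sup>+(w :: bool list). renewal_term lifespan_law (length w) t \<partial>count_space UNIV)"
    proof (rule nn_integral_cong)
      fix w :: "bool list"
      have "(\<integral>\<^sup>+\<omega>. indicator {..t} (split_time (config \<omega>) w) \<partial>M) = (\<integral>\<^sup>+\<omega>. indicator {\<omega> \<in> space M. split_time (config \<omega>) w \<le> t} \<omega> \<partial>M)"
        by (intro nn_integral_cong) (auto simp: indicator_def)
      then show "(\<integral>\<^sup>+\<omega>. indicator {..t} (split_time (config \<omega>) w) \<partial>M) = renewal_term lifespan_law (length w) t"
        by (simp add: split_time_distribution[OF b0, symmetric])
    qed
    also have "\<dots> = (\<Sum>k. 2 ^ k * renewal_term lifespan_law k t)"
      by (rule nn_integral_count_space_length)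
    also have "\<dots> = excess \<beta> t"
      by (rule excess_eq_suminf[OF \<beta> ps _ lifespan_nonneg lifespan_Volterra[OF b0]]) (simp add: lifespan_law_def)
    finally show ?thesis .
  qed
  have dens: "emeasure (density lborel (growth_density \<beta>)) {..t} = excess \<beta> t" for t
  proof -
    have "emeasure (density lborel (growth_density \<beta>)) {..t} = (\<integral>\<^sup>+s. growth_density \<beta> s * indicator {..t} s \<partial>lborel)"
      by (rule emeasure_density) auto
    also have "\<dots> = conv (growth_density \<beta>) unit_step t"
      unfolding conv_def by (intro nn_integral_cong) (auto simp: indicator_def)
    finally show ?thesis by (simp add: excess_eq_conv[OF \<beta>])
  qed
  show ?thesis
  proof (rule measure_eqI_generator_eq[where E = "range atMost" and \<Omega> = UNIV and A = "\<lambda>n. {..real n}"])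
    show "Int_stable (range atMost :: real set set)"
      by (auto simp: Int_stable_def)
    show "sets split_intensity = sigma_sets UNIV (range atMost)"
      "sets (density lborel (growth_density \<beta>)) = sigma_sets UNIV (range atMost)"
      unfolding split_intensity_def by (simp_all add: borel_eq_atMost)
    show "(\<Union>n. {..real n}) = UNIV"
      by (auto intro: real_arch_simple)
    show "emeasure split_intensity {..real n} \<noteq> \<infinity>" for n
      by (simp add: le excess_def)
  qed (auto simp: le dens)
qed

theorem many_to_two:
  assumes \<beta>: "0 < \<beta>" and [measurable]: "f \<in> borel_measurable borel" "g \<in> borel_measurable borel"
    and fg: "\<And>x. 0 \<le> f x" "\<And>x. 0 \<le> g x"
  shows "(\<integral>\<^sup>+\<omega>. particle_sum B T f t \<omega> * particle_sum B T g t \<omega> \<partial>M) =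
    mean_sum M B T (\<lambda>x. f x * g x) t +
    2 * (\<integral>\<^sup>+s\<in>{0..t}. mean_sum M B T f (t - s) * mean_sum M B T g (t - s) *
           ennreal (deriv (growth \<beta>) s) \<partial>lborel)"
proof -
  have b0: "0 \<le> \<beta>" using \<beta> by simp
  note [measurable] = measurable_growth_density[OF b0]
  define \<Gamma> where "\<Gamma> s = mean_config_sum f (t - s) * mean_config_sum g (t - s)" for s
  have [measurable]: "\<Gamma> \<in> borel_measurable borel"
    unfolding \<Gamma>_def[abs_def] by measurable
  let ?C = "\<lambda>\<omega> w i. config_sum f (subtree (i # w) (config \<omega>)) (t - split_time (config \<omega>) w) *
     config_sum g (subtree ((\<not> i) # w) (config \<omega>)) (t - split_time (config \<omega>) w)"
  have "(\<integral>\<^sup>+\<omega>. particle_sum B T f t \<omega> * particle_sum B T g t \<omega> \<partial>M) = (\<integral>\<^sup>+\<omega>. config_sum f (config \<omega>) t * config_sum g (config \<omega>) t \<partial>M)"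
    by (intro nn_integral_cong_AE eventually_mono[OF AE_particle_sum[OF b0]]) simp
  also have "\<dots> = (\<integral>\<^sup>+\<omega>. config_sum (\<lambda>x. f x * g x) (config \<omega>) t + (\<integral>\<^sup>+w. \<integral>\<^sup>+i. ?C \<omega> w i \<partial>count_space UNIV \<partial>count_space UNIV) \<partial>M)"
    by (intro nn_integral_cong config_sum_mult config_nonneg fg)
  also have "\<dots> = mean_config_sum (\<lambda>x. f x * g x) t + (\<integral>\<^sup>+\<omega>. \<integral>\<^sup>+w. \<integral>\<^sup>+i. ?C \<omega> w i \<partial>count_space UNIV \<partial>count_space UNIV \<partial>M)"
  proof -
    have "(\<lambda>\<omega>. \<integral>\<^sup>+w. \<integral>\<^sup>+i. ?C \<omega> w i \<partial>count_space UNIV \<partial>count_space UNIV) \<in> borel_measurable M"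
    proof -
      interpret S: sigma_finite_measure "count_space (UNIV :: bool list set)"
        by (rule sigma_finite_measure_count_space)
      have "(\<lambda>q. \<integral>\<^sup>+i. ?C (snd q) (fst q) i \<partial>count_space UNIV) \<in> borel_measurable (count_space UNIV \<Otimes>\<^sub>M M)"
        by (rule measurable_pair_measure_countable1) (simp_all add: nn_integral_count_space_finite UNIV_bool)
      from measurable_compose[OF _ this, of "\<lambda>q. (snd q, fst q)" "M \<Otimes>\<^sub>M count_space UNIV"]
      have "(\<lambda>q. \<integral>\<^sup>+i. ?C (fst q) (snd q) i \<partial>count_space UNIV) \<in> borel_measurable (M \<Otimes>\<^sub>M count_space UNIV)"
        by simp
      then show ?thesis
        by (intro S.borel_measurable_nn_integral) (simp add: case_prod_unfold)
    qed
    then show ?thesis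
      unfolding mean_config_sum_def by (intro nn_integral_add) measurable
  qed
  also have "(\<integral>\<^sup>+\<omega>. \<integral>\<^sup>+w. \<integral>\<^sup>+i. ?C \<omega> w i \<partial>count_space UNIV \<partial>count_space UNIV \<partial>M) = (\<integral>\<^sup>+w. \<integral>\<^sup>+\<omega>. \<integral>\<^sup>+i. ?C \<omega> w i \<partial>count_space UNIV \<partial>M \<partial>count_space UNIV)"
    by (rule nn_integral_count_space_nn_integral) (simp_all add: nn_integral_count_space_finite UNIV_bool)
  also have "\<dots> = (\<integral>\<^sup>+w. \<integral>\<^sup>+i. \<integral>\<^sup>+\<omega>. ?C \<omega> w i \<partial>M \<partial>count_space UNIV \<partial>count_space UNIV)"
    by (intro nn_integral_cong nn_integral_count_space_nn_integral) auto
  also have "\<dots> = (\<integral>\<^sup>+w. \<integral>\<^sup>+(i::bool). \<integral>\<^sup>+\<omega>. \<Gamma> (split_time (config \<omega>) w) \<partial>M \<partial>count_space UNIV \<partial>count_space UNIV)"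
    unfolding \<Gamma>_def by (intro nn_integral_cong expectation_pair b0) measurable
  \<comment> \<open>The integrand no longer depends on which child carries the first particle, so
    the sum over \<open>i\<close> is a factor 2.\<close>
  also have "\<dots> = 2 * (\<integral>\<^sup>+w. \<integral>\<^sup>+\<omega>. \<Gamma> (split_time (config \<omega>) w) \<partial>M \<partial>count_space UNIV)"
  proof -
    have inner: "(\<integral>\<^sup>+(i::bool). c \<partial>count_space UNIV) = 2 * c" for c :: ennreal
      by (simp add: nn_integral_count_space_finite UNIV_bool) (rule mult.commute)
    show ?thesis
      by (simp only: inner) (rule nn_integral_cmult, simp)
  qed
  also have "(\<integral>\<^sup>+w. \<integral>\<^sup>+\<omega>. \<Gamma> (split_time (config \<omega>) w) \<partial>M \<partial>count_space UNIV) = (\<integral>\<^sup>+s. \<Gamma> s \<partial>density lborel (growth_density \<beta>))"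
    by (simp add: nn_integral_split_intensity flip: split_intensity_eq[OF \<beta>])
  also have "\<dots> = (\<integral>\<^sup>+s. growth_density \<beta> s * \<Gamma> s \<partial>lborel)"
    by (rule nn_integral_density) measurable
  also have "\<dots> = (\<integral>\<^sup>+s\<in>{0..t}. mean_sum M B T f (t - s) * mean_sum M B T g (t - s) * ennreal (deriv (growth \<beta>) s) \<partial>lborel)"
  \<comment> \<open>At s = 0 the value of \<open>deriv\<close> is not controlled, since the
    derivative of m tends to infinity there from the right; this is a null set. Beyond
    \<open>t\<close> the means vanish because their time is negative, and before 0 the density
    does.\<close>
  proof (intro nn_integral_cong_AE eventually_mono[OF AE_lborel_singleton[of "0::real"]])
    fix s :: real assume s: "s \<noteq> 0"
    have "growth_density \<beta> s * \<Gamma> s = 0" if "s \<notin> {0..t}"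
      using that mean_config_sum_neg[of "t - s"] by (auto simp: \<Gamma>_def growth_density_def)
    then show "growth_density \<beta> s * \<Gamma> s = mean_sum M B T f (t - s) * mean_sum M B T g (t - s) * ennreal (deriv (growth \<beta>) s) * indicator {0..t} s"
      using s by (cases "s \<in> {0..t}") (auto simp: mean_sum_eq b0 \<Gamma>_def growth_density_eq_deriv[OF \<beta>] mult.commute)
  qed
  finally show ?thesis
    by (simp add: mean_sum_eq b0)
qed

end

theorem proposition2p4:
  fixes M :: "'w measure" and \<beta> :: real
    and B :: "bool list \<Rightarrow> real \<Rightarrow> 'w \<Rightarrow> real" and T :: "bool list \<Rightarrow> 'w \<Rightarrow> real"
    and f g :: "real \<Rightarrow> real" and t :: real
  assumes "\<beta> > 0"
    and "catalytic_bbm M \<beta> B T"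
    and "f \<in> borel_measurable borel" and "\<And>x. 0 \<le> f x"
    and "g \<in> borel_measurable borel" and "\<And>x. 0 \<le> g x"
    and "0 \<le> t"
  shows "(\<integral>\<^sup>+\<omega>. particle_sum B T f t \<omega> * particle_sum B T g t \<omega> \<partial>M) =
    mean_sum M B T (\<lambda>x. f x * g x) t +
    2 * (\<integral>\<^sup>+s\<in>{0..t}. mean_sum M B T f (t - s) * mean_sum M B T g (t - s) *
           ennreal (deriv (\<lambda>r. 2 * std_normal_cdf (\<beta> * sqrt r) * exp (\<beta>\<^sup>2 / 2 * r)) s) \<partial>lborel)"
  using catalytic_bbm.many_to_two[OF assms(2,1,3,5,4,6), of t]
  unfolding growth_def[abs_def] .

end
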